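(* In the discrete-weight (geometric) model, let $\bar{\boldsymbol\theta}^*=\bar{\boldsymbol\theta}^*_n$ satisfy $q_n\le\bar\alpha_i^*+\bar\beta_j^*\le Q_n$ for all $i\ne j$ with $0<q_n\le Q_n$, and let $A\sim\mathbb{P}_{\bar{\boldsymbol\theta}^*}$. If $e^{9Q_n}(1+q_n^{-15})=o\bigl(n^{1/2}/\log n\bigr)$, then for every fixed $k\ge1$, as $n\to\infty$, the vector of the first $k$ coordinates of $\hat{\boldsymbol\theta}-\bar{\boldsymbol\theta}^*$ is asymptotically multivariate normal with mean zero and covariance matrix equal to the upper-left $k\times k$ block $S_{[k]}$ of $S$; i.e. $S_{[k]}^{-1/2}(\hat{\boldsymbol\theta}-\bar{\boldsymbol\theta}^* )_{1:k}\to N(0,I_k)$ in distribution.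
   Context: Discrete-weight model: parameters $\bar{\boldsymbol\theta}=(\bar\alpha_1,\dots,\bar\alpha_n,\bar\beta_1,\dots,\bar\beta_{n-1})^\top$, $\bar\beta_n:=0$, $\bar\alpha_i+\bar\beta_j>0$ for $i\ne j$. Under $\mathbb{P}_{\bar{\boldsymbol\theta}}$, $A=(a_{i,j})$ has $a_{i,i}=0$ and independent entries $a_{i,j}$ ($i\ne j$) with $\mathbb{P}(a_{i,j}=a)=(1-e^{-(\bar\alpha_i+\bar\beta_j)})e^{-(\bar\alpha_i+\bar\beta_j)a}$, $a\in\{0,1,2,\dots\}$. $d_i=\sum_{j\ne i}a_{i,j}$, $b_j=\sum_{i\ne j}a_{i,j}$. The MLE $\hat{\boldsymbol\theta}$ (with $\hat\beta_n=0$) solves $d_i=\sum_{k\ne i}\frac{1}{e^{\hat\alpha_i+\hat\beta_k}-1}$ ($i\le n$), $b_j=\sum_{k\ne j}\frac{1}{e^{\hat\alpha_k+\hat\beta_j}-1}$ ($j\le n-1$). Fisher information at $\bar{\boldsymbol\theta}^*$: with $u(x)=e^x/(e^x-1)^2$, $v_{i,i}=\sum_{k\ne i}u(\bar\alpha_i^*+\bar\beta_k^* )$ ($i\le n$), $v_{n+j,n+j}=\sum_{k\ne j}u(\bar\alpha_k^*+\bar\beta_j^* )$ ($j\le n-1$), $v_{i,n+j}=v_{n+j,i}=u(\bar\alpha_i^*+\bar\beta_j^* )$ for $i\ne j$, other off-diagonal entries zero. $v_{2n,i}:=v_{i,i}-\sum_{j\le2n-1,j\ne i}v_{i,j}$,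 $v_{2n,2n}:=\sum_{i=1}^{2n-1}v_{2n,i}$. $S=(s_{i,j})$: $s_{i,j}=\delta_{i,j}/v_{i,i}+1/v_{2n,2n}$ if $i,j\in\{1,\dots,n\}$ or $i,j\in\{n+1,\dots,2n-1\}$, else $s_{i,j}=-1/v_{2n,2n}$. *)

theory Defs
  imports "HOL-Analysis.Analysis" "HOL-Probability.Probability" "HOL-Library.Landau_Symbols"
begin

text \<open>Parameter vectors are functions nat => real; for size n the meaningful
coordinates are 1..2n-1: alpha_i = theta i (1 <= i <= n), beta_j = theta (n+j)
(1 <= j <= n-1), and beta_n = 0.\<close>

definition alpha :: "(nat \<Rightarrow> real) \<Rightarrow> nat \<Rightarrow> real" where
  "alpha \<theta> i = \<theta> i"

definition beta :: "nat \<Rightarrow> (nat \<Rightarrow> real) \<Rightarrow> nat \<Rightarrow> real" where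
  "beta n \<theta> j = (if j = n then 0 else \<theta> (n + j))"

definition offdiag :: "nat \<Rightarrow> (nat \<times> nat) set" where
  "offdiag n = {(i, j). i \<in> {1..n} \<and> j \<in> {1..n} \<and> i \<noteq> j}"

definition geom_model :: "nat \<Rightarrow> (nat \<Rightarrow> real) \<Rightarrow> (nat \<times> nat \<Rightarrow> nat) pmf" where
  "geom_model n \<theta> = Pi_pmf (offdiag n) 0
     (\<lambda>(i, j). geometric_pmf (1 - exp (- (alpha \<theta> i + beta n \<theta> j))))"

definition out_deg :: "nat \<Rightarrow> (nat \<times> nat \<Rightarrow> nat) \<Rightarrow> nat \<Rightarrow> real" where
  "out_deg n A i = real (\<Sum>j\<in>{1..n} - {i}. A (i, j))"

definition in_deg :: "nat \<Rightarrow> (nat \<times> nat \<Rightarrow> nat) \<Rightarrow> nat \<Rightarrow> real" where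
  "in_deg n A j = real (\<Sum>i\<in>{1..n} - {j}. A (i, j))"

text \<open>theta is an (admissible) solution of the likelihood equations, i.e. the MLE.\<close>
definition is_mle :: "nat \<Rightarrow> (nat \<times> nat \<Rightarrow> nat) \<Rightarrow> (nat \<Rightarrow> real) \<Rightarrow> bool" where
  "is_mle n A \<theta> \<longleftrightarrow>
     (\<forall>i\<in>{1..n}. \<forall>j\<in>{1..n}. i \<noteq> j \<longrightarrow> alpha \<theta> i + beta n \<theta> j > 0) \<and>
     (\<forall>i\<in>{1..n}. out_deg n A i =
        (\<Sum>k\<in>{1..n} - {i}. 1 / (exp (alpha \<theta> i + beta n \<theta> k) - 1))) \<and>
     (\<forall>j\<in>{1..n-1}. in_deg n A j =
        (\<Sum>k\<in>{1..n} - {j}. 1 / (exp (alpha \<theta> k + beta n \<theta> j) - 1)))"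

definition u_fun :: "real \<Rightarrow> real" where
  "u_fun x = exp x / (exp x - 1)^2"

text \<open>Fisher information entries v_{a,b}, 1 <= a,b <= 2n-1.\<close>
definition vmat :: "nat \<Rightarrow> (nat \<Rightarrow> real) \<Rightarrow> nat \<Rightarrow> nat \<Rightarrow> real" where
  "vmat n \<theta> a b =
     (if a = b \<and> a \<in> {1..n} then (\<Sum>k\<in>{1..n} - {a}. u_fun (alpha \<theta> a + beta n \<theta> k))
      else if a = b \<and> a \<in> {n+1..2*n-1} then
        (\<Sum>k\<in>{1..n} - {a - n}. u_fun (alpha \<theta> k + beta n \<theta> (a - n)))
      else if a \<in> {1..n} \<and> b \<in> {n+1..2*n-1} \<and> a \<noteq> b - n then
        u_fun (alpha \<theta> a + beta n \<theta> (b - n))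
      else if b \<in> {1..n} \<and> a \<in> {n+1..2*n-1} \<and> b \<noteq> a - n then
        u_fun (alpha \<theta> b + beta n \<theta> (a - n))
      else 0)"

definition v2n :: "nat \<Rightarrow> (nat \<Rightarrow> real) \<Rightarrow> nat \<Rightarrow> real" where
  "v2n n \<theta> i = vmat n \<theta> i i - (\<Sum>j\<in>{1..2*n-1} - {i}. vmat n \<theta> i j)"

definition v2n2n :: "nat \<Rightarrow> (nat \<Rightarrow> real) \<Rightarrow> real" where
  "v2n2n n \<theta> = (\<Sum>i\<in>{1..2*n-1}. v2n n \<theta> i)"

definition Smat :: "nat \<Rightarrow> (nat \<Rightarrow> real) \<Rightarrow> nat \<Rightarrow> nat \<Rightarrow> real" where
  "Smat n \<theta> a b =
     (if (a \<in> {1..n} \<and> b \<in> {1..n}) \<or> (a \<in> {n+1..2*n-1} \<and> b \<in> {n+1..2*n-1})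
      then (if a = b then 1 / vmat n \<theta> a a else 0) + 1 / v2n2n n \<theta>
      else - 1 / v2n2n n \<theta>)"

definition inv_sqrt_mat :: "real^'k^'k \<Rightarrow> real^'k^'k" where
  "inv_sqrt_mat M = (THE R. transpose R = R \<and> (\<forall>x. x \<noteq> 0 \<longrightarrow> 0 < x \<bullet> (R *v x))
                          \<and> R ** R = matrix_inv M)"

definition std_normal_vec :: "(real^'k) measure" where
  "std_normal_vec = density lborel (\<lambda>x. ennreal (\<Prod>a\<in>UNIV. std_normal_density (x $ a)))"

definition conv_in_distr ::
  "(nat \<Rightarrow> 'a measure) \<Rightarrow> (nat \<Rightarrow> 'a \<Rightarrow> real^'k) \<Rightarrow> (real^'k) measure \<Rightarrow> bool" where
  "conv_in_distr M X L \<longleftrightarrow>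
     (\<forall>f :: real^'k \<Rightarrow> real. continuous_on UNIV f \<and> bounded (range f) \<longrightarrow>
        (\<lambda>n. \<integral>x. f (X n x) \<partial>(M n)) \<longlonglongrightarrow> (\<integral>y. f y \<partial>L))"

end

theory Submission
  imports Defs
begin

text \<open>Perturb the true parameters by \<open>x\<close> on the \<open>\<alpha>\<close> side and by \<open>-y\<close> on the \<open>\<beta>\<close> side. The likelihood
  depends only on the differences \<open>x i - y j\<close>, and its Hessian is the weighted Laplacian of a bipartite
  graph whose weights are bounded above and below. A maximum principle bounds the oscillation of a
  solution of a Laplace equation by the size of the right-hand side. Used for a minimiser of the
  negative log-likelihood over a small box, it keeps the minimiser off the boundary, so that the MLE
  exists near the truth; strict monotonicity makes it unique. Used once more, after subtracting the
  diagonal part \<open>g i / v i\<close> of the solution, it shows that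
  the error of the MLE of \<open>\<alpha>\<^sub>i\<close> equals \<open>- (d i - \<bbbE> d i) / v i - (b n - \<bbbE> b n) / v\<^bsub>2n,2n\<^esub>\<close> up to
  \<open>O(p\<^bsup>11\<^esup> e\<^bsup>6Q\<^esup> log n / n)\<close> with \<open>p = max 1 (1/q)\<close>, because the right-hand side then consists of
  quadratic remainders and of averages over \<open>n\<^sup>2\<close> independent entries, both controlled by exponential
  tail bounds.

  The main term is a sum of independent centred variables. Its characteristic function is compared
  factor by factor with that of a normal variable, and convergence in distribution follows from a
  multivariate continuity theorem.\<close>

text \<open>The maximum principle turns a right-hand side of size \<open>G\<close> into an error of
  size \<open>G / n\<close>, up to powers of \<open>p\<close> and \<open>exp Q\<close>. For the
  likelihood equations themselves, \<open>G\<close> is a degree deviation of order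
  \<open>sqrt (n * log n)\<close>, so the first bound is of order \<open>sqrt (log n / n)\<close>.
  This exceeds the fluctuations of order \<open>1 / sqrt n\<close> that are sought, which is why a
  second pass is needed. Subtracting the diagonal part removes the degree deviations. What remains
  is a quadratic remainder of size \<open>n * r^2\<close>, of order \<open>log n\<close>, and sums
  over about \<open>n^2\<close> centred entries with weights of order \<open>1 / n\<close>, of order
  \<open>sqrt (log n)\<close>. The second error is of order \<open>log n / n\<close>; multiplied by
  the normalisation of order \<open>sqrt n\<close> it gives the \<open>log n / sqrt n\<close> of the
  rate hypothesis.

  Oscillation bounds leave an additive constant open. The gauge \<open>\<beta> n = 0\<close> fixes
  it, so the in-degree of \<open>n\<close> enters every coordinate of the error, and every entry of
  the block of \<open>S\<close> contains \<open>1 / v_{2n,2n}\<close>.\<close>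

section \<open>Inverse square roots of positive definite matrices\<close>

text \<open>The equation says \<open>(1 - Y)\<^sup>2 = 1 - B\<close>; half its right-hand side is a contraction in \<open>Y\<close> on the ball of radius \<open>norm B\<close>.\<close>

lemma square_root_contraction:
  fixes B :: "'v::euclidean_space \<Rightarrow>\<^sub>L 'v"
  assumes sym: "\<And>x y. blinfun_apply B x \<bullet> y = x \<bullet> blinfun_apply B y" and less: "norm B < 1"
  obtains Y :: "'v \<Rightarrow>\<^sub>L 'v" where "\<And>x y. blinfun_apply Y x \<bullet> y = x \<bullet> blinfun_apply Y y" "norm Y < 1"
    "2 *\<^sub>R Y = B + (Y o\<^sub>L Y)"
proof -
  define b where "b = norm B"
  define K where "K = {Y :: 'v \<Rightarrow>\<^sub>L 'v. norm Y \<le> b \<and> (\<forall>x y. blinfun_apply Y x \<bullet> y = x \<bullet> blinfun_apply Y y)}"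
  define F where "F Y = (1/2) *\<^sub>R (B + (Y o\<^sub>L Y))" for Y :: "'v \<Rightarrow>\<^sub>L 'v"
  have b: "0 \<le> b" "b < 1" using less by (auto simp: b_def)
  have "K = cball 0 b \<inter> (\<Inter>x. \<Inter>y. {Y. blinfun_apply Y x \<bullet> y = x \<bullet> blinfun_apply Y y})"
    by (auto simp: K_def)
  moreover have "closed {Y :: 'v \<Rightarrow>\<^sub>L 'v. blinfun_apply Y x \<bullet> y = x \<bullet> blinfun_apply Y y}" for x y
    by (intro closed_Collect_eq continuous_intros)
  ultimately have "closed K"
    by (auto intro!: closed_Int closed_INT)
  hence "Topological_Spaces.complete K" by (simp add: complete_eq_closed)
  moreover have "K \<noteq> {}" unfolding K_def using sym b_def by blast
  moreover have "F ` K \<subseteq> K"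
  proof
    fix Z assume "Z \<in> F ` K"
    then obtain Y where Y: "Y \<in> K" "Z = F Y" by auto
    have nY: "norm Y \<le> b" using Y by (simp add: K_def)
    have "norm Z \<le> (1/2) * (b + norm (Y o\<^sub>L Y))"
      using norm_triangle_ineq[of B "Y o\<^sub>L Y"] by (simp add: Y F_def b_def)
    also have "norm (Y o\<^sub>L Y) \<le> norm Y * norm Y" by (rule norm_blinfun_compose)
    also have "\<dots> \<le> b * 1" using nY b by (intro mult_mono) auto
    finally have "norm Z \<le> b" by simp
    moreover have "Z x \<bullet> y = x \<bullet> Z y" for x y
      using Y(1) sym unfolding Y(2) F_def K_def
      by (simp add: blinfun.bilinear_simps inner_simps)
    ultimately show "Z \<in> K" by (simp add: K_def)
  qed
  moreover have "\<forall>Y\<in>K. \<forall>Z\<in>K. dist (F Y) (F Z) \<le> b * dist Y Z"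
  proof (intro ballI)
    fix Y Z assume YZ: "Y \<in> K" "Z \<in> K"
    have "F Y - F Z = (1/2) *\<^sub>R ((Y o\<^sub>L (Y - Z)) + ((Y - Z) o\<^sub>L Z))"
      by (rule blinfun_eqI) (simp add: F_def blinfun.bilinear_simps algebra_simps)
    hence "norm (F Y - F Z) \<le> (1/2) * (norm (Y o\<^sub>L (Y - Z)) + norm ((Y - Z) o\<^sub>L Z))"
      using norm_triangle_ineq by auto
    also have "\<dots> \<le> (1/2) * (b * norm (Y - Z) + norm (Y - Z) * b)"
      using YZ b unfolding K_def
      by (intro mult_left_mono add_mono order.trans[OF norm_blinfun_compose] mult_mono) auto
    finally show "dist (F Y) (F Z) \<le> b * dist Y Z"
      by (simp add: dist_norm)
  qed
  ultimately obtain Y where Y: "Y \<in> K" "F Y = Y"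
    using Banach_fix[of K b F] b by auto
  have "B + (Y o\<^sub>L Y) = 2 *\<^sub>R F Y" by (simp add: F_def)
  with Y b show thesis
    by (intro that[of Y]) (auto simp: K_def)
qed

lemma sym_matrix_inner:
  fixes A :: "real^'k^'k"
  assumes "transpose A = A"
  shows "(A *v x) \<bullet> y = x \<bullet> (A *v y)"
  by (metis assms dot_lmul_matrix vector_transpose_matrix)

text \<open>Compactness of the unit sphere supplies a minimiser \<open>z\<close> of the quadratic
  form, and homogeneity carries its value over to all vectors.\<close>

lemma pos_def_lower_bound:
  fixes A :: "real^'k^'k"
  assumes pos: "\<And>x. x \<noteq> 0 \<Longrightarrow> 0 < x \<bullet> (A *v x)"
  obtains l where "0 < l" "\<And>x. l * (norm x)\<^sup>2 \<le> x \<bullet> (A *v x)"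
proof -
  have "continuous_on (sphere 0 1) (\<lambda>x. x \<bullet> (A *v x))"
    by (intro continuous_intros)
  moreover have "sphere (0::real^'k) 1 \<noteq> {}" by simp
  ultimately obtain z where z: "z \<in> sphere 0 1" "\<And>x. x \<in> sphere 0 1 \<Longrightarrow> z \<bullet> (A *v z) \<le> x \<bullet> (A *v x)"
    using continuous_attains_inf[of "sphere 0 1" "\<lambda>x. x \<bullet> (A *v x)"] compact_sphere by blast
  have "(z \<bullet> (A *v z)) * (norm x)\<^sup>2 \<le> x \<bullet> (A *v x)" for x
  proof (cases "x = 0")
    case False
    have "z \<bullet> (A *v z) \<le> (x /\<^sub>R norm x) \<bullet> (A *v (x /\<^sub>R norm x))"
      using False by (intro z) simp
    also have "\<dots> = (x \<bullet> (A *v x)) / (norm x)\<^sup>2"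
      by (simp add: matrix_vector_mult_scaleR power2_eq_square field_simps)
    finally show ?thesis using False by (simp add: field_simps)
  qed simp
  moreover have "0 < z \<bullet> (A *v z)" using z by (intro pos) auto
  ultimately show thesis using that by blast
qed

text \<open>After division by a suitable \<open>c\<close>, the operator \<open>B = 1 - A / c\<close>
  has norm below 1, and the contraction yields a symmetric \<open>Y\<close> with
  \<open>(1 - Y)^2 = A / c\<close>. The root is \<open>sqrt c\<close> times \<open>1 - Y\<close>,
  which is positive because \<open>norm Y < 1\<close>.\<close>

lemma pos_def_square_root_exists:
  fixes A :: "real^'k^'k"
  assumes sym: "transpose A = A" and pos: "\<And>x. x \<noteq> 0 \<Longrightarrow> 0 < x \<bullet> (A *v x)"
  shows "\<exists>R. transpose R = R \<and> (\<forall>x. x \<noteq> 0 \<longrightarrow> 0 < x \<bullet> (R *v x)) \<and> R ** R = A"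
proof -
  obtain l where l: "0 < l" "\<And>x. l * (norm x)\<^sup>2 \<le> x \<bullet> (A *v x)"
    using pos_def_lower_bound[OF pos] by blast
  obtain L where L: "0 < L" "\<And>x. norm (A *v x) \<le> norm x * L"
    using bounded_linear.pos_bounded[OF matrix_vector_mul_bounded_linear[of A]] by blast
  \<comment> \<open>The bound \<open>1 - 2 * l / c + (L / c)^2\<close> for
    \<open>(norm (B x) / norm x)^2\<close> is smallest at this \<open>c\<close>, with value
    \<open>1 - (l / L)^2\<close>.\<close>
  define c where "c = L\<^sup>2 / l"
  have c: "0 < c" using l L by (simp add: c_def)
  define B where "B = Blinfun (\<lambda>x. x - (1 / c) *\<^sub>R (A *v x))"
  have B: "blinfun_apply B x = x - (1 / c) *\<^sub>R (A *v x)" for x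
    unfolding B_def
    by (subst bounded_linear_Blinfun_apply)
      (auto intro!: bounded_linear_intros matrix_vector_mul_bounded_linear)
  have lL: "l \<le> L"
  proof -
    obtain x :: "real^'k" where x: "norm x = 1" using vector_choose_size[of 1] by auto
    have "l \<le> x \<bullet> (A *v x)" using l(2)[of x] x by simp
    also have "\<dots> \<le> norm x * norm (A *v x)" by (rule norm_cauchy_schwarz)
    finally show ?thesis using L(2)[of x] x by simp
  qed
  have "norm (B x) \<le> sqrt (1 - l\<^sup>2 / L\<^sup>2) * norm x" for x
  proof -
    have "(norm (B x))\<^sup>2 = (norm x)\<^sup>2 - 2 / c * (x \<bullet> (A *v x)) + (norm (A *v x))\<^sup>2 / c\<^sup>2"
      unfolding B power2_norm_eq_inner
      by (simp add: inner_simps inner_commute power2_eq_square algebra_simps)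
    also have "\<dots> \<le> (norm x)\<^sup>2 - 2 / c * (l * (norm x)\<^sup>2) + (norm x * L)\<^sup>2 / c\<^sup>2"
      using l(2)[of x] L(2)[of x] c
      by (intro add_mono diff_mono mult_left_mono divide_right_mono power_mono) auto
    also have "\<dots> = (1 - l\<^sup>2 / L\<^sup>2) * (norm x)\<^sup>2"
      using l L by (simp add: c_def field_simps power2_eq_square)
    finally show ?thesis
      by (metis norm_ge_zero real_le_rsqrt real_sqrt_abs real_sqrt_le_iff real_sqrt_mult abs_of_nonneg)
  qed
  hence "norm B \<le> sqrt (1 - l\<^sup>2 / L\<^sup>2)"
    using lL l L by (intro norm_blinfun_bound) (auto simp: power_mono divide_le_eq_1)
  also have "\<dots> < 1" using l L by simp
  finally have "norm B < 1" .
  moreover have "B x \<bullet> y = x \<bullet> B y" for x y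
    using sym_matrix_inner[OF sym] by (simp add: B inner_simps)
  ultimately obtain Y :: "(real^'k) \<Rightarrow>\<^sub>L (real^'k)" where
    Y: "\<And>x y. Y x \<bullet> y = x \<bullet> Y y" "norm Y < 1" "2 *\<^sub>R Y = B + (Y o\<^sub>L Y)"
    using square_root_contraction[of B] by blast
  define R where "R = matrix (\<lambda>x. sqrt c *\<^sub>R (x - Y x))"
  have lin: "linear (\<lambda>x. sqrt c *\<^sub>R (x - Y x))"
    by (auto intro!: linearI simp: blinfun.bilinear_simps algebra_simps)
  have R: "R *v x = sqrt c *\<^sub>R (x - Y x)" for x
    unfolding R_def by (rule matrix_works) (use lin in \<open>simp add: linear_matrix_vector_mul_eq\<close>)
  have symR: "(R *v x) \<bullet> y = x \<bullet> (R *v y)" for x y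
    using Y(1) by (simp add: R inner_simps)
  have "transpose R = R"
    by (metis dot_lmul_matrix matrix_eq symR transpose_matrix_vector vector_eq_rdot)
  moreover have "0 < x \<bullet> (R *v x)" if "x \<noteq> 0" for x
  proof -
    have "x \<bullet> Y x \<le> norm x * norm (Y x)" by (rule norm_cauchy_schwarz)
    also have "\<dots> \<le> norm x * (norm Y * norm x)"
      by (intro mult_left_mono norm_blinfun) auto
    also have "\<dots> < norm x * (1 * norm x)"
      using that Y(2) by (intro mult_strict_left_mono mult_strict_right_mono) auto
    finally have "x \<bullet> Y x < x \<bullet> x" by (simp add: dot_square_norm power2_eq_square)
    thus ?thesis using c by (simp add: R inner_simps)
  qed
  moreover have "R ** R = A"
  proof (subst matrix_eq, rule allI)
    fix x
    have "2 *\<^sub>R Y x = B x + Y (Y x)"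
      using arg_cong[OF Y(3), of "\<lambda>F. blinfun_apply F x"] by (simp add: blinfun.bilinear_simps)
    hence *: "x - Y x - (Y x - Y (Y x)) = x - B x" by (simp add: scaleR_2 algebra_simps)
    have "R *v (R *v x) = (sqrt c * sqrt c) *\<^sub>R (x - Y x - (Y x - Y (Y x)))"
      unfolding R by (simp add: blinfun.bilinear_simps algebra_simps)
    also have "\<dots> = c *\<^sub>R (x - B x)" using c unfolding * by simp
    also have "\<dots> = A *v x" using c by (simp add: B)
    finally show "(R ** R) *v x = A *v x" by (simp add: matrix_vector_mul_assoc)
  qed
  ultimately show ?thesis by blast
qed

text \<open>With \<open>D = R - T\<close>, the equation becomes \<open>R D = - D T\<close>, so the traces of \<open>D R D\<close> and \<open>D T D\<close> add
  up to zero, and both are non-negative.\<close>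

lemma pos_def_square_root_unique:
  fixes R T :: "real^'k^'k"
  assumes R: "transpose R = R" "\<And>x. x \<noteq> 0 \<Longrightarrow> 0 < x \<bullet> (R *v x)"
    and T: "transpose T = T" "\<And>x. x \<noteq> 0 \<Longrightarrow> 0 < x \<bullet> (T *v x)"
    and eq: "R ** R = T ** T"
  shows "R = T"
proof -
  define D where "D = R - T"
  have symD: "transpose D = D"
    using R(1) T(1) by (simp add: D_def transpose_def vec_eq_iff)
  have RD: "R *v (D *v x) = - (D *v (T *v x))" for x
  proof -
    have "R *v (R *v x) = T *v (T *v x)"
      using eq by (metis matrix_vector_mul_assoc)
    thus ?thesis
      by (simp add: D_def matrix_vector_mult_diff_rdistrib matrix_vector_mult_diff_distrib)
  qed
  have nonneg: "0 \<le> x \<bullet> (R *v x)" "0 \<le> x \<bullet> (T *v x)" for x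
    using R(2)[of x] T(2)[of x] by (cases "x = 0"; force)+
  \<comment> \<open>Cyclic invariance of the trace, \<open>Tr (D D T) = Tr (D T D)\<close>, computed
    in the standard basis.\<close>
  have tr: "(\<Sum>b\<in>Basis. b \<bullet> (D *v (D *v (T *v b)))) = (\<Sum>b\<in>Basis. (D *v b) \<bullet> (T *v (D *v b)))"
  proof -
    have "(\<Sum>b\<in>Basis. b \<bullet> (D *v (D *v (T *v b)))) = (\<Sum>b\<in>Basis. (D *v (T *v b)) \<bullet> (D *v b))"
      by (intro sum.cong refl) (metis sym_matrix_inner[OF symD] inner_commute)
    also have "\<dots> = (\<Sum>b\<in>Basis. (\<Sum>c\<in>Basis. ((D *v (T *v b)) \<bullet> c) * ((D *v b) \<bullet> c)))"
      by (subst euclidean_inner) simp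
    also have "\<dots> = (\<Sum>b\<in>Basis. (\<Sum>c\<in>Basis. (b \<bullet> (T *v (D *v c))) * (b \<bullet> (D *v c))))"
      by (intro sum.cong refl arg_cong2[where f="(*)"])
        (metis sym_matrix_inner[OF symD] sym_matrix_inner[OF T(1)] inner_commute)+
    also have "\<dots> = (\<Sum>c\<in>Basis. (\<Sum>b\<in>Basis. (b \<bullet> (T *v (D *v c))) * (b \<bullet> (D *v c))))"
      by (rule sum.swap)
    also have "\<dots> = (\<Sum>b\<in>Basis. (D *v b) \<bullet> (T *v (D *v b)))"
      by (intro sum.cong refl, subst euclidean_inner) (simp add: inner_commute mult.commute)
    finally show ?thesis .
  qed
  have "(\<Sum>b\<in>Basis. (D *v b) \<bullet> (R *v (D *v b))) = - (\<Sum>b\<in>Basis. b \<bullet> (D *v (D *v (T *v b))))"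
    unfolding sum_negf[symmetric] RD
    by (intro sum.cong refl) (metis RD inner_minus_right sym_matrix_inner[OF symD])
  hence "(\<Sum>b\<in>Basis. (D *v b) \<bullet> (R *v (D *v b))) \<le> 0"
    unfolding tr using sum_nonneg[of Basis "\<lambda>b. (D *v b) \<bullet> (T *v (D *v b))"] nonneg(2) by simp
  hence "(\<Sum>b\<in>Basis. (D *v b) \<bullet> (R *v (D *v b))) = 0"
    using nonneg(1) by (intro antisym sum_nonneg) auto
  hence *: "\<forall>b\<in>Basis. (D *v b) \<bullet> (R *v (D *v b)) = 0"
    by (subst (asm) sum_nonneg_eq_0_iff) (auto simp: nonneg)
  hence **: "D *v b = 0" if "b \<in> Basis" for b
    using R(2)[of "D *v b"] that by fastforce
  have "D *v x = 0" for x
  proof -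
    have "D *v x = D *v (\<Sum>b\<in>Basis. (x \<bullet> b) *\<^sub>R b)" by (simp add: euclidean_representation)
    also have "\<dots> = 0"
      using ** by (simp add: matrix_vector_mult_scaleR linear_sum[OF matrix_vector_mul_linear])
    finally show ?thesis .
  qed
  hence "D = 0" by (metis matrix_eq matrix_vector_mult_0)
  thus ?thesis by (simp add: D_def)
qed

lemma pos_def_invertible:
  fixes S :: "real^'k^'k"
  assumes pos: "\<And>x. x \<noteq> 0 \<Longrightarrow> 0 < x \<bullet> (S *v x)"
  shows "invertible S"
proof -
  have "x = 0" if "S *v x = 0" for x
    using pos[of x] that by fastforce
  thus ?thesis
    by (metis invertible_left_inverse matrix_left_invertible_ker)
qed

text \<open>Existence and uniqueness of a positive definite root make the description in
  \<open>inv_sqrt_mat\<close> meaningful. The second equation is the form used later: with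
  \<open>R\<close> the inverse root and \<open>y = R *v t\<close>, it turns
  \<open>y \<bullet> (S *v y)\<close> into \<open>(norm t)^2\<close>.\<close>

lemma inv_sqrt_mat:
  fixes S :: "real^'k^'k"
  assumes sym: "transpose S = S" and pos: "\<And>x. x \<noteq> 0 \<Longrightarrow> 0 < x \<bullet> (S *v x)"
  shows "transpose (inv_sqrt_mat S) = inv_sqrt_mat S"
    and "inv_sqrt_mat S ** S ** inv_sqrt_mat S = mat 1"
proof -
  define A where "A = matrix_inv S"
  have inv: "S ** A = mat 1" "A ** S = mat 1"
    using pos_def_invertible[OF pos] unfolding A_def matrix_inv_def invertible_def
    by (metis (mono_tags, lifting) someI_ex)+
  have "transpose A ** S = mat 1"
    by (metis inv(1) matrix_transpose_mul sym transpose_mat)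
  hence symA: "transpose A = A"
    by (metis inv(1) matrix_mul_assoc matrix_mul_lid matrix_mul_rid)
  have posA: "0 < x \<bullet> (A *v x)" if "x \<noteq> 0" for x
  proof -
    have x: "x = S *v (A *v x)" by (simp add: matrix_vector_mul_assoc inv)
    hence "A *v x \<noteq> 0" using that by auto
    from pos[OF this] show ?thesis by (simp add: x[symmetric] inner_commute)
  qed
  define P where "P R \<longleftrightarrow> transpose R = R \<and> (\<forall>x. x \<noteq> 0 \<longrightarrow> 0 < x \<bullet> (R *v x)) \<and> R ** R = matrix_inv S"
    for R :: "real^'k^'k"
  obtain R where "P R"
    using pos_def_square_root_exists[OF symA posA] unfolding P_def A_def by blast
  moreover have "T = R" if "P T" for T
    using pos_def_square_root_unique[of T R] that \<open>P R\<close> unfolding P_def by metis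
  ultimately have "P (THE R. P R)" by (rule theI)
  hence R: "P (inv_sqrt_mat S)" by (simp add: inv_sqrt_mat_def P_def)
  let ?R = "inv_sqrt_mat S"
  show "transpose ?R = ?R" using R by (simp add: P_def)
  \<comment> \<open>\<open>R\<close> is a left inverse of \<open>R S\<close>, hence also a right
    inverse, which is the claim.\<close>
  have "?R ** (?R ** S) = mat 1" using R inv by (simp add: P_def A_def matrix_mul_assoc)
  thus "?R ** S ** ?R = mat 1" using matrix_left_right_inverse by blast
qed

section \<open>Convergence of characteristic functions on Euclidean spaces\<close>

inductive trig_poly :: "('v::euclidean_space \<Rightarrow> real) \<Rightarrow> bool" where
  cos: "trig_poly (\<lambda>x. cos (t \<bullet> x + c))"
| add: "trig_poly f \<Longrightarrow> trig_poly g \<Longrightarrow> trig_poly (\<lambda>x. f x + g x)"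
| scale: "trig_poly f \<Longrightarrow> trig_poly (\<lambda>x. c * f x)"

lemma trig_poly_mult_cos:
  "trig_poly f \<Longrightarrow> trig_poly (\<lambda>x. f x * cos (t \<bullet> x + c))"
proof (induction rule: trig_poly.induct)
  case (cos s d)
  have "(\<lambda>x. cos (s \<bullet> x + d) * cos (t \<bullet> x + c)) =
      (\<lambda>x. (1/2) * cos ((s - t) \<bullet> x + (d - c)) + (1/2) * cos ((s + t) \<bullet> x + (d + c)))"
  proof
    fix x
    have "(s - t) \<bullet> x + (d - c) = (s \<bullet> x + d) - (t \<bullet> x + c)"
      "(s + t) \<bullet> x + (d + c) = (s \<bullet> x + d) + (t \<bullet> x + c)"
      by (simp_all add: inner_simps)
    thus "cos (s \<bullet> x + d) * cos (t \<bullet> x + c) =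
        (1/2) * cos ((s - t) \<bullet> x + (d - c)) + (1/2) * cos ((s + t) \<bullet> x + (d + c))"
      by (simp only: cos_times_cos) (simp add: add_divide_distrib)
  qed
  thus ?case by (simp only:) (intro trig_poly.intros)
next
  case (add f g)
  from trig_poly.add[OF add.IH] show ?case by (simp add: algebra_simps)
next
  case (scale f d)
  from trig_poly.scale[OF scale.IH, of d] show ?case by (simp add: algebra_simps)
qed

lemma trig_poly_mult:
  assumes "trig_poly f" "trig_poly g"
  shows "trig_poly (\<lambda>x. f x * g x)"
  using assms(2)
proof (induction rule: trig_poly.induct)
  case (cos t c)
  show ?case by (rule trig_poly_mult_cos[OF assms(1)])
next
  case (add g h)
  from trig_poly.add[OF add.IH] show ?case by (simp add: algebra_simps)
next
  case (scale g d)
  from trig_poly.scale[OF scale.IH, of d] show ?case by (simp add: algebra_simps)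
qed

lemma trig_poly_const: "trig_poly (\<lambda>x. c)"
  using trig_poly.scale[OF trig_poly.cos[of 0 0], of c] by simp

lemma trig_poly_sin: "trig_poly (\<lambda>x. sin (t \<bullet> x))"
proof -
  have "(\<lambda>x. sin (t \<bullet> x)) = (\<lambda>x. cos (t \<bullet> x + (- pi / 2)))"
    by (rule ext) (simp add: cos_diff)
  thus ?thesis by (simp only: trig_poly.cos)
qed

lemma trig_poly_sum:
  assumes "finite I" "\<And>i. i \<in> I \<Longrightarrow> trig_poly (f i)"
  shows "trig_poly (\<lambda>x. \<Sum>i\<in>I. f i x)"
  using assms by (induction I rule: finite_induct) (auto intro: trig_poly_const trig_poly.add)

text \<open>Stone-Weierstrass gives polynomials on a cube, which are unbounded outside it. Composed
  with a sine in every coordinate they become bounded functions on the whole space whose integrals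
  are governed by characteristic functions. Products cause no trouble because a product of cosines
  is a sum of cosines.\<close>

lemma trig_poly_real_polynomial:
  fixes K :: real
  assumes "real_polynomial_function P"
  shows "trig_poly (\<lambda>x::'v::euclidean_space. P (\<Sum>b\<in>Basis. sin ((x \<bullet> b) / K) *\<^sub>R (b::'v)))"
  using assms
proof (induction rule: real_polynomial_function.induct)
  case (linear l)
  have *: "sin ((x \<bullet> b) / K) = sin (((1 / K) *\<^sub>R b) \<bullet> x)" for x b :: 'v
    by (simp add: inner_commute)
  have "trig_poly (\<lambda>x. \<Sum>b\<in>Basis. l b * sin (((1 / K) *\<^sub>R b) \<bullet> x))"
    by (intro trig_poly_sum trig_poly.scale trig_poly_sin) auto
  also have "(\<lambda>x. \<Sum>b\<in>Basis. l b * sin (((1 / K) *\<^sub>R b) \<bullet> x)) =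
      (\<lambda>x. l (\<Sum>b\<in>Basis. sin ((x \<bullet> b) / K) *\<^sub>R b))"
    unfolding * using linear
    by (simp add: linear_sum linear_scale bounded_linear.linear mult.commute)
  finally show ?case .
qed (auto intro: trig_poly_const trig_poly.add trig_poly_mult)

lemma trig_poly_continuous: "trig_poly f \<Longrightarrow> continuous_on UNIV f"
  by (induction rule: trig_poly.induct) (auto intro!: continuous_intros)

lemma trig_poly_bounded: "trig_poly f \<Longrightarrow> \<exists>B. \<forall>x. \<bar>f x\<bar> \<le> B"
proof (induction rule: trig_poly.induct)
  case (cos t c)
  show ?case by (rule exI[of _ 1]) simp
next
  case (add f g)
  then obtain B C where "\<forall>x. \<bar>f x\<bar> \<le> B" "\<forall>x. \<bar>g x\<bar> \<le> C" by blast
  thus ?case by (intro exI[of _ "B + C"]) (meson abs_triangle_ineq add_mono order_trans)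
next
  case (scale f c)
  then obtain B where "\<forall>x. \<bar>f x\<bar> \<le> B" by blast
  thus ?case by (intro exI[of _ "\<bar>c\<bar> * B"]) (simp add: abs_mult mult_left_mono)
qed

lemma (in prob_space) integrable_bounded_continuous:
  fixes f :: "'v::euclidean_space \<Rightarrow> 'b::{banach, second_countable_topology}"
  assumes "continuous_on UNIV f" "\<And>x. norm (f x) \<le> B" "X \<in> borel_measurable M"
  shows "integrable M (\<lambda>x. f (X x))"
  using assms
  by (intro integrable_const_bound[of _ B] measurable_compose[OF assms(3)] borel_measurable_continuous_onI) auto

section \<open>A continuity theorem for characteristic functions in several variables\<close>

context
  fixes \<mu> :: "nat \<Rightarrow> 'v::euclidean_space measure" and \<nu> :: "'v measure"
  assumes prob: "\<And>n. prob_space (\<mu> n)" "prob_space \<nu>"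
    and sets: "\<And>n. sets (\<mu> n) = sets borel" "sets \<nu> = sets borel"
    and char: "\<And>t. (\<lambda>n. \<integral>x. iexp (t \<bullet> x) \<partial>\<mu> n) \<longlonglongrightarrow> (\<integral>x. iexp (t \<bullet> x) \<partial>\<nu>)"
begin

text \<open>A cosine with phase \<open>c\<close> is the real part of \<open>iexp c\<close> times a
  character, so the generators converge by hypothesis.\<close>

lemma trig_poly_conv:
  assumes "trig_poly g"
  shows "(\<lambda>n. \<integral>x. g x \<partial>\<mu> n) \<longlonglongrightarrow> (\<integral>x. g x \<partial>\<nu>)"
  using assms
proof (induction rule: trig_poly.induct)
  case (cos t c)
  have eq: "(\<integral>x. cos (t \<bullet> x + c) \<partial>M) = Re (iexp c * (\<integral>x. iexp (t \<bullet> x) \<partial>M))"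
    if "prob_space M" "sets M = sets borel" for M :: "'v measure"
  proof -
    interpret prob_space M by fact
    have [measurable_cong]: "sets M = sets borel" by fact
    have "integrable M (\<lambda>x. iexp (t \<bullet> x))"
      by (intro integrable_const_bound[of _ 1]) auto
    hence "iexp c * (\<integral>x. iexp (t \<bullet> x) \<partial>M) = (\<integral>x. iexp (t \<bullet> x + c) \<partial>M)"
      by (subst integral_mult_right_zero[symmetric])
        (simp add: exp_add[symmetric] algebra_simps)
    also have "Re \<dots> = (\<integral>x. Re (iexp (t \<bullet> x + c)) \<partial>M)"
      by (rule integral_Re[symmetric]) (intro integrable_const_bound[of _ 1], auto)
    finally show ?thesis by (simp add: Re_exp)
  qed
  show ?case
    unfolding eq[OF prob(1) sets(1)] eq[OF prob(2) sets(2)]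
    by (intro tendsto_intros char)
next
  case (add f g)
  have int: "integrable M f" "integrable M g" if "prob_space M" "sets M = sets borel" for M
    using trig_poly_bounded[OF add.hyps(1)] trig_poly_bounded[OF add.hyps(2)]
      trig_poly_continuous[OF add.hyps(1)] trig_poly_continuous[OF add.hyps(2)] that
    by (auto intro!: prob_space.integrable_bounded_continuous[of M _ _ "\<lambda>x. x", simplified]
        simp: measurable_def sets_eq_imp_space_eq[OF that(2)])
  show ?case
    using tendsto_add[OF add.IH] int prob sets by (simp add: Bochner_Integration.integral_add)
next
  case (scale f c)
  thus ?case using tendsto_mult_left by force
qed

text \<open>The univariate continuity theorem, applied to projections, takes the place of tightness:
  integrals of cut-off functions of single coordinates converge, so the mass that
  \<open>\<mu> n\<close> puts outside a large cube is eventually small.\<close>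

lemma levy_continuity_marginal:
  fixes h :: "real \<Rightarrow> real"
  assumes "continuous_on UNIV h" "\<And>x. \<bar>h x\<bar> \<le> B"
  shows "(\<lambda>n. \<integral>x. h (x \<bullet> b) \<partial>\<mu> n) \<longlonglongrightarrow> (\<integral>x. h (x \<bullet> b) \<partial>\<nu>)"
proof -
  define D where "D M = distr M borel (\<lambda>x. x \<bullet> b)" for M :: "'v measure"
  have meas [measurable_cong]: "\<And>n. sets (\<mu> n) = sets borel" "sets \<nu> = sets borel" by (fact sets)+
  have D: "real_distribution (D M)" if "prob_space M" "sets M = sets borel" for M
  proof -
    interpret prob_space M by fact
    have [measurable_cong]: "sets M = sets borel" by fact
    show ?thesis unfolding D_def by (rule real_distribution_distr) measurable
  qed
  have ch: "Characteristic_Functions.char (D M) t = (\<integral>x. iexp ((t *\<^sub>R b) \<bullet> x) \<partial>M)"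
    if "sets M = sets borel" for M t
  proof -
    have [measurable_cong]: "sets M = sets borel" by fact
    show ?thesis unfolding D_def char_def
      by (subst integral_distr) (auto simp: inner_commute)
  qed
  have "weak_conv_m (\<lambda>n. D (\<mu> n)) (D \<nu>)"
  proof (rule levy_continuity)
    show "(\<lambda>n. Characteristic_Functions.char (D (\<mu> n)) t) \<longlonglongrightarrow> Characteristic_Functions.char (D \<nu>) t" for t
      by (simp only: ch sets) (rule char)
  qed (auto intro!: D prob sets)
  hence "(\<lambda>n. integral\<^sup>L (D (\<mu> n)) h) \<longlonglongrightarrow> integral\<^sup>L (D \<nu>) h"
    by (rule weak_conv_imp_integral_bdd_continuous_conv[rotated 2])
      (use assms D prob sets in \<open>auto simp: continuous_on_eq_continuous_at\<close>)
  moreover have h [measurable]: "h \<in> borel_measurable borel"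
    using assms(1) by (rule borel_measurable_continuous_onI)
  ultimately show ?thesis unfolding D_def
    by (simp add: integral_distr)
qed

text \<open>Outside the cube of side \<open>2K\<close> the function is replaced by a bounded periodic one, which is
  uniformly close to a trigonometric polynomial by the Stone-Weierstrass theorem.\<close>

theorem levy_continuity_euclidean:
  fixes f :: "'v \<Rightarrow> real"
  assumes cont: "continuous_on UNIV f" and bound: "\<And>x. \<bar>f x\<bar> \<le> B"
  shows "(\<lambda>n. \<integral>x. f x \<partial>\<mu> n) \<longlonglongrightarrow> (\<integral>x. f x \<partial>\<nu>)"
proof (rule LIMSEQ_I)
  fix r :: real assume r: "0 < r"
  have [measurable_cong]: "\<And>n. sets (\<mu> n) = sets borel" "sets \<nu> = sets borel" by (fact sets)+
  have fm [measurable]: "f \<in> borel_measurable borel"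
    using cont by (rule borel_measurable_continuous_onI)
  have B: "0 \<le> B" using bound[of 0] by simp
  \<comment> \<open>Budget: \<open>e\<close> for the convergence of the trigonometric polynomial,
    and \<open>e + 2 * B * e\<close> for replacing \<open>f\<close> by it under each of the two
    measures, less than \<open>4 * (B + 1) * e\<close> in all.\<close>
  define e where "e = r / (4 * (B + 1))"
  have e: "0 < e" using r B by (simp add: e_def)
  \<comment> \<open>A continuous ramp that vanishes for \<open>\<bar>s\<bar> \<le> K - 1\<close> and
    equals 1 for \<open>\<bar>s\<bar> \<ge> K\<close>; its sum \<open>H K\<close> over the
    coordinates dominates the indicator of the complement of the cube.\<close>
  define h where "h K s = min 1 (max 0 (\<bar>s\<bar> - K + 1))" for K s :: real
  have h: "continuous_on UNIV (h K)" "\<bar>h K s\<bar> \<le> 1" "0 \<le> h K s" for K s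
    unfolding h_def by (auto intro!: continuous_intros)
  have hm [measurable]: "h K \<in> borel_measurable borel" for K
    using h(1) by (rule borel_measurable_continuous_onI)
  define H where "H K x = (\<Sum>b\<in>Basis. h K (x \<bullet> b))" for K and x :: 'v
  have Hm [measurable]: "H K \<in> borel_measurable borel" for K unfolding H_def by measurable
  have Hb: "\<bar>H K x\<bar> \<le> DIM('v)" for K x
    unfolding H_def using h(2)
    by (intro order.trans[OF sum_abs]) (use sum_bounded_above[of Basis "\<lambda>b. \<bar>h K (x \<bullet> b)\<bar>" 1] in auto)
  have Hconv: "(\<lambda>n. \<integral>x. H K x \<partial>\<mu> n) \<longlonglongrightarrow> (\<integral>x. H K x \<partial>\<nu>)" for K
  proof -
    have "integrable M (\<lambda>x. h K (x \<bullet> b))" if "prob_space M" "sets M = sets borel" for M and b :: 'v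
    proof -
      have [measurable_cong]: "sets M = sets borel" by fact
      interpret prob_space M by fact
      show ?thesis using h(2) by (intro integrable_const_bound[of _ 1]) auto
    qed
    hence "(\<integral>x. H K x \<partial>M) = (\<Sum>b\<in>Basis. \<integral>x. h K (x \<bullet> b) \<partial>M)"
      if "prob_space M" "sets M = sets borel" for M
      unfolding H_def using that by (intro Bochner_Integration.integral_sum) auto
    thus ?thesis
      by (auto intro!: tendsto_sum levy_continuity_marginal[OF h(1) h(2)] simp: prob sets)
  qed
  have "(\<lambda>k. \<integral>x. H (real k) x \<partial>\<nu>) \<longlonglongrightarrow> (\<integral>x. 0 \<partial>\<nu>)"
  proof (rule integral_dominated_convergence[where w="\<lambda>_. real DIM('v)"])
    interpret prob_space \<nu> by (fact prob)
    show "integrable \<nu> (\<lambda>_. real DIM('v))" by simp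
    show "AE x in \<nu>. (\<lambda>k. H (real k) x) \<longlonglongrightarrow> 0"
    proof (rule AE_I2)
      fix x
      have "eventually (\<lambda>k. h (real k) s = 0) sequentially" for s
        using eventually_ge_at_top[of "nat \<lceil>\<bar>s\<bar> + 1\<rceil>"]
      proof eventually_elim
        case (elim k)
        hence "\<bar>s\<bar> + 1 \<le> real k" by linarith
        thus ?case by (simp add: h_def max_def)
      qed
      hence "(\<lambda>k. h (real k) s) \<longlonglongrightarrow> 0" for s
        by (rule tendsto_eventually)
      thus "(\<lambda>k. H (real k) x) \<longlonglongrightarrow> 0"
        unfolding H_def by (intro tendsto_null_sum) 
    qed
  qed (use Hb in auto)
  hence "eventually (\<lambda>k. (\<integral>x. H (real k) x \<partial>\<nu>) < e) sequentially"
    using e by (intro order_tendstoD) auto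
  then obtain k where k: "k > 0" "(\<integral>x. H (real k) x \<partial>\<nu>) < e"
    using eventually_gt_at_top[of 0] by (metis (no_types, lifting) eventually_at_top_linorder max.cobounded1 max.cobounded2 order_less_le_trans zero_less_one gr0I nat_le_linear not_less)
  define K where "K = real k"
  have K: "0 < K" using k by (simp add: K_def)
  define p where "p x = (\<Sum>b\<in>Basis. sin ((x \<bullet> b) / K) *\<^sub>R b)" for x :: 'v
  define S where "S = cbox (-One) (One::'v)"
  \<comment> \<open>\<open>g (p x)\<close> is the periodic replacement of \<open>f\<close>: since
    \<open>pi / 2\<close> exceeds 1, \<open>arcsin\<close> undoes the sine of
    \<open>(x \<bullet> b) / K\<close> throughout the cube, where
    \<open>g (p x) = f x\<close>.\<close>
  define g where "g y = f (\<Sum>b\<in>Basis. (K * arcsin (y \<bullet> b)) *\<^sub>R b)" for y :: 'v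
  have Sb: "\<bar>y \<bullet> b\<bar> \<le> 1" if "y \<in> S" "b \<in> Basis" for y b
    using that by (auto simp: S_def mem_box abs_le_iff)
  have "continuous_on S g"
    unfolding g_def
    by (rule continuous_on_compose2[OF cont])
      (use Sb in \<open>auto intro!: continuous_intros simp: abs_le_iff minus_le_iff\<close>)
  then obtain P where P: "real_polynomial_function P" "\<And>y. y \<in> S \<Longrightarrow> \<bar>g y - P y\<bar> < e"
    using Stone_Weierstrass_real_polynomial_function[of S g e] e unfolding S_def by auto
  define G where "G x = P (p x)" for x
  have G: "trig_poly G"
    unfolding G_def p_def by (rule trig_poly_real_polynomial[OF P(1)])
  have Gm [measurable]: "G \<in> borel_measurable borel"
    using trig_poly_continuous[OF G] by (rule borel_measurable_continuous_onI)
  have close: "\<bar>f x - G x\<bar> \<le> e + 2 * B * H K x" for x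
  proof -
    have px: "p x \<in> S"
      by (auto simp: S_def mem_box p_def abs_le_iff minus_le_iff)
    have "\<bar>f x - g (p x)\<bar> \<le> 2 * B * H K x"
    proof (cases "\<forall>b\<in>Basis. \<bar>x \<bullet> b\<bar> \<le> K")
      case True
      have "K * arcsin (sin ((x \<bullet> b) / K)) = x \<bullet> b" if "b \<in> Basis" for b
      proof -
        have "\<bar>(x \<bullet> b) / K\<bar> \<le> 1" using True that K by simp
        hence "\<bar>(x \<bullet> b) / K\<bar> \<le> pi / 2" using pi_ge_two by linarith
        hence "- (pi / 2) \<le> (x \<bullet> b) / K" "(x \<bullet> b) / K \<le> pi / 2" by linarith+
        thus ?thesis using K by (subst arcsin_sin) auto
      qed
      hence "g (p x) = f x"
        by (simp add: g_def p_def euclidean_representation)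
      thus ?thesis using B h(3) by (auto simp: H_def intro!: mult_nonneg_nonneg sum_nonneg)
    next
      case False
      then obtain b where b: "b \<in> Basis" "K < \<bar>x \<bullet> b\<bar>" by auto
      have "1 = h K (x \<bullet> b)" using b by (simp add: h_def)
      also have "\<dots> \<le> H K x" unfolding H_def using b h(3) by (intro member_le_sum) auto
      finally have "2 * B * 1 \<le> 2 * B * H K x" using B by (intro mult_left_mono) auto
      thus ?thesis using bound[of x] bound[of "\<Sum>b\<in>Basis. (K * arcsin (p x \<bullet> b)) *\<^sub>R b"]
        unfolding g_def by linarith
    qed
    thus ?thesis using P(2)[OF px] unfolding G_def by linarith
  qed
  have diff: "\<bar>(\<integral>x. f x \<partial>M) - (\<integral>x. G x \<partial>M)\<bar> \<le> e + 2 * B * (\<integral>x. H K x \<partial>M)"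
    if "prob_space M" "sets M = sets borel" for M
  proof -
    have [measurable_cong]: "sets M = sets borel" by fact
    interpret prob_space M by fact
    obtain C where C: "\<And>x. \<bar>G x\<bar> \<le> C" using trig_poly_bounded[OF G] by blast
    have int: "integrable M f" "integrable M G" "integrable M (H K)"
      using bound C Hb
      by (auto intro: integrable_const_bound[of f B] integrable_const_bound[of G C]
          integrable_const_bound[of "H K" "DIM('v)"])
    have "\<bar>(\<integral>x. f x \<partial>M) - (\<integral>x. G x \<partial>M)\<bar> = \<bar>\<integral>x. f x - G x \<partial>M\<bar>"
      using int by simp
    also have "\<dots> \<le> (\<integral>x. \<bar>f x - G x\<bar> \<partial>M)"
      by (rule integral_abs_bound)
    also have "\<dots> \<le> (\<integral>x. e + 2 * B * H K x \<partial>M)"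
      using int close by (intro integral_mono) auto
    also have "\<dots> = e + 2 * B * (\<integral>x. H K x \<partial>M)"
      using int by (simp add: prob_space)
    finally show ?thesis .
  qed
  have "eventually (\<lambda>n. (\<integral>x. H K x \<partial>\<mu> n) < e) sequentially"
    using Hconv k by (intro order_tendstoD(2)) (auto simp: K_def)
  moreover have "eventually (\<lambda>n. dist (\<integral>x. G x \<partial>\<mu> n) (\<integral>x. G x \<partial>\<nu>) < e) sequentially"
    using trig_poly_conv[OF G] e by (rule tendstoD)
  ultimately have "eventually (\<lambda>n. norm ((\<integral>x. f x \<partial>\<mu> n) - (\<integral>x. f x \<partial>\<nu>)) < r) sequentially"
  proof eventually_elim
    case (elim n)
    have "2 * B * (\<integral>x. H K x \<partial>\<mu> n) \<le> 2 * B * e" "2 * B * (\<integral>x. H K x \<partial>\<nu>) \<le> 2 * B * e"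
      using elim k B by (auto intro!: mult_left_mono simp: K_def)
    hence "norm ((\<integral>x. f x \<partial>\<mu> n) - (\<integral>x. f x \<partial>\<nu>)) < 4 * ((B + 1) * e)"
      using diff[OF prob(1)[of n] sets(1)] diff[OF prob(2) sets(2)] elim e B
      unfolding dist_norm real_norm_def by (simp add: algebra_simps) 
    also have "\<dots> = r" using B by (simp add: e_def field_simps)
    finally show ?case .
  qed
  thus "\<exists>no. \<forall>n\<ge>no. norm ((\<integral>x. f x \<partial>\<mu> n) - (\<integral>x. f x \<partial>\<nu>)) < r"
    by (simp add: eventually_sequentially)
qed

end

section \<open>The standard normal vector as a limit law\<close>

lemma std_normal_vec_char:
  fixes t :: "real^'k"
  shows "prob_space (std_normal_vec :: (real^'k) measure)"
    and "(\<integral>x. iexp (t \<bullet> x) \<partial>std_normal_vec) = complex_of_real (exp (- (norm t)\<^sup>2 / 2))"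
proof -
  let ?B = "Basis :: (real^'k) set"
  let ?P = "\<Pi>\<^sub>M b\<in>?B. (lborel :: real measure)"
  \<comment> \<open>Lebesgue measure is the image under \<open>?T\<close> of the product of its
    one-dimensional copies (\<open>lborel_eq\<close>). As the density is a product too, the
    integrals factor over the coordinates.\<close>
  let ?T = "\<lambda>f. \<Sum>b\<in>?B. f b *\<^sub>R b"
  interpret product_sigma_finite "\<lambda>_ :: real^'k. lborel :: real measure" ..
  have dens: "(\<Prod>a\<in>UNIV. std_normal_density (x $ a)) = (\<Prod>b\<in>Basis. std_normal_density (x \<bullet> b))"
    for x :: "real^'k"
    unfolding Basis_vec_def
    by (subst prod.UNION_disjoint) 
      (auto simp: axis_eq_axis inner_axis)
  have [measurable]: "(\<lambda>x :: real^'k. \<Prod>b\<in>Basis. std_normal_density (x \<bullet> b)) \<in> borel_measurable borel"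
    by measurable
  have T: "?T f \<bullet> b = f b" if "b \<in> Basis" for f b
    using that by simp
  have "integrable lborel (std_normal_density :: real \<Rightarrow> real)"
    "(\<integral>x. std_normal_density x \<partial>lborel) = 1"
    using integrable_normal_density[of 1 0] integral_normal_density[of 1 0] by auto
  note nd = this
  have intT: "integrable ?P (\<lambda>x. \<Prod>b\<in>?B. std_normal_density (x b))"
    using nd by (intro product_integrable_prod) auto
  have one: "(\<integral>x. (\<Prod>b\<in>?B. std_normal_density (x b)) \<partial>?P) = 1"
    using nd by (subst product_integral_prod) auto
  have "emeasure (std_normal_vec :: (real^'k) measure) (space std_normal_vec) =
      (\<integral>\<^sup>+x. ennreal (\<Prod>b\<in>?B. std_normal_density (x \<bullet> b)) \<partial>lborel)"
    unfolding std_normal_vec_def dens by (subst emeasure_density) auto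
  also have "\<dots> = (\<integral>\<^sup>+x. ennreal (\<Prod>b\<in>?B. std_normal_density (x b)) \<partial>?P)"
    by (subst lborel_eq, subst nn_integral_distr) (auto simp: T)
  also have "\<dots> = ennreal (\<integral>x. (\<Prod>b\<in>?B. std_normal_density (x b)) \<partial>?P)"
    by (rule nn_integral_eq_integral[OF intT]) (auto intro!: prod_nonneg)
  finally show "prob_space (std_normal_vec :: (real^'k) measure)"
    using one by (intro prob_spaceI) simp
  have n1: "integrable lborel (\<lambda>y. std_normal_density y *\<^sub>R iexp (s * y))" for s
    using nd(1) by (rule Bochner_Integration.integrable_bound) auto
  have n2: "(\<integral>y. std_normal_density y *\<^sub>R iexp (s * y) \<partial>lborel) = exp (- s\<^sup>2 / 2)" for s :: real
  proof -
    have "Characteristic_Functions.char std_normal_distribution s =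
        (\<integral>y. std_normal_density y *\<^sub>R iexp (s * y) \<partial>lborel)"
      unfolding char_def by (subst integral_density) auto
    thus ?thesis by (simp add: char_std_normal_distribution)
  qed
  have "(\<integral>x. iexp (t \<bullet> x) \<partial>std_normal_vec) =
      (\<integral>x. (\<Prod>b\<in>?B. std_normal_density (x \<bullet> b)) *\<^sub>R iexp (t \<bullet> x) \<partial>lborel)"
    unfolding std_normal_vec_def dens
    by (subst integral_density) (auto intro!: prod_nonneg)
  also have "\<dots> = (\<integral>x. (\<Prod>b\<in>?B. std_normal_density (?T x \<bullet> b)) *\<^sub>R iexp (t \<bullet> ?T x) \<partial>?P)"
    by (subst lborel_eq, subst integral_distr) auto
  also have "\<dots> = (\<integral>x. (\<Prod>b\<in>?B. std_normal_density (x b) *\<^sub>R iexp ((t \<bullet> b) * x b)) \<partial>?P)"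
  proof (intro Bochner_Integration.integral_cong refl)
    fix x :: "real^'k \<Rightarrow> real"
    have "iexp (t \<bullet> ?T x) = (\<Prod>b\<in>?B. iexp ((t \<bullet> b) * x b))"
      by (simp add: exp_sum[symmetric] inner_sum_right sum_distrib_left mult.commute)
    thus "(\<Prod>b\<in>?B. std_normal_density (?T x \<bullet> b)) *\<^sub>R iexp (t \<bullet> ?T x) =
        (\<Prod>b\<in>?B. std_normal_density (x b) *\<^sub>R iexp ((t \<bullet> b) * x b))"
      by (simp add: T scaleR_conv_of_real[of _ "_ :: complex"] prod.distrib)
  qed
  also have "\<dots> = (\<Prod>b\<in>?B. complex_of_real (exp (- (t \<bullet> b)\<^sup>2 / 2)))"
    by (subst product_integral_prod[OF finite_Basis n1]) (simp only: n2)
  also have "\<dots> = complex_of_real (exp (\<Sum>b\<in>Basis. - (t \<bullet> b)\<^sup>2 / 2))"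
    by (simp add: exp_sum)
  also have "(\<Sum>b\<in>Basis. - (t \<bullet> b)\<^sup>2 / 2) = - (norm t)\<^sup>2 / 2"
  proof -
    have "(norm t)\<^sup>2 = (\<Sum>b\<in>Basis. (t \<bullet> b)\<^sup>2)"
      by (subst power2_norm_eq_inner, subst euclidean_inner) (simp add: power2_eq_square)
    thus ?thesis by (simp add: sum_negf sum_divide_distrib[symmetric])
  qed
  finally show "(\<integral>x. iexp (t \<bullet> x) \<partial>std_normal_vec) = complex_of_real (exp (- (norm t)\<^sup>2 / 2))" .
qed

lemma conv_in_distr_std_normal_vecI:
  fixes X :: "nat \<Rightarrow> 'a \<Rightarrow> real^'k"
  assumes prob: "\<And>n. prob_space (M n)" and meas: "\<And>n. X n \<in> borel_measurable (M n)"
    and char: "\<And>t. (\<lambda>n. \<integral>x. iexp (t \<bullet> X n x) \<partial>M n) \<longlonglongrightarrow> complex_of_real (exp (- (norm t)\<^sup>2 / 2))"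
  shows "conv_in_distr M X std_normal_vec"
  unfolding conv_in_distr_def
proof (intro allI impI, elim conjE)
  fix f :: "real^'k \<Rightarrow> real" assume f: "continuous_on UNIV f" "bounded (range f)"
  then obtain B where B: "\<And>x. \<bar>f x\<bar> \<le> B" by (auto simp: bounded_iff)
  have [measurable]: "f \<in> borel_measurable borel" using f(1) by (rule borel_measurable_continuous_onI)
  define \<mu> where "\<mu> n = distr (M n) borel (X n)" for n
  have "(\<lambda>n. \<integral>x. f x \<partial>\<mu> n) \<longlonglongrightarrow> (\<integral>x. f x \<partial>std_normal_vec)"
  proof (rule levy_continuity_euclidean[OF _ _ _ _ _ f(1) B])
    show "prob_space (\<mu> n)" for n
      unfolding \<mu>_def by (rule prob_space.prob_space_distr[OF prob meas])
    show "(\<lambda>n. \<integral>x. iexp (t \<bullet> x) \<partial>\<mu> n) \<longlonglongrightarrow> (\<integral>x. iexp (t \<bullet> x) \<partial>std_normal_vec)" for t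
      using char[of t] meas unfolding \<mu>_def std_normal_vec_char by (simp add: integral_distr)
  qed (auto simp: \<mu>_def std_normal_vec_def intro: std_normal_vec_char(1)[unfolded std_normal_vec_def])
  thus "(\<lambda>n. \<integral>x. f (X n x) \<partial>M n) \<longlonglongrightarrow> (\<integral>x. f x \<partial>std_normal_vec)"
    using meas by (simp add: \<mu>_def integral_distr)
qed

section \<open>Centred geometric variables\<close>

definition h_fun :: "real \<Rightarrow> real" where
  "h_fun x = 1 / (exp x - 1)"

text \<open>The log-partition function of the geometric law with rate \<open>x\<close>. Its
  derivative is minus the mean \<open>h_fun\<close>, whose derivative is minus the variance
  \<open>u_fun\<close>; this is why the Fisher information is built from
  \<open>u_fun\<close>.\<close>

definition psi_fun :: "real \<Rightarrow> real" where
  "psi_fun x = - ln (1 - exp (- x))"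

definition u_deriv :: "real \<Rightarrow> real" where
  "u_deriv x = - (exp x * (exp x + 1) / (exp x - 1) ^ 3)"

lemma h_fun_deriv:
  assumes "0 < x" shows "(h_fun has_real_derivative - u_fun x) (at x)"
  unfolding h_fun_def[abs_def] u_fun_def using assms
  by (auto intro!: derivative_eq_intros simp: power2_eq_square field_simps)

lemma u_fun_deriv:
  assumes "0 < x" shows "(u_fun has_real_derivative u_deriv x) (at x)"
proof -
  have "exp x - 1 \<noteq> 0" using assms by simp
  moreover have "(exp x * (exp x - 1)\<^sup>2 - exp x * (2 * (exp x - 1) * exp x)) / ((exp x - 1)\<^sup>2 * (exp x - 1)\<^sup>2) = u_deriv x"
    unfolding u_deriv_def using \<open>exp x - 1 \<noteq> 0\<close>
    by (simp add: divide_simps) algebra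
  moreover have "((\<lambda>x. exp x / (exp x - 1)\<^sup>2) has_real_derivative
      (exp x * (exp x - 1)\<^sup>2 - exp x * (2 * (exp x - 1) * exp x)) / ((exp x - 1)\<^sup>2 * (exp x - 1)\<^sup>2)) (at x)"
    using \<open>exp x - 1 \<noteq> 0\<close> by (auto intro!: derivative_eq_intros)
  ultimately show ?thesis
    unfolding u_fun_def[abs_def] by simp
qed

lemma psi_fun_deriv:
  assumes "0 < x" shows "(psi_fun has_real_derivative - h_fun x) (at x)"
  unfolding psi_fun_def[abs_def] h_fun_def using assms
  by (auto intro!: derivative_eq_intros simp: exp_minus field_simps)

lemma u_fun_pos: "0 < x \<Longrightarrow> 0 < u_fun x"
  unfolding u_fun_def by simp

lemma u_fun_lower:
  assumes "0 < x" shows "exp (- x) \<le> u_fun x"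
proof -
  have "(exp x - 1)\<^sup>2 \<le> (exp x)\<^sup>2" using assms by (intro power_mono) auto
  hence "exp x / (exp x)\<^sup>2 \<le> exp x / (exp x - 1)\<^sup>2"
    using assms by (intro divide_left_mono) auto
  thus ?thesis by (simp add: u_fun_def exp_minus power2_eq_square divide_simps)
qed

text \<open>With \<open>w = 1 / (exp x - 1)\<close> one has \<open>u_fun x = w * (1 + w)\<close> and
  \<open>u_deriv x = - w * (1 + w) * (1 + 2 * w)\<close>. Hence the single estimate
  \<open>w \<le> a\<close>, together with \<open>1 \<le> a\<close>, yields the constants 2 and 6 in
  the bounds on \<open>u_fun\<close> and \<open>u_deriv\<close>.\<close>

lemma exp_minus_one_inverse:
  fixes a x :: real
  assumes "0 < a" "1 / a \<le> x"
  shows "1 / (exp x - 1) \<le> a" "0 < x"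
proof -
  show x: "0 < x" using assms by (smt (verit) zero_less_divide_1_iff)
  have "x \<le> exp x - 1" using exp_ge_add_one_self[of x] by linarith
  hence "1 / (exp x - 1) \<le> 1 / x" using x by (intro divide_left_mono) auto
  also have "\<dots> \<le> a" using assms x by (simp add: field_simps)
  finally show "1 / (exp x - 1) \<le> a" .
qed

lemma exp_split: "0 < x \<Longrightarrow> exp x / (exp x - 1) = 1 + 1 / (exp x - (1::real))"
  by (simp add: field_simps)

lemma u_fun_upper:
  assumes "1 \<le> a" "1 / a \<le> x"
  shows "u_fun x \<le> 2 * a\<^sup>2"
proof -
  note 1 = exp_minus_one_inverse[of a x] 
  have x: "0 < x" "1 / (exp x - 1) \<le> a" using 1 assms by auto
  have "u_fun x = (exp x / (exp x - 1)) * (1 / (exp x - 1))"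
    by (simp add: u_fun_def power2_eq_square)
  also have "\<dots> \<le> (2 * a) * a"
    using x assms unfolding exp_split[OF x(1)] by (intro mult_mono) auto
  finally show ?thesis by (simp add: power2_eq_square)
qed

lemma u_deriv_bound:
  assumes "1 \<le> a" "1 / a \<le> x"
  shows "\<bar>u_deriv x\<bar> \<le> 6 * a ^ 3"
proof -
  note 1 = exp_minus_one_inverse[of a x] 
  have x: "0 < x" "1 / (exp x - 1) \<le> a" using 1 assms by auto
  have e: "0 < exp x - 1" using x by simp
  have "\<bar>u_deriv x\<bar> = (exp x / (exp x - 1)) * ((exp x + 1) / (exp x - 1)) * (1 / (exp x - 1))"
    using e by (simp add: u_deriv_def power3_eq_cube abs_mult)
  also have "(exp x + 1) / (exp x - 1) = 1 + 2 * (1 / (exp x - 1))"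
    using e by (simp add: field_simps)
  also have "(exp x / (exp x - 1)) * (1 + 2 * (1 / (exp x - 1))) * (1 / (exp x - 1)) \<le> (2 * a) * (3 * a) * a"
    using x assms e unfolding exp_split[OF x(1)] by (intro mult_mono) auto
  finally show ?thesis by (simp add: power3_eq_cube)
qed

lemma lipschitz_of_deriv:
  fixes f f' :: "real \<Rightarrow> real"
  assumes "\<And>x. c \<le> x \<Longrightarrow> (f has_real_derivative f' x) (at x)"
    and "\<And>x. c \<le> x \<Longrightarrow> \<bar>f' x\<bar> \<le> K" and "c \<le> x" "c \<le> y"
  shows "\<bar>f x - f y\<bar> \<le> K * \<bar>x - y\<bar>"
proof -
  have "norm (f x - f y) \<le> K * norm (x - y)"
    using assms
    by (intro field_differentiable_bound[of "{c..}" f f' K])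
       (auto intro: has_field_derivative_at_within)
  thus ?thesis by simp
qed

text \<open>At a mean value \<open>z\<close> the increment of \<open>f\<close> is
  \<open>f' z * (y - x)\<close>, and \<open>f' z\<close> is compared with \<open>f' x\<close> by the
  Lipschitz bound. The usual factor 1/2 is given up.\<close>

lemma taylor_bound:
  fixes f f' :: "real \<Rightarrow> real"
  assumes d: "\<And>x. c \<le> x \<Longrightarrow> (f has_real_derivative f' x) (at x)"
    and l: "\<And>x y. c \<le> x \<Longrightarrow> c \<le> y \<Longrightarrow> \<bar>f' x - f' y\<bar> \<le> K * \<bar>x - y\<bar>" and xy: "c \<le> x" "c \<le> y"
    and K: "0 \<le> K"
  shows "\<bar>f y - f x - f' x * (y - x)\<bar> \<le> K * (y - x)\<^sup>2"
proof (cases "x = y")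
  case False
  obtain z where z: "c \<le> z" "\<bar>z - x\<bar> \<le> \<bar>y - x\<bar>" "f y - f x = (y - x) * f' z"
  proof (cases "x < y")
    case True
    from MVT2[OF this, of f f'] d xy obtain z where "x < z" "z < y" "f y - f x = (y - x) * f' z"
      by fastforce
    thus thesis using xy by (intro that[of z]) auto
  next
    case False
    with \<open>x \<noteq> y\<close> have "y < x" by simp
    from MVT2[OF this, of f f'] d xy obtain z where "y < z" "z < x" "f x - f y = (x - y) * f' z"
      by fastforce
    thus thesis using xy by (intro that[of z]) (auto simp: algebra_simps)
  qed
  have "\<bar>f y - f x - f' x * (y - x)\<bar> = \<bar>f' z - f' x\<bar> * \<bar>y - x\<bar>"
    unfolding z by (simp add: abs_mult[symmetric] algebra_simps)
  also have "\<dots> \<le> (K * \<bar>z - x\<bar>) * \<bar>y - x\<bar>" using l[OF z(1) xy(1)] by (intro mult_right_mono) auto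
  also have "\<dots> \<le> (K * \<bar>y - x\<bar>) * \<bar>y - x\<bar>" using z K by (intro mult_right_mono mult_left_mono) auto
  finally show ?thesis by (simp add: power2_eq_square)
qed auto

lemma h_fun_lipschitz:
  assumes "1 \<le> a" "1 / a \<le> x" "1 / a \<le> y"
  shows "\<bar>h_fun x - h_fun y\<bar> \<le> 2 * a\<^sup>2 * \<bar>x - y\<bar>"
proof (rule lipschitz_of_deriv[where f'="\<lambda>x. - u_fun x" and c="1 / a"])
  fix x assume x: "1 / a \<le> x"
  have "0 < x" using exp_minus_one_inverse(2)[of a x] assms x by simp
  thus "(h_fun has_real_derivative - u_fun x) (at x)" "\<bar>- u_fun x\<bar> \<le> 2 * a\<^sup>2"
    using h_fun_deriv u_fun_upper[OF assms(1) x] u_fun_pos[of x] by auto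
qed (use assms in auto)

lemma h_fun_taylor:
  assumes "1 \<le> a" "1 / a \<le> x" "1 / a \<le> y"
  shows "\<bar>h_fun y - h_fun x + u_fun x * (y - x)\<bar> \<le> 6 * a ^ 3 * (y - x)\<^sup>2"
proof -
  have "\<bar>h_fun y - h_fun x - (- u_fun x) * (y - x)\<bar> \<le> 6 * a ^ 3 * (y - x)\<^sup>2"
  proof (rule taylor_bound[where f'="\<lambda>x. - u_fun x" and c="1 / a"])
    have p: "0 < x" if "1 / a \<le> x" for x using exp_minus_one_inverse(2)[of a x] assms that by simp
    show "(h_fun has_real_derivative - u_fun x) (at x)" if "1 / a \<le> x" for x
      using h_fun_deriv p[OF that] .
    show "\<bar>- u_fun x - - u_fun y\<bar> \<le> 6 * a ^ 3 * \<bar>x - y\<bar>" if "1 / a \<le> x" "1 / a \<le> y" for x y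
    proof -
      have "\<bar>u_fun x - u_fun y\<bar> \<le> 6 * a ^ 3 * \<bar>x - y\<bar>"
        using that u_fun_deriv p u_deriv_bound assms(1)
        by (intro lipschitz_of_deriv[where f'=u_deriv and c="1 / a"]) auto
      thus ?thesis by (simp add: abs_minus_commute)
    qed
  qed (use assms in auto)
  thus ?thesis by simp
qed

definition geom_eps :: "real \<Rightarrow> nat \<Rightarrow> real" where
  "geom_eps x a = real a - h_fun x"

lemma exp_2_le: "exp 2 \<le> (9::real)"
proof -
  have "exp 2 = exp 1 * exp (1::real)" by (simp flip: exp_add)
  also have "\<dots> \<le> 3 * 3" using exp_le by (intro mult_mono) auto
  finally show ?thesis by simp
qed

text \<open>A single term of the exponential series is at most its sum. This converts bounds on the
  moment generating function at \<open>s\<close> and \<open>- s\<close> into moment bounds.\<close>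

lemma power_le_fact_exp_abs:
  fixes x :: real shows "\<bar>x\<bar> ^ k \<le> fact k * (exp x + exp (- x))"
proof -
  have "(\<Sum>n\<in>{k}. inverse (fact n) * \<bar>x\<bar> ^ n) \<le> (\<Sum>n. inverse (fact n) * \<bar>x\<bar> ^ n)"
    by (intro sum_le_suminf summable_exp) auto
  hence "\<bar>x\<bar> ^ k \<le> fact k * exp \<bar>x\<bar>"
    by (simp add: exp_def field_simps)
  also have "\<dots> \<le> fact k * (exp x + exp (- x))"
    by (intro mult_left_mono) (auto simp: abs_if)
  finally show ?thesis .
qed

section \<open>Moment generating function and moments of one centred entry\<close>

context
  fixes \<pi> :: real
  assumes \<pi>: "0 < \<pi>"
begin

abbreviation "geom \<equiv> geometric_pmf (1 - exp (- \<pi>))"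
abbreviation "geom_exp \<equiv> measure_pmf.expectation geom"

lemma geom_param: "0 < 1 - exp (- \<pi>)" "1 - exp (- \<pi>) \<le> 1" "1 - exp (- \<pi>) \<in> {0<..1}"
  using \<pi> by auto

lemma pmf_geom: "pmf geom k = exp (- \<pi>) ^ k * (1 - exp (- \<pi>))"
  using geom_param by simp

lemma geom_expectation:
  assumes "summable (\<lambda>k. pmf geom k * norm (f k :: real))"
  shows "integrable (measure_pmf geom) f" "geom_exp f = (\<Sum>k. pmf geom k * f k)"
proof -
  have "integrable (count_space UNIV) (\<lambda>k. pmf geom k * f k)"
    using assms by (subst integrable_count_space_nat_iff) (simp add: abs_mult)
  thus "integrable (measure_pmf geom) f" "geom_exp f = (\<Sum>k. pmf geom k * f k)"
    by (simp_all add: measure_pmf_eq_density integrable_density integral_density integral_count_space_nat)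
qed

text \<open>Weighting by \<open>exp (s * a)\<close> turns the geometric law with rate
  \<open>\<pi>\<close> into the one with rate \<open>\<pi> - s\<close>, so the value is a quotient
  of normalising constants.\<close>

lemma geom_mgf:
  assumes "s < \<pi>"
  shows "integrable (measure_pmf geom) (\<lambda>a. exp (s * real a))"
    and "geom_exp (\<lambda>a. exp (s * real a)) = exp (psi_fun (\<pi> - s) - psi_fun \<pi>)"
proof -
  have eq: "pmf geom k * exp (s * real k) = (1 - exp (- \<pi>)) * exp (s - \<pi>) ^ k" for k
    by (simp add: pmf_geom exp_of_nat_mult[symmetric] exp_add[symmetric] algebra_simps del: pmf_geometric)
  have s: "(\<lambda>k. (1 - exp (- \<pi>)) * exp (s - \<pi>) ^ k) sums ((1 - exp (- \<pi>)) * (1 / (1 - exp (s - \<pi>))))"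
    using assms by (intro sums_mult geometric_sums) auto
  have sm: "summable (\<lambda>k. pmf geom k * norm (exp (s * real k)))"
    using sums_summable[OF s, folded eq] by (simp del: pmf_geometric)
  note E = geom_expectation[OF sm]
  show "integrable (measure_pmf geom) (\<lambda>a. exp (s * real a))" by (fact E(1))
  have "exp (psi_fun (\<pi> - s) - psi_fun \<pi>) = (1 - exp (- \<pi>)) * (1 / (1 - exp (s - \<pi>)))"
    using assms \<pi> by (simp add: psi_fun_def exp_diff exp_minus field_simps)
  thus "geom_exp (\<lambda>a. exp (s * real a)) = exp (psi_fun (\<pi> - s) - psi_fun \<pi>)"
    unfolding E(2) eq using sums_unique[OF s] by simp
qed

lemma geom_mean: "geom_exp real = h_fun \<pi>"
  using expectation_geometric_pmf[OF geom_param(3)]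
  by (simp add: h_fun_def exp_minus field_simps)

abbreviation "eps \<equiv> geom_eps \<pi>"

lemma geom_eps_mgf:
  assumes "s < \<pi>"
  shows "integrable (measure_pmf geom) (\<lambda>a. exp (s * eps a))"
    and "geom_exp (\<lambda>a. exp (s * eps a)) = exp (psi_fun (\<pi> - s) - psi_fun \<pi> - s * h_fun \<pi>)"
proof -
  have "(\<lambda>a. exp (s * eps a)) = (\<lambda>a. exp (s * real a) * exp (- (s * h_fun \<pi>)))"
    by (simp add: geom_eps_def exp_add[symmetric] algebra_simps)
  moreover have "exp (psi_fun (\<pi> - s) - psi_fun \<pi> - s * h_fun \<pi>)
      = exp (psi_fun (\<pi> - s) - psi_fun \<pi>) * exp (- (s * h_fun \<pi>))"
    by (simp add: exp_add[symmetric])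
  ultimately show "integrable (measure_pmf geom) (\<lambda>a. exp (s * eps a))"
    "geom_exp (\<lambda>a. exp (s * eps a)) = exp (psi_fun (\<pi> - s) - psi_fun \<pi> - s * h_fun \<pi>)"
    using geom_mgf[OF assms] by simp_all
qed

lemma geom_eps_integrable:
  "integrable (measure_pmf geom) (\<lambda>a. \<bar>eps a\<bar> ^ k)"
proof -
  define s where "s = \<pi> / 2"
  have s: "0 < s" "s < \<pi>" "- s < \<pi>" using \<pi> by (auto simp: s_def)
  have "integrable (measure_pmf geom) (\<lambda>a. fact k / s ^ k * (exp (s * eps a) + exp (- s * eps a)))"
    using geom_eps_mgf(1)[OF s(2)] geom_eps_mgf(1)[OF s(3)] by auto
  thus ?thesis
  proof (rule Bochner_Integration.integrable_bound)
    show "AE a in measure_pmf geom. norm (\<bar>eps a\<bar> ^ k)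
        \<le> norm (fact k / s ^ k * (exp (s * eps a) + exp (- s * eps a)))"
    proof (rule AE_I2)
      fix a
      have "s ^ k * \<bar>eps a\<bar> ^ k \<le> fact k * (exp (s * eps a) + exp (- s * eps a))"
        using power_le_fact_exp_abs[of "s * eps a" k] s by (simp add: abs_mult power_mult_distrib)
      thus "norm (\<bar>eps a\<bar> ^ k) \<le> norm (fact k / s ^ k * (exp (s * eps a) + exp (- s * eps a)))"
        using s by (simp add: abs_mult field_simps)
    qed
  qed auto
qed

lemma geom_eps_mean: "integrable (measure_pmf geom) eps" "geom_exp eps = 0"
  using integrable_real_geometric_pmf[OF geom_param(3)] geom_mean
  by (simp_all add: geom_eps_def[abs_def])

lemma geom_variance: "geom_exp (\<lambda>a. (eps a)\<^sup>2) = u_fun \<pi>"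
proof -
  define r where "r = exp (- \<pi>)"
  have r: "0 < r" "r < 1" using \<pi> by (auto simp: r_def)
  have int: "integrable (measure_pmf geom) real"
    using integrable_real_geometric_pmf[OF geom_param(3)] .
  have int2: "integrable (measure_pmf geom) (\<lambda>a. (real a)\<^sup>2)"
  proof -
    have "(\<lambda>a. (real a)\<^sup>2) = (\<lambda>a. \<bar>eps a\<bar> ^ 2 + 2 * h_fun \<pi> * eps a + (h_fun \<pi>)\<^sup>2)"
      by (simp add: geom_eps_def power2_eq_square algebra_simps)
    thus ?thesis using geom_eps_integrable[of 2] geom_eps_mean(1) by simp
  qed
  \<comment> \<open>Memorylessness: the value is 0 with probability \<open>1 - r\<close>, and
    otherwise its predecessor has the original law. For the square this gives a linear equation for
    \<open>E2\<close>.\<close>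
  have rec: "geom_exp f = (1 - r) * f 0 + r * geom_exp (\<lambda>a. f (Suc a))"
    if "\<And>a. 0 \<le> f a" "integrable (measure_pmf geom) f" "integrable (measure_pmf geom) (\<lambda>a. f (Suc a))"
    for f :: "nat \<Rightarrow> real"
  proof -
    have sm: "summable (\<lambda>k. pmf geom k * norm (g k))" if "\<And>a. 0 \<le> g a" "integrable (measure_pmf geom) g"
      for g :: "nat \<Rightarrow> real"
    proof -
      have "integrable (count_space UNIV) (\<lambda>k. pmf geom k * g k)"
        using that(2) by (simp add: measure_pmf_eq_density integrable_density)
      thus ?thesis using that(1) by (simp add: integrable_count_space_nat_iff abs_mult)
    qed
    note s1 = sm[of f] and s2 = sm[of "\<lambda>a. f (Suc a)"]
    have "geom_exp f = (\<Sum>k. pmf geom k * f k)"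
      using s1 that by (intro geom_expectation(2)) auto
    also have "\<dots> = (\<Sum>k. pmf geom (Suc k) * f (Suc k)) + pmf geom 0 * f 0"
      using s1 that by (subst suminf_split_head) auto
    also have "(\<Sum>k. pmf geom (Suc k) * f (Suc k)) = (\<Sum>k. r * (pmf geom k * f (Suc k)))"
      by (simp add: pmf_geom r_def del: pmf_geometric) (simp add: ac_simps)
    also have "\<dots> = r * (\<Sum>k. pmf geom k * f (Suc k))"
      using s2 that by (intro suminf_mult) auto
    also have "(\<Sum>k. pmf geom k * f (Suc k)) = geom_exp (\<lambda>a. f (Suc a))"
      using s2 that by (intro geom_expectation(2)[symmetric]) auto
    finally show ?thesis by (simp add: pmf_geom r_def del: pmf_geometric)
  qed
  define E2 where "E2 = geom_exp (\<lambda>a. (real a)\<^sup>2)"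
  have "E2 = r * geom_exp (\<lambda>a. (real (Suc a))\<^sup>2)"
    unfolding E2_def using int int2
    by (subst rec) (auto simp: power2_eq_square algebra_simps)
  also have "geom_exp (\<lambda>a. (real (Suc a))\<^sup>2) = E2 + 2 * h_fun \<pi> + 1"
    using int int2 geom_mean unfolding E2_def by (simp add: power2_eq_square algebra_simps)
  finally have "E2 * (1 - r) = r * (2 * h_fun \<pi> + 1)" by (simp add: algebra_simps)
  hence E2: "E2 = r * (2 * h_fun \<pi> + 1) / (1 - r)" using r by (simp add: field_simps)
  have hr: "h_fun \<pi> = r / (1 - r)" by (simp add: h_fun_def r_def exp_minus field_simps)
  have ur: "u_fun \<pi> = r / (1 - r)\<^sup>2"
    using \<pi> by (simp add: u_fun_def r_def exp_minus field_simps power2_eq_square)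
  have "geom_exp (\<lambda>a. (eps a)\<^sup>2) = E2 - (h_fun \<pi>)\<^sup>2"
    using int int2 geom_mean unfolding E2_def geom_eps_def
    by (simp add: power2_eq_square algebra_simps)
  also have "\<dots> = u_fun \<pi>"
  proof -
    have "1 - r \<noteq> 0" using r by simp
    thus ?thesis unfolding E2 hr ur by (simp add: divide_simps) algebra
  qed
  finally show ?thesis .
qed

context
  fixes p :: real
  assumes p: "1 \<le> p" "1 / p \<le> \<pi>"
begin

lemma geom_eps_mgf_bound:
  assumes "\<bar>s\<bar> \<le> 1 / (2 * p)"
  shows "integrable (measure_pmf geom) (\<lambda>a. exp (s * eps a))"
    and "geom_exp (\<lambda>a. exp (s * eps a)) \<le> exp (8 * s\<^sup>2 * p\<^sup>2)"
proof -
  have half: "1 / (2 * p) = 1 / p / 2" "0 < 1 / p" using p by auto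
  have s: "s < \<pi>" using assms p half by linarith
  show "integrable (measure_pmf geom) (\<lambda>a. exp (s * eps a))" by (rule geom_eps_mgf[OF s])
  have pos: "0 < x" if "1 / (2 * p) \<le> x" for x using that half by linarith
  have "\<bar>psi_fun (\<pi> - s) - psi_fun \<pi> - (- h_fun \<pi>) * (\<pi> - s - \<pi>)\<bar> \<le> (2 * (2 * p)\<^sup>2) * (\<pi> - s - \<pi>)\<^sup>2"
  proof (rule taylor_bound[where c="1 / (2 * p)" and f'="\<lambda>x. - h_fun x"])
    show "(psi_fun has_real_derivative - h_fun x) (at x)" if "1 / (2 * p) \<le> x" for x
      using psi_fun_deriv pos[OF that] .
    show "\<bar>- h_fun x - - h_fun y\<bar> \<le> 2 * (2 * p)\<^sup>2 * \<bar>x - y\<bar>" if "1 / (2 * p) \<le> x" "1 / (2 * p) \<le> y" for x y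
      using h_fun_lipschitz[of "2 * p" x y] that p by (simp add: abs_minus_commute)
    show "1 / (2 * p) \<le> \<pi>" "1 / (2 * p) \<le> \<pi> - s" using assms p half by linarith+
  qed auto
  hence "psi_fun (\<pi> - s) - psi_fun \<pi> - s * h_fun \<pi> \<le> 8 * s\<^sup>2 * p\<^sup>2"
    by (simp add: power_mult_distrib algebra_simps)
  thus "geom_exp (\<lambda>a. exp (s * eps a)) \<le> exp (8 * s\<^sup>2 * p\<^sup>2)"
    unfolding geom_eps_mgf(2)[OF s] by simp
qed

lemma geom_third_moment: "geom_exp (\<lambda>a. \<bar>eps a\<bar> ^ 3) \<le> 864 * p ^ 3"
proof -
  \<comment> \<open>The largest argument covered by \<open>geom_eps_mgf_bound\<close>; both
    exponential moments are then at most \<open>exp 2 \<le> 9\<close>, and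
    \<open>(6 / s^3) * 18 = 864 * p^3\<close>.\<close>
  define s where "s = 1 / (2 * p)"
  have s: "0 < s" "\<bar>s\<bar> \<le> 1 / (2 * p)" "\<bar>- s\<bar> \<le> 1 / (2 * p)" using p by (auto simp: s_def)
  note b = geom_eps_mgf_bound[OF s(2)] geom_eps_mgf_bound[OF s(3)]
  have sp: "8 * s\<^sup>2 * p\<^sup>2 = 2" using p by (simp add: s_def power2_eq_square)
  have "geom_exp (\<lambda>a. \<bar>eps a\<bar> ^ 3)
      \<le> geom_exp (\<lambda>a. 6 / s ^ 3 * (exp (s * eps a) + exp (- s * eps a)))"
  proof (rule integral_mono[OF geom_eps_integrable])
    fix a
    have "s ^ 3 * \<bar>eps a\<bar> ^ 3 \<le> 6 * (exp (s * eps a) + exp (- s * eps a))"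
      using power_le_fact_exp_abs[of "s * eps a" 3] s by (simp add: abs_mult power_mult_distrib fact_numeral)
    thus "\<bar>eps a\<bar> ^ 3 \<le> 6 / s ^ 3 * (exp (s * eps a) + exp (- s * eps a))"
      using s by (simp add: field_simps)
  qed (use b in auto)
  also have "\<dots> = 6 / s ^ 3 * (geom_exp (\<lambda>a. exp (s * eps a))
      + geom_exp (\<lambda>a. exp (- s * eps a)))"
    using b by simp
  also have "\<dots> \<le> 6 / s ^ 3 * (9 + 9)"
    using b s sp exp_2_le by (intro mult_left_mono add_mono) auto
  also have "\<dots> = 864 * p ^ 3" using p by (simp add: s_def power3_eq_cube)
  finally show ?thesis .
qed

end

end

section \<open>Linear statistics of independent geometric variables\<close>

text \<open>Degree deviations, the sums \<open>row_err\<close> and \<open>col_err\<close>, and the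
  projected main term all have this form, so one tail bound and one estimate of the characteristic
  function serve for all of them.\<close>

definition lin_stat :: "'i set \<Rightarrow> ('i \<Rightarrow> real) \<Rightarrow> ('i \<Rightarrow> real) \<Rightarrow> ('i \<Rightarrow> nat) \<Rightarrow> real" where
  "lin_stat I \<pi> c A = (\<Sum>i\<in>I. c i * geom_eps (\<pi> i) (A i))"

context
  fixes I :: "'i set" and \<pi> :: "'i \<Rightarrow> real" and p :: real
  assumes fin: "finite I" and p: "1 \<le> p" and \<pi>: "\<And>i. i \<in> I \<Longrightarrow> 1 / p \<le> \<pi> i"
begin

abbreviation "geoms \<equiv> Pi_pmf I (0::nat) (\<lambda>i. geometric_pmf (1 - exp (- \<pi> i)))"

abbreviation "geoms_exp \<equiv> measure_pmf.expectation geoms"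
abbreviation "lstat \<equiv> lin_stat I \<pi>"

lemma pi_pos: "i \<in> I \<Longrightarrow> 0 < \<pi> i"
  using \<pi>[of i] p by (smt (verit) zero_less_divide_1_iff)

lemma lin_stat_mgf:
  assumes "\<And>i. i \<in> I \<Longrightarrow> \<bar>c i\<bar> \<le> 1 / (2 * p)"
  shows "integrable (measure_pmf geoms) (\<lambda>A. exp (lstat c A))"
    and "geoms_exp (\<lambda>A. exp (lstat c A)) \<le> exp (8 * p\<^sup>2 * (\<Sum>i\<in>I. (c i)\<^sup>2))"
proof -
  note m = geom_eps_mgf_bound[OF pi_pos p \<pi> assms]
  have eq: "exp (lstat c A) = (\<Prod>i\<in>I. exp (c i * geom_eps (\<pi> i) (A i)))" for A
    unfolding lin_stat_def by (rule exp_sum[OF fin])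
  show "integrable (measure_pmf geoms) (\<lambda>A. exp (lstat c A))"
    unfolding eq by (intro integrable_prod_Pi_pmf fin m)
  have "geoms_exp (\<lambda>A. exp (lstat c A))
      = (\<Prod>i\<in>I. measure_pmf.expectation (geom (\<pi> i)) (\<lambda>a. exp (c i * geom_eps (\<pi> i) a)))"
    unfolding eq by (intro expectation_prod_Pi_pmf fin m) auto
  also have "\<dots> \<le> (\<Prod>i\<in>I. exp (8 * (c i)\<^sup>2 * p\<^sup>2))"
    by (intro prod_mono conjI m Bochner_Integration.integral_nonneg) auto
  also have "\<dots> = exp (8 * p\<^sup>2 * (\<Sum>i\<in>I. (c i)\<^sup>2))"
    by (simp add: exp_sum[OF fin, symmetric] sum_distrib_left sum_distrib_right ac_simps)
  finally show "geoms_exp (\<lambda>A. exp (lstat c A)) \<le> exp (8 * p\<^sup>2 * (\<Sum>i\<in>I. (c i)\<^sup>2))" .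
qed

lemma lin_stat_tail_upper:
  assumes V: "0 < V" "(\<Sum>i\<in>I. (c i)\<^sup>2) \<le> V" and L: "0 < L"
    and c: "\<And>i. i \<in> I \<Longrightarrow> \<bar>c i\<bar> * sqrt (L / V) \<le> 1 / 2"
  shows "measure geoms {A. lstat c A \<ge> 10 * p * sqrt (V * L)} \<le> exp (- 2 * L)"
proof -
  \<comment> \<open>This \<open>s\<close> makes the Chernoff exponent
    \<open>- 10 * L + 8 * L\<close>, and the assumption on \<open>c\<close> keeps every
    \<open>s * c i\<close> in the range of \<open>geom_eps_mgf_bound\<close>.\<close>
  define s where "s = sqrt (L / V) / p"
  have s: "0 < s" using V L p by (simp add: s_def)
  have eq: "s * lstat c A = lstat (\<lambda>i. s * c i) A" for A
    by (simp add: lin_stat_def sum_distrib_left mult.assoc)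
  have sc: "\<bar>s * c i\<bar> \<le> 1 / (2 * p)" if "i \<in> I" for i
    using c[OF that] s p unfolding abs_mult by (simp add: s_def field_simps)
  note m = lin_stat_mgf[of "\<lambda>i. s * c i", OF sc]
  have "measure geoms {A. 10 * p * sqrt (V * L) \<le> lstat c A}
      \<le> exp (- s * (10 * p * sqrt (V * L))) * (\<integral>A. exp (s * lstat c A) \<partial>geoms)"
    using measure_pmf.Chernoff_ineq_ge[OF s, of geoms UNIV "lstat c" "10 * p * sqrt (V * L)"] m(1)
    by (simp add: eq set_integrable_def set_lebesgue_integral_def)
  also have "\<dots> \<le> exp (- s * (10 * p * sqrt (V * L))) * exp (8 * p\<^sup>2 * (\<Sum>i\<in>I. (s * c i)\<^sup>2))"
    using m(2) by (intro mult_left_mono) (simp_all add: eq)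
  also have "\<dots> \<le> exp (- s * (10 * p * sqrt (V * L))) * exp (8 * p\<^sup>2 * (s\<^sup>2 * V))"
    using V by (auto simp: power_mult_distrib sum_distrib_left[symmetric] intro!: mult_left_mono)
  also have "\<dots> = exp (- 2 * L)"
  proof -
    have "s * (10 * p * sqrt (V * L)) = 10 * L"
      using V L p by (simp add: s_def real_sqrt_mult real_sqrt_divide)
    moreover have "8 * p\<^sup>2 * (s\<^sup>2 * V) = 8 * L"
      using V L p by (simp add: s_def power_divide)
    ultimately show ?thesis by (simp add: exp_add[symmetric])
  qed
  finally show ?thesis by simp
qed

lemma lin_stat_tail:
  assumes V: "0 < V" "(\<Sum>i\<in>I. (c i)\<^sup>2) \<le> V" and L: "0 < L"
    and c: "\<And>i. i \<in> I \<Longrightarrow> \<bar>c i\<bar> * sqrt (L / V) \<le> 1 / 2"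
  shows "measure geoms {A. \<bar>lstat c A\<bar> \<ge> 10 * p * sqrt (V * L)} \<le> 2 * exp (- 2 * L)"
proof -
  have "lstat (\<lambda>i. - c i) A = - lstat c A" for A
    by (simp add: lin_stat_def sum_negf)
  hence "{A. \<bar>lstat c A\<bar> \<ge> 10 * p * sqrt (V * L)} \<subseteq>
      {A. lstat c A \<ge> 10 * p * sqrt (V * L)} \<union> {A. lstat (\<lambda>i. - c i) A \<ge> 10 * p * sqrt (V * L)}"
    by auto
  hence "measure geoms {A. \<bar>lstat c A\<bar> \<ge> 10 * p * sqrt (V * L)} \<le>
      measure geoms ({A. lstat c A \<ge> 10 * p * sqrt (V * L)} \<union> {A. lstat (\<lambda>i. - c i) A \<ge> 10 * p * sqrt (V * L)})"
    by (intro measure_pmf.finite_measure_mono) auto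
  also have "\<dots> \<le> measure geoms {A. lstat c A \<ge> 10 * p * sqrt (V * L)} +
      measure geoms {A. lstat (\<lambda>i. - c i) A \<ge> 10 * p * sqrt (V * L)}"
    by (intro measure_Un_le) auto
  also have "\<dots> \<le> exp (- 2 * L) + exp (- 2 * L)"
    using assms by (intro add_mono lin_stat_tail_upper) auto
  finally show ?thesis by simp
qed

lemma geoms_component:
  fixes f :: "nat \<Rightarrow> 'b :: {banach, second_countable_topology}"
  assumes "i \<in> I"
  shows "integrable (measure_pmf geoms) (\<lambda>A. f (A i)) \<longleftrightarrow> integrable (measure_pmf (geom (\<pi> i))) f"
    and "geoms_exp (\<lambda>A. f (A i)) = measure_pmf.expectation (geom (\<pi> i)) f"
proof -
  have eq: "geom (\<pi> i) = map_pmf (\<lambda>A. A i) geoms"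
    using assms fin by (simp add: Pi_pmf_component)
  show "integrable (measure_pmf geoms) (\<lambda>A. f (A i)) \<longleftrightarrow> integrable (measure_pmf (geom (\<pi> i))) f"
    unfolding eq by (simp add: integrable_map_pmf_eq)
  show "geoms_exp (\<lambda>A. f (A i)) = measure_pmf.expectation (geom (\<pi> i)) f"
    unfolding eq by simp
qed

text \<open>For factors in the unit disc the difference of two products is at most the sum of the
  differences of the factors. Both factors are matched to \<open>1 - v / 2\<close>: the
  characteristic function up to a sixth of the third absolute moment, whence
  \<open>144 = 864 / 6\<close>, and the exponential up to \<open>(v / 2)^2 / 2\<close>.\<close>

lemma lin_stat_char:
  "cmod ((\<integral>A. iexp (lstat c A) \<partial>measure_pmf geoms) - complex_of_real (exp (- (\<Sum>i\<in>I. (c i)\<^sup>2 * u_fun (\<pi> i)) / 2)))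
    \<le> (\<Sum>i\<in>I. 144 * p ^ 3 * \<bar>c i\<bar> ^ 3 + ((c i)\<^sup>2 * u_fun (\<pi> i))\<^sup>2 / 8)"
proof -
  note P = measure_pmf.prob_space_axioms[of geoms]
  define X where "X i A = c i * geom_eps (\<pi> i) (A i)" for i and A :: "'i \<Rightarrow> nat"
  define \<phi> where "\<phi> i = Characteristic_Functions.char (distr geoms borel (X i)) 1" for i
  define v where "v i = (c i)\<^sup>2 * u_fun (\<pi> i)" for i
  have "prob_space.indep_vars geoms (\<lambda>_. borel) X I"
  proof -
    have "prob_space.indep_vars geoms (\<lambda>_. borel) (\<lambda>i A. (\<lambda>a. c i * geom_eps (\<pi> i) a) (A i)) I"
      by (rule prob_space.indep_vars_compose2[OF P indep_vars_Pi_pmf[OF fin]]) auto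
    thus ?thesis by (simp add: X_def[abs_def])
  qed
  hence "Characteristic_Functions.char (distr geoms borel (\<lambda>A. \<Sum>i\<in>I. X i A)) 1 = (\<Prod>i\<in>I. \<phi> i)"
    unfolding \<phi>_def by (intro prob_space.char_distr_sum[OF P]) auto
  hence 1: "(\<integral>A. iexp (lstat c A) \<partial>measure_pmf geoms) = (\<Prod>i\<in>I. \<phi> i)"
    by (simp add: char_def integral_distr lin_stat_def X_def)
  have 2: "complex_of_real (exp (- (\<Sum>i\<in>I. (c i)\<^sup>2 * u_fun (\<pi> i)) / 2)) = (\<Prod>i\<in>I. complex_of_real (exp (- v i / 2)))"
    by (simp add: exp_sum[OF fin, symmetric] v_def sum_negf sum_divide_distrib
        flip: of_real_prod)
  have v: "0 \<le> v i" if "i \<in> I" for i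
    using u_fun_pos[OF pi_pos[OF that]] by (simp add: v_def)
  have "cmod ((\<Prod>i\<in>I. \<phi> i) - (\<Prod>i\<in>I. complex_of_real (exp (- v i / 2)))) \<le>
      (\<Sum>i\<in>I. cmod (\<phi> i - complex_of_real (exp (- v i / 2))))"
  proof (rule norm_prod_diff)
    show "cmod (\<phi> i) \<le> 1" for i
      unfolding \<phi>_def
      by (intro real_distribution.cmod_char_le_1 prob_space.real_distribution_distr[OF P]) auto
    show "cmod (complex_of_real (exp (- v i / 2))) \<le> 1" if "i \<in> I" for i
      using v[OF that] by simp
  qed
  also have "\<dots> \<le> (\<Sum>i\<in>I. 144 * p ^ 3 * \<bar>c i\<bar> ^ 3 + (v i)\<^sup>2 / 8)"
  proof (rule sum_mono)
    fix i assume i: "i \<in> I"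
    have pos: "0 < \<pi> i" using pi_pos[OF i] .
    have sq: "(\<lambda>A. (X i A)\<^sup>2) = (\<lambda>A. (c i)\<^sup>2 * (geom_eps (\<pi> i) (A i))\<^sup>2)"
      by (simp add: X_def power_mult_distrib)
    have int3: "integrable (measure_pmf geoms) (\<lambda>A. \<bar>X i A\<bar> ^ 3)"
      using geom_eps_integrable[OF pos, of 3]
      by (simp add: X_def abs_mult power_mult_distrib geoms_component(1)[OF i, of "\<lambda>a. \<bar>geom_eps (\<pi> i) a\<bar> ^ 3"])
    have int2: "integrable (measure_pmf geoms) (\<lambda>A. (X i A)\<^sup>2)"
      using geom_eps_integrable[OF pos, of 2]
      by (simp add: sq geoms_component(1)[OF i, of "\<lambda>a. (geom_eps (\<pi> i) a)\<^sup>2"])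
    have int1: "integrable (measure_pmf geoms) (X i)"
      using geom_eps_mean(1)[OF pos]
      by (simp add: X_def[abs_def] geoms_component(1)[OF i, of "geom_eps (\<pi> i)"])
    have mean: "geoms_exp (X i) = 0"
      using geom_eps_mean(2)[OF pos]
      by (simp add: X_def[abs_def] geoms_component(2)[OF i, of "geom_eps (\<pi> i)"])
    have var: "measure_pmf.variance geoms (X i) = v i"
      unfolding mean using geom_variance[OF pos]
      by (simp add: sq v_def geoms_component(2)[OF i, of "\<lambda>a. (geom_eps (\<pi> i) a)\<^sup>2"])
    have "cmod (\<phi> i - (1 - 1\<^sup>2 * v i / 2)) \<le>
        (1\<^sup>2 / 6) * geoms_exp (\<lambda>A. min (6 * (X i A)\<^sup>2) (\<bar>1\<bar> * \<bar>X i A\<bar> ^ 3))"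
      unfolding \<phi>_def by (rule prob_space.char_approx3'[OF P _ int1 int2 mean var]) auto
    also have "\<dots> \<le> (1 / 6) * geoms_exp (\<lambda>A. \<bar>X i A\<bar> ^ 3)"
      using int2 int3 by (auto intro!: integral_mono mult_left_mono integrable_min)
    also have "geoms_exp (\<lambda>A. \<bar>X i A\<bar> ^ 3) =
        \<bar>c i\<bar> ^ 3 * measure_pmf.expectation (geom (\<pi> i)) (\<lambda>a. \<bar>geom_eps (\<pi> i) a\<bar> ^ 3)"
      by (simp add: X_def abs_mult power_mult_distrib geoms_component(2)[OF i, of "\<lambda>a. \<bar>geom_eps (\<pi> i) a\<bar> ^ 3"])
    also have "\<dots> \<le> \<bar>c i\<bar> ^ 3 * (864 * p ^ 3)"
      by (intro mult_left_mono geom_third_moment[OF pos p \<pi>[OF i]]) auto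
    finally have a: "cmod (\<phi> i - (1 - v i / 2)) \<le> 144 * p ^ 3 * \<bar>c i\<bar> ^ 3" by simp
    have "\<bar>(1 - y) - exp (- y)\<bar> \<le> y\<^sup>2 / 2" if "0 \<le> y" for y :: real
    proof -
      \<comment> \<open>The factor \<open>1 + y + y^2 / 2\<close> is at most \<open>exp y\<close>,
        while its product with \<open>1 - y + y^2 / 2\<close> is \<open>1 + y^4 / 4\<close>, at
        least 1; cancelling it gives the upper bound on \<open>exp (- y)\<close>.\<close>
      have "(1 + y + y\<^sup>2 / 2) * exp (- y) \<le> exp y * exp (- y)"
        using exp_lower_Taylor_quadratic[OF that] by (intro mult_right_mono) auto
      also have "\<dots> \<le> 1 + (y\<^sup>2)\<^sup>2 / 4" by (simp flip: exp_add)
      also have "\<dots> = (1 + y + y\<^sup>2 / 2) * (1 - y + y\<^sup>2 / 2)"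
        by (simp add: field_simps power2_eq_square)
      finally have "exp (- y) \<le> 1 - y + y\<^sup>2 / 2"
        using that by (subst (asm) mult_le_cancel_left_pos) (auto simp: add_pos_nonneg)
      moreover have "1 - y \<le> exp (- y)" using exp_ge_add_one_self[of "- y"] by simp
      ultimately show ?thesis by simp
    qed
    from this[of "v i / 2"] v[OF i] have "\<bar>(1 - v i / 2) - exp (- (v i / 2))\<bar> \<le> (v i)\<^sup>2 / 8"
      by (simp add: power_divide)
    hence b: "cmod ((1 - v i / 2) - complex_of_real (exp (- v i / 2))) \<le> (v i)\<^sup>2 / 8"
    proof -
      have "(1 - v i / 2) - complex_of_real (exp (- v i / 2)) = complex_of_real (1 - v i / 2 - exp (- (v i / 2)))"
        by simp
      thus ?thesis
        using \<open>\<bar>(1 - v i / 2) - exp (- (v i / 2))\<bar> \<le> (v i)\<^sup>2 / 8\<close> by (simp only: norm_of_real)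
    qed
    show "cmod (\<phi> i - complex_of_real (exp (- v i / 2))) \<le> 144 * p ^ 3 * \<bar>c i\<bar> ^ 3 + (v i)\<^sup>2 / 8"
      using norm_triangle_ineq[of "\<phi> i - (1 - v i / 2)" "(1 - v i / 2) - complex_of_real (exp (- v i / 2))"] a b
      by simp
  qed
  finally show ?thesis unfolding 1 2 v_def .
qed

end

section \<open>The bipartite Laplacian and the likelihood\<close>

text \<open>A row at the maximum forces the columns it meets to be close to \<open>hi\<close> on
  average. If the minimum is at a row as well, the columns common to both rows would have to be
  close to \<open>hi\<close> and to \<open>lo\<close>. If it is at a column, some row
  \<open>l\<close> is close to \<open>lo\<close>, yet the columns near \<open>hi\<close> pull it up,
  against its own inequality. Row \<open>i\<close> does not meet column \<open>i\<close>, so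
  \<open>y i\<close> is uncontrolled; it costs at most \<open>M * (hi - lo)\<close>, which the
  assumption \<open>2 * M \<le> (n - 1) * m\<close> absorbs.\<close>

lemma laplacian_osc_row:
  fixes x y :: "nat \<Rightarrow> real"
  assumes n: "3 \<le> n" and m: "0 < m" and M: "2 * M \<le> (real n - 1) * m"
    and c: "\<And>i j. i \<in> {1..n} \<Longrightarrow> j \<in> {1..n} \<Longrightarrow> i \<noteq> j \<Longrightarrow> m \<le> c i j \<and> c i j \<le> M"
    and bx: "\<And>i. i \<in> {1..n} \<Longrightarrow> lo \<le> x i \<and> x i \<le> hi"
    and by': "\<And>i. i \<in> {1..n} \<Longrightarrow> lo \<le> y i \<and> y i \<le> hi"
    and hi: "i \<in> {1..n}" "x i = hi" and lo: "j \<in> {1..n}" "x j = lo \<or> y j = lo"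
    and row: "\<And>i. i \<in> {1..n} \<Longrightarrow> lo < x i \<Longrightarrow> (\<Sum>k\<in>{1..n}-{i}. c i k * (x i - y k)) \<le> \<gamma>"
      "\<And>i. i \<in> {1..n} \<Longrightarrow> x i < hi \<Longrightarrow> - \<gamma> \<le> (\<Sum>k\<in>{1..n}-{i}. c i k * (x i - y k))"
    and col: "\<And>j. j \<in> {1..n} \<Longrightarrow> y j < hi \<Longrightarrow> - \<gamma> \<le> (\<Sum>k\<in>{1..n}-{j}. c k j * (y j - x k))"
    and \<gamma>: "0 \<le> \<gamma>"
  shows "hi - lo \<le> 6 * M * \<gamma> / (m\<^sup>2 * (real n - 1))"
proof (cases "lo < hi")
  case False
  have "m \<le> M" using c[of 1 2] n by auto
  hence "0 \<le> 6 * M * \<gamma> / (m\<^sup>2 * (real n - 1))" using n m \<gamma> by auto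
  thus ?thesis using False by simp
next
  case lohi: True
  have mM: "m \<le> M" using c[of 1 2] n by auto
  have n1: "real n - 1 > 0" using n by simp
  have gm: "\<gamma> / m \<le> M * \<gamma> / m\<^sup>2"
  proof -
    have "\<gamma> * m \<le> M * \<gamma>" using mult_right_mono[OF mM \<gamma>] by (simp add: mult.commute)
    thus ?thesis using m by (simp add: power2_eq_square field_simps)
  qed
  have fin: "hi - lo \<le> 6 * M * \<gamma> / (m\<^sup>2 * (real n - 1))"
    if "(real n - 1) * (hi - lo) \<le> 6 * (M * \<gamma> / m\<^sup>2)"
  proof -
    have "hi - lo \<le> 6 * (M * \<gamma> / m\<^sup>2) / (real n - 1)"
      using that by (subst pos_le_divide_eq[OF n1]) (simp add: mult.commute)
    thus ?thesis by (simp add: mult.assoc)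
  qed
  have above: "(\<Sum>k\<in>{1..n}-{i}. hi - y k) \<le> \<gamma> / m"
  proof -
    have "(\<Sum>k\<in>{1..n}-{i}. m * (hi - y k)) \<le> (\<Sum>k\<in>{1..n}-{i}. c i k * (x i - y k))"
      unfolding hi(2) using c hi by' by (intro sum_mono mult_right_mono) auto
    also have "\<dots> \<le> \<gamma>" using row(1)[OF hi(1)] lohi hi by simp
    finally show ?thesis using m unfolding sum_distrib_left[symmetric]
      by (subst pos_le_divide_eq) (simp_all only: mult.commute)
  qed
  show ?thesis
  proof (cases "x j = lo")
    case True
    have below: "(\<Sum>k\<in>{1..n}-{j}. y k - lo) \<le> \<gamma> / m"
    proof -
      have "(\<Sum>k\<in>{1..n}-{j}. m * (y k - lo)) \<le> (\<Sum>k\<in>{1..n}-{j}. c j k * (y k - x j))"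
        unfolding True using c lo by' by (intro sum_mono mult_right_mono) auto
      also have "\<dots> = - (\<Sum>k\<in>{1..n}-{j}. c j k * (x j - y k))"
        by (simp add: sum_negf[symmetric] algebra_simps)
      also have "\<dots> \<le> \<gamma>" using row(2)[OF lo(1)] lohi True by simp
      finally show ?thesis using m unfolding sum_distrib_left[symmetric]
      by (subst pos_le_divide_eq) (simp_all only: mult.commute)
    qed
    have ij: "i \<noteq> j" using hi True lohi by auto
    have "(real n - 2) * (hi - lo) = (\<Sum>k\<in>{1..n}-{i,j}. (hi - y k) + (y k - lo))"
      using hi lo ij n by (simp add: card_Diff_subset of_nat_diff)
    also have "\<dots> = (\<Sum>k\<in>{1..n}-{i,j}. hi - y k) + (\<Sum>k\<in>{1..n}-{i,j}. y k - lo)"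
      by (rule sum.distrib)
    also have "\<dots> \<le> (\<Sum>k\<in>{1..n}-{i}. hi - y k) + (\<Sum>k\<in>{1..n}-{j}. y k - lo)"
      using by' by (intro add_mono sum_mono2) auto
    also have "\<dots> \<le> 2 * (\<gamma> / m)" using above below by simp
    finally have "(real n - 2) * (hi - lo) \<le> 2 * (\<gamma> / m)" .
    moreover have "(real n - 1) / 2 * (hi - lo) \<le> (real n - 2) * (hi - lo)"
      using n lohi by (intro mult_right_mono) auto
    ultimately have "(real n - 1) * (hi - lo) \<le> 4 * (\<gamma> / m)" by simp
    also have "\<dots> \<le> 6 * (M * \<gamma> / m\<^sup>2)" using gm \<gamma> m mM by (smt (verit) divide_nonneg_pos)
    finally show ?thesis by (rule fin)
  next
    case False
    hence yj: "y j = lo" using lo by auto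
    have below: "(\<Sum>k\<in>{1..n}-{j}. x k - lo) \<le> \<gamma> / m"
    proof -
      have "(\<Sum>k\<in>{1..n}-{j}. m * (x k - lo)) \<le> (\<Sum>k\<in>{1..n}-{j}. c k j * (x k - y j))"
        unfolding yj using c lo bx by (intro sum_mono mult_right_mono) auto
      also have "\<dots> = - (\<Sum>k\<in>{1..n}-{j}. c k j * (y j - x k))"
        by (simp add: sum_negf[symmetric] algebra_simps)
      also have "\<dots> \<le> \<gamma>" using col[OF lo(1)] lohi yj by simp
      finally show ?thesis using m unfolding sum_distrib_left[symmetric]
      by (subst pos_le_divide_eq) (simp_all only: mult.commute)
    qed
    have card: "real (card ({1..n} - {j})) = real n - 1"
      using lo n by (simp add: card_Diff_subset of_nat_diff)
    \<comment> \<open>Averaging: some row exceeds \<open>lo\<close> by at most the mean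
      excess.\<close>
    obtain l where l: "l \<in> {1..n} - {j}" "(real n - 1) * (x l - lo) \<le> \<gamma> / m"
    proof (rule ccontr)
      assume "\<not> thesis"
      hence "\<forall>l\<in>{1..n}-{j}. \<gamma> / m < (real n - 1) * (x l - lo)" using that by force
      hence *: "\<forall>l\<in>{1..n}-{j}. (\<gamma> / m) / (real n - 1) < x l - lo"
        by (subst pos_divide_less_eq[OF n1]) (simp add: mult.commute)
      have "{1..n} - {j} \<noteq> {}" using card n1 by (metis card.empty of_nat_0 less_irrefl)
      hence "(\<Sum>l\<in>{1..n}-{j}. (\<gamma> / m) / (real n - 1)) < (\<Sum>k\<in>{1..n}-{j}. x k - lo)"
        using * by (intro sum_strict_mono) auto
      moreover have "(\<Sum>l\<in>{1..n}-{j}. (\<gamma> / m) / (real n - 1)) = \<gamma> / m"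
        unfolding sum_constant card using n1
        by (subst times_divide_eq_right, subst nonzero_mult_div_cancel_left) auto
      ultimately have "\<gamma> / m < (\<Sum>k\<in>{1..n}-{j}. x k - lo)" by simp
      thus False using below by simp
    qed
    \<comment> \<open>The inequality at row \<open>l\<close> is available only below
      \<open>hi\<close>; if \<open>x l = hi\<close>, the closeness of \<open>x l\<close> to
      \<open>lo\<close> already bounds \<open>hi - lo\<close>.\<close>
    show ?thesis
    proof (cases "x l < hi")
      case False
      hence "x l = hi" using bx l by force
      hence "(real n - 1) * (hi - lo) \<le> \<gamma> / m" using l by simp
      also have "\<dots> \<le> 6 * (M * \<gamma> / m\<^sup>2)" using gm \<gamma> m mM by (smt (verit) divide_nonneg_pos)
      finally show ?thesis by (rule fin)
    next
      case True
      have card': "real (card ({1..n} - {l})) = real n - 1"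
        using l n by (simp add: card_Diff_subset of_nat_diff)
      have "- \<gamma> \<le> (\<Sum>k\<in>{1..n}-{l}. c l k * (x l - y k))" using row(2) l True by auto
      \<comment> \<open>The difference \<open>x l - y k\<close> is split so that two non-negative
        quantities known to be small on average take the upper weight \<open>M\<close>, and the
        subtracted \<open>hi - lo\<close> takes the lower weight \<open>m\<close>.\<close>
      also have "\<dots> = (\<Sum>k\<in>{1..n}-{l}. c l k * (x l - lo) + c l k * (hi - y k) - c l k * (hi - lo))"
        by (intro sum.cong refl) (simp add: algebra_simps)
      also have "\<dots> \<le> (\<Sum>k\<in>{1..n}-{l}. M * (x l - lo) + M * (hi - y k) - m * (hi - lo))"
        using c l bx by' lohi by (intro sum_mono add_mono diff_mono mult_right_mono) auto
      also have "\<dots> = (real n - 1) * (M * (x l - lo)) + M * (\<Sum>k\<in>{1..n}-{l}. hi - y k)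
          - (real n - 1) * (m * (hi - lo))"
        by (simp add: sum.distrib sum_subtractf sum_distrib_left card'[unfolded One_nat_def] right_diff_distrib)
      also have "(\<Sum>k\<in>{1..n}-{l}. hi - y k) \<le> (\<Sum>k\<in>{1..n}. hi - y k)"
        using by' by (intro sum_mono2) auto
      also have "\<dots> = (hi - y i) + (\<Sum>k\<in>{1..n}-{i}. hi - y k)"
        using hi by (simp add: sum.remove)
      also have "\<dots> \<le> (hi - lo) + \<gamma> / m"
        using above by'[OF hi(1)] by (intro add_mono) auto
      finally have "- \<gamma> \<le> M * ((real n - 1) * (x l - lo)) + M * ((hi - lo) + \<gamma> / m) - (real n - 1) * (m * (hi - lo))"
        using m mM by (simp add: ac_simps)
      also have "M * ((real n - 1) * (x l - lo)) \<le> M * (\<gamma> / m)"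
        using l m mM by (intro mult_left_mono) auto
      finally have "((real n - 1) * m - M) * (hi - lo) \<le> \<gamma> + 2 * (M * (\<gamma> / m))"
        by (simp add: algebra_simps)
      moreover have "(real n - 1) * m / 2 * (hi - lo) \<le> ((real n - 1) * m - M) * (hi - lo)"
        using M lohi by (intro mult_right_mono) linarith+
      moreover have "\<gamma> \<le> M * (\<gamma> / m)"
      proof -
        have "m * (\<gamma> / m) \<le> M * (\<gamma> / m)" using mM m \<gamma> by (intro mult_right_mono) auto
        thus ?thesis using m by simp
      qed
      ultimately have "(real n - 1) * m / 2 * (hi - lo) \<le> 3 * (M * (\<gamma> / m))" by linarith
      hence "m * ((real n - 1) * (hi - lo)) \<le> m * (6 * (M * \<gamma> / m\<^sup>2))"
        using m by (simp add: power2_eq_square mult.assoc mult.left_commute[of m])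
      thus ?thesis unfolding mult_le_cancel_left_pos[OF m] by (rule fin)
    qed
  qed
qed

text \<open>A maximum principle for the weighted Laplacian of the complete bipartite graph without a
  perfect matching: \<open>x\<close> lives on the rows and \<open>y\<close> on the columns. Extremal nodes only need a
  one-sided bound, so that the lemma also applies to minimisers on the boundary of a box.\<close>

lemma laplacian_osc:
  fixes x y :: "nat \<Rightarrow> real"
  assumes n: "3 \<le> n" and m: "0 < m" and M: "2 * M \<le> (real n - 1) * m"
    and c: "\<And>i j. i \<in> {1..n} \<Longrightarrow> j \<in> {1..n} \<Longrightarrow> i \<noteq> j \<Longrightarrow> m \<le> c i j \<and> c i j \<le> M"
    and \<gamma>: "0 \<le> \<gamma>"
  defines "W \<equiv> x ` {1..n} \<union> y ` {1..n}"
  assumes row: "\<And>i. i \<in> {1..n} \<Longrightarrow> Min W < x i \<Longrightarrow> (\<Sum>k\<in>{1..n}-{i}. c i k * (x i - y k)) \<le> \<gamma>"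
      "\<And>i. i \<in> {1..n} \<Longrightarrow> x i < Max W \<Longrightarrow> - \<gamma> \<le> (\<Sum>k\<in>{1..n}-{i}. c i k * (x i - y k))"
    and col: "\<And>j. j \<in> {1..n} \<Longrightarrow> Min W < y j \<Longrightarrow> (\<Sum>k\<in>{1..n}-{j}. c k j * (y j - x k)) \<le> \<gamma>"
      "\<And>j. j \<in> {1..n} \<Longrightarrow> y j < Max W \<Longrightarrow> - \<gamma> \<le> (\<Sum>k\<in>{1..n}-{j}. c k j * (y j - x k))"
  shows "Max W - Min W \<le> 6 * M * \<gamma> / (m\<^sup>2 * (real n - 1))"
proof -
  have W: "finite W" "W \<noteq> {}" using n by (auto simp: W_def)
  have bounds: "Min W \<le> x i \<and> x i \<le> Max W" "Min W \<le> y i \<and> y i \<le> Max W" if "i \<in> {1..n}" for i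
    using W that by (auto intro!: Min_le Max_ge simp: W_def)
  have "Max W \<in> W" "Min W \<in> W" using W by auto
  then obtain i j where i: "i \<in> {1..n}" "x i = Max W \<or> y i = Max W"
    and j: "j \<in> {1..n}" "x j = Min W \<or> y j = Min W"
    by (auto simp: W_def)
  from i(2) show ?thesis
  proof
    assume "x i = Max W"
    show ?thesis
      by (rule laplacian_osc_row[OF n m M c bounds i(1) \<open>x i = Max W\<close> j row col(2) \<gamma>])
  next
    assume "y i = Max W"
    moreover have "y j = Min W \<or> x j = Min W" using j by auto
    ultimately show ?thesis
      using laplacian_osc_row[of n m M "\<lambda>i j. c j i" "Min W" y "Max W" x i j \<gamma>,
          OF n m M _ bounds(2,1) i(1) _ j(1) _ col row(2) \<gamma>] c by auto
  qed
qed

text \<open>The column variable is the negative of the perturbation of \<open>\<beta>\<close>, so that the derivatives of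
  \<open>neg_log_lik\<close> are Laplacians.\<close>

definition neg_log_lik :: "nat \<Rightarrow> (nat \<Rightarrow> nat \<Rightarrow> real) \<Rightarrow> (nat \<Rightarrow> real) \<Rightarrow> (nat \<Rightarrow> real) \<Rightarrow> (nat \<Rightarrow> real) \<Rightarrow> (nat \<Rightarrow> real) \<Rightarrow> real" where
  "neg_log_lik n \<pi> d b x y = (\<Sum>i\<in>{1..n}. \<Sum>j\<in>{1..n}-{i}. psi_fun (\<pi> i j + x i - y j))
     + (\<Sum>i\<in>{1..n}. d i * x i) - (\<Sum>j\<in>{1..n}. b j * y j)"

section \<open>The negative log-likelihood: symmetries, minimisers, uniqueness\<close>

lemma sum_offdiag_swap:
  "(\<Sum>i\<in>{1..n::nat}. \<Sum>j\<in>{1..n}-{i}. f i j) = (\<Sum>j\<in>{1..n}. \<Sum>i\<in>{1..n}-{j}. (f i j :: 'a :: comm_monoid_add))"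
proof -
  have *: "(\<Sum>j\<in>{1..n}-{i}. g j) = (\<Sum>j\<in>{1..n}. if j = i then 0 else g j)" for i and g :: "nat \<Rightarrow> 'a"
    by (rule sum.mono_neutral_cong_left) auto
  show ?thesis
    unfolding * by (subst sum.swap) (intro sum.cong refl, auto)
qed

text \<open>Transposing the matrix exchanges rows and columns, with signs from the convention for
  \<open>y\<close>. Facts about columns thus follow from those about rows.\<close>

lemma neg_log_lik_swap: "neg_log_lik n \<pi> d b x y = neg_log_lik n (\<lambda>i j. \<pi> j i) b d (\<lambda>i. - y i) (\<lambda>i. - x i)"
  unfolding neg_log_lik_def by (subst sum_offdiag_swap) (simp add: sum_negf algebra_simps)

text \<open>Equal degree totals cancel the shift in the linear terms. This freedom moves a minimiser
  away from the faces of the box.\<close>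

lemma neg_log_lik_shift:
  assumes "(\<Sum>i\<in>{1..n}. d i) = (\<Sum>j\<in>{1..n}. b j)"
  shows "neg_log_lik n \<pi> d b (\<lambda>i. x i - s) (\<lambda>i. y i - s) = neg_log_lik n \<pi> d b x y"
proof -
  have *: "\<pi> i j + (x i - s) - (y j - s) = \<pi> i j + x i - y j" for i j by simp
  show ?thesis
    unfolding neg_log_lik_def * using assms
    by (simp add: right_diff_distrib sum_subtractf flip: sum_distrib_right)
qed

text \<open>First-order conditions in a box: where \<open>x i\<close> may still decrease, the
  partial derivative cannot be positive, and where it may still increase, it cannot be negative. At
  a face only one of the two is available, which is what the one-sided assumptions of
  \<open>laplacian_osc\<close> accommodate.\<close>

lemma neg_log_lik_min_row:
  assumes i: "i \<in> {1..n}" and \<tau>: "x i \<in> {-\<tau>..\<tau>}"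
    and pos: "\<And>k. k \<in> {1..n}-{i} \<Longrightarrow> 0 < \<pi> i k + x i - y k"
    and min: "\<And>t. t \<in> {-\<tau>..\<tau>} \<Longrightarrow> neg_log_lik n \<pi> d b x y \<le> neg_log_lik n \<pi> d b (x(i := t)) y"
  shows "- \<tau> < x i \<Longrightarrow> d i \<le> (\<Sum>k\<in>{1..n}-{i}. h_fun (\<pi> i k + x i - y k))"
    and "x i < \<tau> \<Longrightarrow> (\<Sum>k\<in>{1..n}-{i}. h_fun (\<pi> i k + x i - y k)) \<le> d i"
proof -
  define f where "f t = (\<Sum>k\<in>{1..n}-{i}. psi_fun (\<pi> i k + t - y k)) + d i * t" for t
  define C where "C = (\<Sum>l\<in>{1..n}-{i}. \<Sum>j\<in>{1..n}-{l}. psi_fun (\<pi> l j + x l - y j))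
     + (\<Sum>l\<in>{1..n}-{i}. d l * x l) - (\<Sum>j\<in>{1..n}. b j * y j)"
  have "neg_log_lik n \<pi> d b (x(i := t)) y = f t + C" for t
  proof -
    have r: "(\<Sum>l\<in>{1..n}. F l) = F i + (\<Sum>l\<in>{1..n}-{i}. F l)" for F :: "nat \<Rightarrow> real"
      using i by (intro sum.remove) auto
    have "(\<Sum>l\<in>{1..n}-{i}. \<Sum>j\<in>{1..n}-{l}. psi_fun (\<pi> l j + (x(i := t)) l - y j))
        = (\<Sum>l\<in>{1..n}-{i}. \<Sum>j\<in>{1..n}-{l}. psi_fun (\<pi> l j + x l - y j))"
      "(\<Sum>l\<in>{1..n}-{i}. d l * (x(i := t)) l) = (\<Sum>l\<in>{1..n}-{i}. d l * x l)"
      by (auto intro!: sum.cong)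
    thus ?thesis
      unfolding neg_log_lik_def f_def C_def
      by (subst r[of "\<lambda>l. \<Sum>j\<in>{1..n}-{l}. psi_fun (\<pi> l j + (x(i := t)) l - y j)"],
          subst r[of "\<lambda>l. d l * (x(i := t)) l"]) simp
  qed
  from this[of "x i"] this have le: "f (x i) \<le> f t" if "t \<in> {-\<tau>..\<tau>}" for t
    using min[OF that] by simp
  define f' where "f' = (\<Sum>k\<in>{1..n}-{i}. - h_fun (\<pi> i k + x i - y k)) + d i"
  have "((\<lambda>t. psi_fun (\<pi> i k + t - y k)) has_real_derivative - h_fun (\<pi> i k + x i - y k)) (at (x i))"
    if "k \<in> {1..n}-{i}" for k
  proof -
    have lin: "((\<lambda>t. \<pi> i k + t - y k) has_real_derivative 1) (at (x i))"
      by (auto intro!: derivative_eq_intros)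
    show ?thesis
      using DERIV_chain2[OF psi_fun_deriv[OF pos[OF that]] lin] by simp
  qed
  hence "((\<lambda>t. \<Sum>k\<in>{1..n}-{i}. psi_fun (\<pi> i k + t - y k)) has_real_derivative
      (\<Sum>k\<in>{1..n}-{i}. - h_fun (\<pi> i k + x i - y k))) (at (x i))"
    by (rule DERIV_sum)
  moreover have "((\<lambda>t. d i * t) has_real_derivative d i) (at (x i))"
    by (auto intro!: derivative_eq_intros)
  ultimately have D: "(f has_real_derivative f') (at (x i))"
    unfolding f_def[abs_def] f'_def by (rule DERIV_add)
  show "d i \<le> (\<Sum>k\<in>{1..n}-{i}. h_fun (\<pi> i k + x i - y k))" if "- \<tau> < x i"
  proof (rule ccontr)
    assume "\<not> ?thesis"
    hence "0 < f'" by (simp add: f'_def sum_negf)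
    from DERIV_pos_inc_left[OF D this] obtain e where
      e: "0 < e" "\<And>s. 0 < s \<Longrightarrow> s < e \<Longrightarrow> f (x i - s) < f (x i)" by blast
    define s where "s = min (e / 2) (x i + \<tau>)"
    have "0 < s" "s < e" "x i - s \<in> {-\<tau>..\<tau>}" using e that \<tau> by (auto simp: s_def min_def)
    thus False using e(2)[of s] le[of "x i - s"] by simp
  qed
  show "(\<Sum>k\<in>{1..n}-{i}. h_fun (\<pi> i k + x i - y k)) \<le> d i" if "x i < \<tau>"
  proof (rule ccontr)
    assume "\<not> ?thesis"
    hence "f' < 0" by (simp add: f'_def sum_negf)
    from DERIV_neg_dec_right[OF D this] obtain e where
      e: "0 < e" "\<And>s. 0 < s \<Longrightarrow> s < e \<Longrightarrow> f (x i + s) < f (x i)" by blast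
    define s where "s = min (e / 2) (\<tau> - x i)"
    have "0 < s" "s < e" "x i + s \<in> {-\<tau>..\<tau>}" using e that \<tau> by (auto simp: s_def min_def)
    thus False using e(2)[of s] le[of "x i + s"] by simp
  qed
qed

lemma neg_log_lik_min_col:
  assumes j: "j \<in> {1..n}" and \<tau>: "y j \<in> {-\<tau>..\<tau>}"
    and pos: "\<And>k. k \<in> {1..n}-{j} \<Longrightarrow> 0 < \<pi> k j + x k - y j"
    and min: "\<And>t. t \<in> {-\<tau>..\<tau>} \<Longrightarrow> neg_log_lik n \<pi> d b x y \<le> neg_log_lik n \<pi> d b x (y(j := t))"
  shows "y j < \<tau> \<Longrightarrow> b j \<le> (\<Sum>k\<in>{1..n}-{j}. h_fun (\<pi> k j + x k - y j))"
    and "- \<tau> < y j \<Longrightarrow> (\<Sum>k\<in>{1..n}-{j}. h_fun (\<pi> k j + x k - y j)) \<le> b j"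
proof -
  have m: "neg_log_lik n (\<lambda>i j. \<pi> j i) b d (\<lambda>i. - y i) (\<lambda>i. - x i)
      \<le> neg_log_lik n (\<lambda>i j. \<pi> j i) b d ((\<lambda>i. - y i)(j := t)) (\<lambda>i. - x i)" if "t \<in> {-\<tau>..\<tau>}" for t
  proof -
    have "(\<lambda>i. - y i)(j := t) = (\<lambda>i. - (y(j := - t)) i)" by auto
    thus ?thesis using min[of "- t"] that by (simp add: neg_log_lik_swap[of n \<pi> d b])
  qed
  note r = neg_log_lik_min_row[of j n "\<lambda>i. - y i" \<tau> "\<lambda>i j. \<pi> j i" "\<lambda>i. - x i" b d, OF j _ _ m]
  show "y j < \<tau> \<Longrightarrow> b j \<le> (\<Sum>k\<in>{1..n}-{j}. h_fun (\<pi> k j + x k - y j))"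
    using r(1) \<tau> pos by (simp add: algebra_simps)
  show "- \<tau> < y j \<Longrightarrow> (\<Sum>k\<in>{1..n}-{j}. h_fun (\<pi> k j + x k - y j)) \<le> b j"
    using r(2) \<tau> pos by (simp add: algebra_simps)
qed

text \<open>Vectors are functions on all of \<open>nat\<close>, so the box is an infinite product of
  intervals and its compactness is Tychonoff's theorem; \<open>cut\<close> resets the coordinates
  outside \<open>{1..n}\<close>. The margin \<open>2 * \<tau> < \<pi> i j\<close> keeps the
  arguments of \<open>psi_fun\<close> positive.\<close>

lemma neg_log_lik_attains_min:
  assumes pos: "\<And>i j. i \<in> {1..n} \<Longrightarrow> j \<in> {1..n} \<Longrightarrow> i \<noteq> j \<Longrightarrow> 2 * \<tau> < \<pi> i j" and \<tau>: "0 \<le> \<tau>"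
  shows "\<exists>x y. (\<forall>i\<in>{1..n}. x i \<in> {-\<tau>..\<tau>} \<and> y i \<in> {-\<tau>..\<tau>}) \<and>
    (\<forall>x' y'. (\<forall>i\<in>{1..n}. x' i \<in> {-\<tau>..\<tau>} \<and> y' i \<in> {-\<tau>..\<tau>}) \<longrightarrow> neg_log_lik n \<pi> d b x y \<le> neg_log_lik n \<pi> d b x' y')"
proof -
  define B :: "(nat \<Rightarrow> real) set" where "B = PiE UNIV (\<lambda>_. {-\<tau>..\<tau>})"
  have "compactin (product_topology (\<lambda>_. euclidean) UNIV) B"
    unfolding B_def by (subst compactin_PiE) auto
  hence B: "compact B" by (simp add: euclidean_product_topology)
  have "(\<lambda>_. 0) \<in> B" using \<tau> by (simp add: B_def PiE_iff)
  hence ne: "B \<times> B \<noteq> {}" by blast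
  have psi: "continuous_on {0<..} psi_fun"
    by (rule DERIV_continuous_on) (auto intro: has_field_derivative_at_within psi_fun_deriv)
  have co: "continuous_on (B \<times> B) (\<lambda>w. fst w i)" "continuous_on (B \<times> B) (\<lambda>w. snd w i)" for i
    by (rule continuous_on_compose2[OF continuous_on_product_coordinates[of i] _ subset_UNIV],
        rule continuous_on_fst[OF continuous_on_id])
      (rule continuous_on_compose2[OF continuous_on_product_coordinates[of i] _ subset_UNIV],
        rule continuous_on_snd[OF continuous_on_id])
  have summand: "continuous_on (B \<times> B) (\<lambda>w. psi_fun (\<pi> i j + fst w i - snd w j))"
    if ij: "i \<in> {1..n}" "j \<in> {1..n} - {i}" for i j
  proof (rule continuous_on_compose2[OF psi])
    show "continuous_on (B \<times> B) (\<lambda>w. \<pi> i j + fst w i - snd w j)"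
      by (rule continuous_on_diff[OF continuous_on_add[OF continuous_on_const co(1)] co(2)])
    show "(\<lambda>w. \<pi> i j + fst w i - snd w j) ` (B \<times> B) \<subseteq> {0<..}"
    proof clarsimp
      fix x y assume xy: "x \<in> B" "y \<in> B"
      have "- \<tau> \<le> x i" "y j \<le> \<tau>" using xy by (auto simp: B_def PiE_iff)
      thus "y j < \<pi> i j + x i" using pos[of i j] ij by auto
    qed
  qed
  have "continuous_on (B \<times> B) (\<lambda>w. neg_log_lik n \<pi> d b (fst w) (snd w))"
    unfolding neg_log_lik_def
    by (intro continuous_on_diff continuous_on_add continuous_on_sum continuous_on_mult
        continuous_on_const co summand)
  from continuous_attains_inf[OF compact_Times[OF B B] ne this]
  obtain x y where xy: "x \<in> B" "y \<in> B"
    and min: "\<And>x' y'. x' \<in> B \<Longrightarrow> y' \<in> B \<Longrightarrow> neg_log_lik n \<pi> d b x y \<le> neg_log_lik n \<pi> d b x' y'"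
    by auto
  have "neg_log_lik n \<pi> d b x y \<le> neg_log_lik n \<pi> d b x' y'"
    if *: "\<forall>i\<in>{1..n}. x' i \<in> {-\<tau>..\<tau>} \<and> y' i \<in> {-\<tau>..\<tau>}" for x' y' :: "nat \<Rightarrow> real"
  proof -
    define cut where "cut z i = (if i \<in> {1..n} then z i else 0)" for z :: "nat \<Rightarrow> real" and i
    have "cut x' \<in> B" "cut y' \<in> B" using * \<tau> by (auto simp: B_def PiE_iff cut_def)
    moreover have "neg_log_lik n \<pi> d b (cut x') (cut y') = neg_log_lik n \<pi> d b x' y'"
      unfolding neg_log_lik_def cut_def by (intro arg_cong2[where f="(-)"] arg_cong2[where f="(+)"] sum.cong refl) auto
    ultimately show ?thesis using min by metis
  qed
  moreover have "\<forall>i\<in>{1..n}. x i \<in> {-\<tau>..\<tau>} \<and> y i \<in> {-\<tau>..\<tau>}"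
    using xy by (auto simp: B_def PiE_iff)
  ultimately show ?thesis by blast
qed

lemma h_fun_strict_antimono:
  assumes "0 < x" "x < y" shows "h_fun y < h_fun x"
  unfolding h_fun_def using assms by (intro divide_strict_left_mono mult_pos_pos) auto

text \<open>The differences of the equations, multiplied by the differences of the parameters and
  summed, give a vanishing sum of the terms \<open>D i j * e i j\<close>. None of them is positive,
  because \<open>h_fun\<close> is strictly decreasing, so every \<open>e i j\<close> vanishes. The
  gauge stands in for the missing equation of column \<open>n\<close>.\<close>

lemma likelihood_solution_unique:
  fixes \<alpha> \<beta> \<alpha>' \<beta>' :: "nat \<Rightarrow> real"
  assumes n: "3 \<le> n" and z: "\<beta> n = 0" "\<beta>' n = 0"
    and pos: "\<And>i j. i \<in> {1..n} \<Longrightarrow> j \<in> {1..n} \<Longrightarrow> i \<noteq> j \<Longrightarrow> 0 < \<alpha> i + \<beta> j \<and> 0 < \<alpha>' i + \<beta>' j"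
    and row: "\<And>i. i \<in> {1..n} \<Longrightarrow> (\<Sum>k\<in>{1..n}-{i}. h_fun (\<alpha> i + \<beta> k)) = (\<Sum>k\<in>{1..n}-{i}. h_fun (\<alpha>' i + \<beta>' k))"
    and col: "\<And>j. j \<in> {1..n-1} \<Longrightarrow> (\<Sum>k\<in>{1..n}-{j}. h_fun (\<alpha> k + \<beta> j)) = (\<Sum>k\<in>{1..n}-{j}. h_fun (\<alpha>' k + \<beta>' j))"
    and i: "i \<in> {1..n}"
  shows "\<alpha> i = \<alpha>' i"
proof -
  define D where "D i j = h_fun (\<alpha> i + \<beta> j) - h_fun (\<alpha>' i + \<beta>' j)" for i j
  define e where "e i j = (\<alpha> i + \<beta> j) - (\<alpha>' i + \<beta>' j)" for i j
  have D: "D i j * e i j \<le> 0" "D i j * e i j = 0 \<Longrightarrow> e i j = 0"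
    if "i \<in> {1..n}" "j \<in> {1..n}" "i \<noteq> j" for i j
  proof -
    have p: "0 < \<alpha> i + \<beta> j" "0 < \<alpha>' i + \<beta>' j" using pos[OF that] by auto
    have "D i j * e i j < 0" if "e i j \<noteq> 0"
    proof (cases "\<alpha> i + \<beta> j < \<alpha>' i + \<beta>' j")
      case True
      from h_fun_strict_antimono[OF p(1) this] True show ?thesis
        unfolding D_def e_def by (intro mult_pos_neg) auto
    next
      case False
      hence "\<alpha>' i + \<beta>' j < \<alpha> i + \<beta> j" using that by (simp add: e_def)
      from h_fun_strict_antimono[OF p(2) this] this show ?thesis
        unfolding D_def e_def by (intro mult_neg_pos) auto
    qed
    thus "D i j * e i j \<le> 0" "D i j * e i j = 0 \<Longrightarrow> e i j = 0" by force+
  qed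
  have "(\<Sum>i\<in>{1..n}. \<Sum>j\<in>{1..n}-{i}. D i j * e i j) =
      (\<Sum>i\<in>{1..n}. \<Sum>j\<in>{1..n}-{i}. D i j * (\<alpha> i - \<alpha>' i)) + (\<Sum>i\<in>{1..n}. \<Sum>j\<in>{1..n}-{i}. D i j * (\<beta> j - \<beta>' j))"
    by (simp add: e_def sum.distrib[symmetric] algebra_simps)
  also have "(\<Sum>i\<in>{1..n}. \<Sum>j\<in>{1..n}-{i}. D i j * (\<alpha> i - \<alpha>' i)) = 0"
  proof (rule sum.neutral, rule ballI)
    fix i assume "i \<in> {1..n}"
    hence "(\<Sum>j\<in>{1..n}-{i}. D i j) = 0" using row[of i] by (simp only: D_def sum_subtractf)
    thus "(\<Sum>j\<in>{1..n}-{i}. D i j * (\<alpha> i - \<alpha>' i)) = 0"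
      by (simp only: sum_distrib_right[symmetric])
  qed
  also have "(\<Sum>i\<in>{1..n}. \<Sum>j\<in>{1..n}-{i}. D i j * (\<beta> j - \<beta>' j)) = 0"
  proof (subst sum_offdiag_swap, rule sum.neutral, rule ballI)
    fix j assume j: "j \<in> {1..n}"
    show "(\<Sum>i\<in>{1..n}-{j}. D i j * (\<beta> j - \<beta>' j)) = 0"
    proof (cases "j = n")
      case False
      hence "j \<in> {1..n-1}" using j by auto
      hence "(\<Sum>i\<in>{1..n}-{j}. D i j) = 0" using col[of j] by (simp only: D_def sum_subtractf)
      thus ?thesis by (simp only: sum_distrib_right[symmetric])
    qed (simp add: z)
  qed
  finally have "(\<Sum>i\<in>{1..n}. \<Sum>j\<in>{1..n}-{i}. - (D i j * e i j)) = 0"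
    by (simp add: sum_negf)
  moreover have nn: "0 \<le> (\<Sum>j\<in>{1..n}-{i}. - (D i j * e i j))" if "i \<in> {1..n}" for i
    using D(1) that by (intro sum_nonneg) auto
  ultimately have 0: "\<forall>i\<in>{1..n}. (\<Sum>j\<in>{1..n}-{i}. - (D i j * e i j)) = 0"
    by (subst (asm) sum_nonneg_eq_0_iff) auto
  have "- (D i j * e i j) = 0" if ij: "i \<in> {1..n}" "j \<in> {1..n}-{i}" for i j
  proof -
    have "0 \<le> - (D i k * e i k)" if "k \<in> {1..n}-{i}" for k
      using D(1)[of i k] ij that by auto
    hence "\<forall>k\<in>{1..n}-{i}. - (D i k * e i k) = 0"
      using 0 ij by (subst sum_nonneg_eq_0_iff[symmetric]) auto
    thus ?thesis using ij by blast
  qed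
  hence e0: "e i j = 0" if "i \<in> {1..n}" "j \<in> {1..n}" "i \<noteq> j" for i j
    using D(2) that by simp
  show ?thesis
  proof (cases "i = n")
    case False
    thus ?thesis using e0[of i n] i z by (auto simp: e_def)
  next
    case True
    \<comment> \<open>The pair \<open>(n, n)\<close> is absent, so \<open>\<alpha> n\<close> is
      reached through row 2 and column 1 rather than through column \<open>n\<close>.\<close>
    have "\<alpha> 2 = \<alpha>' 2" using e0[of 2 n] n z by (auto simp: e_def)
    moreover have "e 2 1 = 0" "e n 1 = 0" using e0[of 2 1] e0[of n 1] n by auto
    ultimately show ?thesis using True by (simp add: e_def)
  qed
qed

section \<open>Deterministic analysis of the likelihood equations\<close>

definition row_info :: "nat \<Rightarrow> (nat \<Rightarrow> nat \<Rightarrow> real) \<Rightarrow> nat \<Rightarrow> real" where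
  "row_info n \<pi> i = (\<Sum>k\<in>{1..n}-{i}. u_fun (\<pi> i k))"

text \<open>At \<open>j = n\<close> this is the entry \<open>v_{2n,2n}\<close>
  (\<open>v2n2n_eq\<close>).\<close>

definition col_info :: "nat \<Rightarrow> (nat \<Rightarrow> nat \<Rightarrow> real) \<Rightarrow> nat \<Rightarrow> real" where
  "col_info n \<pi> j = (\<Sum>k\<in>{1..n}-{j}. u_fun (\<pi> k j))"

definition row_dev :: "nat \<Rightarrow> (nat \<Rightarrow> nat \<Rightarrow> real) \<Rightarrow> (nat \<Rightarrow> real) \<Rightarrow> nat \<Rightarrow> real" where
  "row_dev n \<pi> d i = d i - (\<Sum>k\<in>{1..n}-{i}. h_fun (\<pi> i k))"

definition col_dev :: "nat \<Rightarrow> (nat \<Rightarrow> nat \<Rightarrow> real) \<Rightarrow> (nat \<Rightarrow> real) \<Rightarrow> nat \<Rightarrow> real" where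
  "col_dev n \<pi> b j = b j - (\<Sum>k\<in>{1..n}-{j}. h_fun (\<pi> k j))"

text \<open>A fixed pair of degree sequences. Chance will enter only through
  \<open>\<gamma>\<close>, a bound on all degree deviations that holds with high
  probability.\<close>

locale degree_data =
  fixes n :: nat and \<pi> :: "nat \<Rightarrow> nat \<Rightarrow> real" and p Q :: real and d b :: "nat \<Rightarrow> real" and \<gamma> :: real
  assumes n: "3 \<le> n" and p: "1 \<le> p"
    and \<pi>: "\<And>i j. i \<in> {1..n} \<Longrightarrow> j \<in> {1..n} \<Longrightarrow> i \<noteq> j \<Longrightarrow> 1 / p \<le> \<pi> i j \<and> \<pi> i j \<le> Q"
    and total: "(\<Sum>i\<in>{1..n}. d i) = (\<Sum>j\<in>{1..n}. b j)"
    and row_noise: "\<And>i. i \<in> {1..n} \<Longrightarrow> \<bar>row_dev n \<pi> d i\<bar> \<le> \<gamma>"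
    and col_noise: "\<And>j. j \<in> {1..n} \<Longrightarrow> \<bar>col_dev n \<pi> b j\<bar> \<le> \<gamma>"
    and \<gamma>: "0 < \<gamma>"
begin

text \<open>The bound of \<open>laplacian_osc\<close> for weights between
  \<open>exp (- (Q + 1))\<close> and \<open>8 * p^2\<close>, the range in
  \<open>secant_slope\<close>; \<open>48 = 6 * 8\<close>.\<close>

definition "radius = 48 * p\<^sup>2 * exp (2 * (Q + 1)) * \<gamma> / (real n - 1)"

text \<open>The mean value theorem makes a difference of \<open>h_fun\<close> exactly linear in
  \<open>t\<close>, with slope \<open>u_fun\<close> at an unknown point. The likelihood conditions
  then form a Laplacian with unknown weights, which the maximum principle tolerates. The restriction
  on \<open>t\<close> keeps that point between \<open>1 / (2 * p)\<close> and
  \<open>Q + 1\<close>.\<close>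

lemma secant_slope:
  assumes "i \<in> {1..n}" "j \<in> {1..n}" "i \<noteq> j" "\<bar>t\<bar> \<le> 1 / (2 * p)"
  obtains c where "exp (- (Q + 1)) \<le> c" "c \<le> 8 * p\<^sup>2" "h_fun (\<pi> i j) - h_fun (\<pi> i j + t) = c * t"
proof -
  define a where "a = \<pi> i j"
  have a: "1 / p \<le> a" "a \<le> Q" using \<pi> assms by (auto simp: a_def)
  have half: "1 / (2 * p) = 1 / p / 2" "0 < 1 / p" "1 / p \<le> 1" using p by auto
  have u: "exp (- (Q + 1)) \<le> u_fun x \<and> u_fun x \<le> 8 * p\<^sup>2" if "1 / (2 * p) \<le> x" "x \<le> Q + 1" for x
  proof -
    have "0 < x" using that half by linarith
    hence "exp (- x) \<le> u_fun x" by (rule u_fun_lower)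
    moreover have "exp (- (Q + 1)) \<le> exp (- x)" using that by (subst exp_le_cancel_iff) linarith
    moreover have "u_fun x \<le> 2 * (2 * p)\<^sup>2" using that p by (intro u_fun_upper) auto
    ultimately show ?thesis by (auto simp: power_mult_distrib intro: order_trans)
  qed
  have at: "1 / (2 * p) \<le> a + t" "1 / (2 * p) \<le> a" "a + t \<le> Q + 1" "a \<le> Q + 1"
    using a assms(4) half by linarith+
  have D: "(h_fun has_real_derivative - u_fun x) (at x)" if "1 / (2 * p) \<le> x" for x
    by (rule h_fun_deriv) (use that half in linarith)
  consider "t = 0" | "0 < t" | "t < 0" by linarith
  hence "\<exists>x. 1 / (2 * p) \<le> x \<and> x \<le> Q + 1 \<and> h_fun a - h_fun (a + t) = u_fun x * t"
  proof cases
    case 1 thus ?thesis using at by (intro exI[of _ a]) auto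
  next
    case 2
    with MVT2[of a "a + t" h_fun "\<lambda>x. - u_fun x"] D at
    obtain z where "a < z" "z < a + t" "h_fun (a + t) - h_fun a = t * (- u_fun z)" by fastforce
    thus ?thesis using at by (intro exI[of _ z]) (auto simp: algebra_simps)
  next
    case 3
    with MVT2[of "a + t" a h_fun "\<lambda>x. - u_fun x"] D at
    obtain z where "a + t < z" "z < a" "h_fun a - h_fun (a + t) = (- t) * (- u_fun z)" by fastforce
    thus ?thesis using at by (intro exI[of _ z]) (auto simp: algebra_simps)
  qed
  thus thesis using u that unfolding a_def by metis
qed

text \<open>The box has half-width \<open>radius\<close>, which equals the oscillation bound implied
  by the one-sided conditions at its minimiser. A minimiser thus fills at most half of the width,
  and a common shift centres it in the interior, where all derivatives vanish. The condition on
  \<open>radius\<close> makes \<open>\<bar>x i - y j\<bar> \<le> 1 / (2 * p)\<close> in the box, as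
  \<open>secant_slope\<close> requires.\<close>

lemma likelihood_solution_exists:
  assumes radius: "radius \<le> 1 / (4 * p)" and big: "16 * p\<^sup>2 * exp (Q + 1) \<le> real n - 1"
  shows "\<exists>x y. y n = 0 \<and>
    (\<forall>i\<in>{1..n}. \<forall>j\<in>{1..n}. i \<noteq> j \<longrightarrow> \<bar>x i - y j\<bar> \<le> radius) \<and>
    (\<forall>i\<in>{1..n}. d i = (\<Sum>k\<in>{1..n}-{i}. h_fun (\<pi> i k + x i - y k))) \<and>
    (\<forall>j\<in>{1..n}. b j = (\<Sum>k\<in>{1..n}-{j}. h_fun (\<pi> k j + x k - y j)))"
proof -
  define \<tau> where "\<tau> = radius"
  have \<tau>: "0 < \<tau>" "4 * \<tau> \<le> 1 / p"
    using radius p n \<gamma> by (auto simp: \<tau>_def radius_def field_simps)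
  have pos2: "2 * \<tau> < \<pi> i j" if "i \<in> {1..n}" "j \<in> {1..n}" "i \<noteq> j" for i j
    using \<tau> \<pi>[OF that] by linarith
  obtain x y where
    xy: "\<forall>i\<in>{1..n}. x i \<in> {-\<tau>..\<tau>} \<and> y i \<in> {-\<tau>..\<tau>}" and
    min': "\<forall>x' y'. (\<forall>i\<in>{1..n}. x' i \<in> {-\<tau>..\<tau>} \<and> y' i \<in> {-\<tau>..\<tau>}) \<longrightarrow> neg_log_lik n \<pi> d b x y \<le> neg_log_lik n \<pi> d b x' y'"
    using neg_log_lik_attains_min[where n=n and \<pi>=\<pi> and \<tau>=\<tau> and d=d and b=b, OF pos2 less_imp_le[OF \<tau>(1)]]
    by blast
  have x: "x i \<in> {-\<tau>..\<tau>}" and y: "y i \<in> {-\<tau>..\<tau>}" if "i \<in> {1..n}" for i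
    using xy that by blast+
  have min: "neg_log_lik n \<pi> d b x y \<le> neg_log_lik n \<pi> d b x' y'"
    if "\<And>i. i \<in> {1..n} \<Longrightarrow> x' i \<in> {-\<tau>..\<tau>}" "\<And>i. i \<in> {1..n} \<Longrightarrow> y' i \<in> {-\<tau>..\<tau>}" for x' y'
    using min' that by blast
  have pos: "0 < \<pi> i k + x i - y k" if "i \<in> {1..n}" "k \<in> {1..n}" "i \<noteq> k" for i k
    using pos2[OF that] x[OF that(1)] y[OF that(2)] by simp
  have "\<forall>i j. \<exists>c. i \<in> {1..n} \<longrightarrow> j \<in> {1..n} \<longrightarrow> i \<noteq> j \<longrightarrow>
      exp (- (Q + 1)) \<le> c \<and> c \<le> 8 * p\<^sup>2 \<and> h_fun (\<pi> i j) - h_fun (\<pi> i j + (x i - y j)) = c * (x i - y j)"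
  proof (intro allI)
    fix i j
    show "\<exists>c. i \<in> {1..n} \<longrightarrow> j \<in> {1..n} \<longrightarrow> i \<noteq> j \<longrightarrow>
      exp (- (Q + 1)) \<le> c \<and> c \<le> 8 * p\<^sup>2 \<and> h_fun (\<pi> i j) - h_fun (\<pi> i j + (x i - y j)) = c * (x i - y j)"
    proof (cases "i \<in> {1..n} \<and> j \<in> {1..n} \<and> i \<noteq> j")
      case True
      have "1 / (2 * p) = 1 / p / 2" by simp
      hence "\<bar>x i - y j\<bar> \<le> 1 / (2 * p)" using x[of i] y[of j] True \<tau> by (simp only: abs_le_iff) auto
      with True show ?thesis using secant_slope[of i j "x i - y j"] by metis
    qed auto
  qed
  then obtain c where c: "\<And>i j. i \<in> {1..n} \<Longrightarrow> j \<in> {1..n} \<Longrightarrow> i \<noteq> j \<Longrightarrow>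
      exp (- (Q + 1)) \<le> c i j \<and> c i j \<le> 8 * p\<^sup>2 \<and> h_fun (\<pi> i j) - h_fun (\<pi> i j + (x i - y j)) = c i j * (x i - y j)"
    by metis
  have rsum: "(\<Sum>k\<in>{1..n}-{i}. c i k * (x i - y k)) =
      (\<Sum>k\<in>{1..n}-{i}. h_fun (\<pi> i k)) - (\<Sum>k\<in>{1..n}-{i}. h_fun (\<pi> i k + x i - y k))" if "i \<in> {1..n}" for i
    unfolding sum_subtractf[symmetric] using c that by (intro sum.cong refl) (auto simp: add_diff_eq)
  have csum: "(\<Sum>k\<in>{1..n}-{j}. c k j * (y j - x k)) =
      (\<Sum>k\<in>{1..n}-{j}. h_fun (\<pi> k j + x k - y j)) - (\<Sum>k\<in>{1..n}-{j}. h_fun (\<pi> k j))" if "j \<in> {1..n}" for j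
  proof -
    have "c k j * (y j - x k) = h_fun (\<pi> k j + x k - y j) - h_fun (\<pi> k j)" if "k \<in> {1..n}-{j}" for k
    proof -
      have "c k j * (y j - x k) = - (c k j * (x k - y j))" by (simp add: algebra_simps)
      thus ?thesis using c[of k j] that \<open>j \<in> {1..n}\<close> by (auto simp: add_diff_eq)
    qed
    thus ?thesis unfolding sum_subtractf[symmetric] by (intro sum.cong refl) auto
  qed
  define W where "W = x ` {1..n} \<union> y ` {1..n}"
  have W: "finite W" "W \<noteq> {}" using n by (auto simp: W_def)
  have Wb: "- \<tau> \<le> Min W" "Max W \<le> \<tau>" using W x y by (auto simp: W_def)
  have rmin: "neg_log_lik n \<pi> d b x y \<le> neg_log_lik n \<pi> d b (x(i := t)) y" if "t \<in> {-\<tau>..\<tau>}" for i t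
    using x y that by (intro min) auto
  have cmin: "neg_log_lik n \<pi> d b x y \<le> neg_log_lik n \<pi> d b x (y(j := t))" if "t \<in> {-\<tau>..\<tau>}" for j t
    using x y that by (intro min) auto
  have osc: "Max W - Min W \<le> \<tau>"
  proof -
    have big': "2 * (8 * p\<^sup>2) \<le> (real n - 1) * exp (- (Q + 1))"
    proof -
      have "16 * p\<^sup>2 * exp (Q + 1) * exp (- (Q + 1)) \<le> (real n - 1) * exp (- (Q + 1))"
        using big by (rule mult_right_mono) simp
      moreover have "exp (Q + 1) * exp (- (Q + 1)) = 1" by (simp only: exp_add[symmetric]) simp
      moreover from this have "16 * p\<^sup>2 * exp (Q + 1) * exp (- (Q + 1)) = 16 * p\<^sup>2" by (metis mult.assoc mult.right_neutral)
      ultimately show ?thesis by linarith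
    qed
    have "Max W - Min W \<le> 6 * (8 * p\<^sup>2) * \<gamma> / ((exp (- (Q + 1)))\<^sup>2 * (real n - 1))"
    proof (rule laplacian_osc[where n=n and x=x and y=y and c=c, folded W_def, OF n _ big'])
      fix i assume i: "i \<in> {1..n}"
      note r = neg_log_lik_min_row[of i n x \<tau> \<pi> y d b, OF i x[OF i] _ rmin]
      show "(\<Sum>k\<in>{1..n}-{i}. c i k * (x i - y k)) \<le> \<gamma>" if "Min W < x i"
        using r(1) pos i that Wb row_noise[OF i, unfolded row_dev_def] unfolding rsum[OF i] by (auto simp: abs_le_iff)
      show "- \<gamma> \<le> (\<Sum>k\<in>{1..n}-{i}. c i k * (x i - y k))" if "x i < Max W"
        using r(2) pos i that Wb row_noise[OF i, unfolded row_dev_def] unfolding rsum[OF i] by (auto simp: abs_le_iff)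
    next
      fix j assume j: "j \<in> {1..n}"
      note r = neg_log_lik_min_col[of j n y \<tau> \<pi> x d b, OF j y[OF j] _ cmin]
      show "(\<Sum>k\<in>{1..n}-{j}. c k j * (y j - x k)) \<le> \<gamma>" if "Min W < y j"
        using r(2) pos j that Wb col_noise[OF j, unfolded col_dev_def] unfolding csum[OF j] by (auto simp: abs_le_iff)
      show "- \<gamma> \<le> (\<Sum>k\<in>{1..n}-{j}. c k j * (y j - x k))" if "y j < Max W"
        using r(1) pos j that Wb col_noise[OF j, unfolded col_dev_def] unfolding csum[OF j] by (auto simp: abs_le_iff)
    qed (use c \<gamma> in auto)
    also have "\<dots> = \<tau>"
    proof -
      have "(exp (- (Q + 1)))\<^sup>2 = inverse (exp (2 * (Q + 1)))"
        by (simp only: exp_double exp_minus power_inverse)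
      thus ?thesis by (simp only: \<tau>_def radius_def) (simp add: field_simps)
    qed
    finally show ?thesis .
  qed
  \<comment> \<open>Subtracting the midpoint of the range leaves values of size at most
    \<open>\<tau> / 2\<close>.\<close>
  define s where "s = (Max W + Min W) / 2"
  define x1 where "x1 i = x i - s" for i
  define y1 where "y1 i = y i - s" for i
  have xW: "Min W \<le> x i" "x i \<le> Max W" "Min W \<le> y i" "y i \<le> Max W" if "i \<in> {1..n}" for i
    using W that by (auto intro!: Min_le Max_ge simp: W_def)
  have x1: "- \<tau> < x1 i" "x1 i < \<tau>" "- \<tau> < y1 i" "y1 i < \<tau>" if "i \<in> {1..n}" for i
    using xW[OF that] osc \<tau> by (auto simp: x1_def y1_def s_def field_simps)
  have P1: "neg_log_lik n \<pi> d b x1 y1 = neg_log_lik n \<pi> d b x y"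
    unfolding x1_def y1_def by (rule neg_log_lik_shift[OF total])
  have x1': "x1 i \<in> {-\<tau>..\<tau>}" "y1 i \<in> {-\<tau>..\<tau>}" if "i \<in> {1..n}" for i
    using x1[OF that] by auto
  have pos1: "0 < \<pi> i k + x1 i - y1 k" if "i \<in> {1..n}" "k \<in> {1..n}" "i \<noteq> k" for i k
    using pos[OF that] by (simp add: x1_def y1_def)
  have rmin1: "neg_log_lik n \<pi> d b x1 y1 \<le> neg_log_lik n \<pi> d b (x1(i := t)) y1" if "t \<in> {-\<tau>..\<tau>}" for i t
    unfolding P1 using x1' that by (intro min) auto
  have cmin1: "neg_log_lik n \<pi> d b x1 y1 \<le> neg_log_lik n \<pi> d b x1 (y1(j := t))" if "t \<in> {-\<tau>..\<tau>}" for j t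
    unfolding P1 using x1' that by (intro min) auto
  show ?thesis
  proof (rule exI[of _ "\<lambda>i. x i - y n"], rule exI[of _ "\<lambda>i. y i - y n"], intro conjI ballI impI)
    fix i j assume "i \<in> {1..n}" "j \<in> {1..n}"
    thus "\<bar>(x i - y n) - (y j - y n)\<bar> \<le> radius"
      using xW[of i] xW[of j] osc by (auto simp: \<tau>_def abs_le_iff)
  next
    fix i assume i: "i \<in> {1..n}"
    note r = neg_log_lik_min_row[of i n x1 \<tau> \<pi> y1 d b, OF i x1'(1)[OF i] _ rmin1]
    have "d i = (\<Sum>k\<in>{1..n}-{i}. h_fun (\<pi> i k + x1 i - y1 k))"
      using r pos1 i x1[OF i] by (intro antisym) auto
    thus "d i = (\<Sum>k\<in>{1..n}-{i}. h_fun (\<pi> i k + (x i - y n) - (y k - y n)))"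
      by (simp add: x1_def y1_def)
  next
    fix j assume j: "j \<in> {1..n}"
    note r = neg_log_lik_min_col[of j n y1 \<tau> \<pi> x1 d b, OF j x1'(2)[OF j] _ cmin1]
    have "b j = (\<Sum>k\<in>{1..n}-{j}. h_fun (\<pi> k j + x1 k - y1 j))"
      using r pos1 j x1[OF j] by (intro antisym) auto
    thus "b j = (\<Sum>k\<in>{1..n}-{j}. h_fun (\<pi> k j + (x k - y n) - (y j - y n)))"
      by (simp add: x1_def y1_def)
  qed simp
qed

abbreviation "vr \<equiv> row_info n \<pi>"
abbreviation "vc \<equiv> col_info n \<pi>"
abbreviation "gr \<equiv> row_dev n \<pi> d"
abbreviation "gc \<equiv> col_dev n \<pi> b"

text \<open>The maximum principle is applied to the solution minus its diagonal approximation; the gauge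
  \<open>y n = 0\<close> then fixes the additive constant.\<close>

lemma solution_expansion:
  fixes x y :: "nat \<Rightarrow> real"
  assumes z: "y n = 0" and r: "r \<le> 1 / (2 * p)"
    and close: "\<And>i j. i \<in> {1..n} \<Longrightarrow> j \<in> {1..n} \<Longrightarrow> i \<noteq> j \<Longrightarrow> \<bar>x i - y j\<bar> \<le> r"
    and row: "\<And>i. i \<in> {1..n} \<Longrightarrow> d i = (\<Sum>k\<in>{1..n}-{i}. h_fun (\<pi> i k + x i - y k))"
    and col: "\<And>j. j \<in> {1..n} \<Longrightarrow> b j = (\<Sum>k\<in>{1..n}-{j}. h_fun (\<pi> k j + x k - y j))"
    and er: "\<And>i. i \<in> {1..n} \<Longrightarrow> \<bar>\<Sum>k\<in>{1..n}-{i}. u_fun (\<pi> i k) * gc k / vc k\<bar> \<le> \<epsilon>"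
    and ec: "\<And>j. j \<in> {1..n} \<Longrightarrow> \<bar>\<Sum>k\<in>{1..n}-{j}. u_fun (\<pi> k j) * gr k / vr k\<bar> \<le> \<epsilon>"
    and big: "4 * p\<^sup>2 * exp Q \<le> real n - 1"
    and i: "i \<in> {1..n}"
  shows "\<bar>x i + gr i / vr i + gc n / vc n\<bar> \<le> 12 * p\<^sup>2 * exp (2 * Q) * (48 * p ^ 3 * r\<^sup>2 * real n + \<epsilon>) / (real n - 1)"
proof -
  have half: "1 / (2 * p) = 1 / p / 2" "0 < 1 / p" using p by auto
  have r0: "0 \<le> r" using close[of 1 2] n by auto
  have \<epsilon>0: "0 \<le> \<epsilon>" using er[OF i] by linarith
  have \<pi>pos: "0 < \<pi> i j" if "i \<in> {1..n}" "j \<in> {1..n}" "i \<noteq> j" for i j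
    using \<pi>[OF that] half by linarith
  have u: "exp (- Q) \<le> u_fun (\<pi> i j)" "u_fun (\<pi> i j) \<le> 2 * p\<^sup>2"
    if "i \<in> {1..n}" "j \<in> {1..n}" "i \<noteq> j" for i j
  proof -
    have "exp (- Q) \<le> exp (- \<pi> i j)" using \<pi>[OF that] by simp
    also have "\<dots> \<le> u_fun (\<pi> i j)" by (rule u_fun_lower[OF \<pi>pos[OF that]])
    finally show "exp (- Q) \<le> u_fun (\<pi> i j)" .
    show "u_fun (\<pi> i j) \<le> 2 * p\<^sup>2" using \<pi>[OF that] p by (intro u_fun_upper) auto
  qed
  have other: "\<exists>k. k \<in> {1..n} - {i}" for i
    using n by (intro exI[of _ "if i = 1 then 2 else 1"]) auto
  have vr: "0 < vr i" and vc: "0 < vc i" if "i \<in> {1..n}" for i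
  proof -
    have "finite ({1..n} - {i})" "{1..n} - {i} \<noteq> {}" using other[of i] by auto
    thus "0 < vr i" "0 < vc i"
      unfolding row_info_def col_info_def using that by (intro sum_pos u_fun_pos \<pi>pos; auto)+
  qed
  define \<rho> where "\<rho> i j = h_fun (\<pi> i j + (x i - y j)) - h_fun (\<pi> i j) + u_fun (\<pi> i j) * (x i - y j)" for i j
  have \<rho>: "\<bar>\<rho> i j\<bar> \<le> 48 * p ^ 3 * r\<^sup>2" if "i \<in> {1..n}" "j \<in> {1..n}" "i \<noteq> j" for i j
  proof -
    have "1 / (2 * p) \<le> \<pi> i j" "1 / (2 * p) \<le> \<pi> i j + (x i - y j)"
      using \<pi>[OF that] close[OF that] r half by (auto simp: abs_le_iff)
    hence "\<bar>\<rho> i j\<bar> \<le> 6 * (2 * p) ^ 3 * (x i - y j)\<^sup>2"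
      unfolding \<rho>_def using h_fun_taylor[of "2 * p" "\<pi> i j" "\<pi> i j + (x i - y j)"] p by simp
    also have "(x i - y j)\<^sup>2 \<le> r\<^sup>2"
      using close[OF that] r0 by (metis abs_le_square_iff abs_of_nonneg)
    finally show ?thesis using p by (simp add: power_mult_distrib)
  qed
  have sum_bound: "\<bar>\<Sum>k\<in>{1..n}-{i}. f k\<bar> \<le> 48 * p ^ 3 * r\<^sup>2 * real n"
    if "\<And>k. k \<in> {1..n}-{i} \<Longrightarrow> \<bar>f k\<bar> \<le> 48 * p ^ 3 * r\<^sup>2" for f i
  proof -
    have "\<bar>\<Sum>k\<in>{1..n}-{i}. f k\<bar> \<le> (\<Sum>k\<in>{1..n}-{i}. 48 * p ^ 3 * r\<^sup>2)"
      using that by (intro order.trans[OF sum_abs] sum_mono)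
    also have "\<dots> = real (card ({1..n}-{i})) * (48 * p ^ 3 * r\<^sup>2)" by simp
    also have "\<dots> \<le> real n * (48 * p ^ 3 * r\<^sup>2)"
      using p card_mono[of "{1..n}" "{1..n}-{i}"] by (intro mult_right_mono) auto
    finally show ?thesis by (simp add: mult.commute)
  qed
  define zr where "zr i = x i + gr i / vr i" for i
  define zc where "zc j = y j - gc j / vc j" for j
  \<comment> \<open>The choice of \<open>zr\<close> cancels the deviation of row \<open>i\<close>
    against \<open>vr i * (gr i / vr i)\<close>. Only Taylor remainders and the column deviations,
    averaged with weights of order \<open>1 / n\<close>, are left.\<close>
  have rowz: "(\<Sum>k\<in>{1..n}-{i}. u_fun (\<pi> i k) * (zr i - zc k)) =
      (\<Sum>k\<in>{1..n}-{i}. \<rho> i k) + (\<Sum>k\<in>{1..n}-{i}. u_fun (\<pi> i k) * gc k / vc k)" if "i \<in> {1..n}" for i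
  proof -
    have "(\<Sum>k\<in>{1..n}-{i}. u_fun (\<pi> i k) * (zr i - zc k)) =
        (\<Sum>k\<in>{1..n}-{i}. \<rho> i k - (h_fun (\<pi> i k + x i - y k) - h_fun (\<pi> i k)) + u_fun (\<pi> i k) * (gr i / vr i)
          + u_fun (\<pi> i k) * gc k / vc k)"
      by (intro sum.cong refl) (simp add: zr_def zc_def \<rho>_def algebra_simps)
    also have "\<dots> = (\<Sum>k\<in>{1..n}-{i}. \<rho> i k) - gr i + vr i * (gr i / vr i)
        + (\<Sum>k\<in>{1..n}-{i}. u_fun (\<pi> i k) * gc k / vc k)"
      unfolding sum.distrib sum_subtractf sum_distrib_right[symmetric] row_dev_def row_info_def
      using row[OF that] by simp
    finally show ?thesis using vr[OF that] by simp
  qed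
  have colz: "(\<Sum>k\<in>{1..n}-{j}. u_fun (\<pi> k j) * (zc j - zr k)) =
      - (\<Sum>k\<in>{1..n}-{j}. \<rho> k j) - (\<Sum>k\<in>{1..n}-{j}. u_fun (\<pi> k j) * gr k / vr k)" if "j \<in> {1..n}" for j
  proof -
    have "(\<Sum>k\<in>{1..n}-{j}. u_fun (\<pi> k j) * (zc j - zr k)) =
        (\<Sum>k\<in>{1..n}-{j}. (h_fun (\<pi> k j + x k - y j) - h_fun (\<pi> k j)) - \<rho> k j - u_fun (\<pi> k j) * (gc j / vc j)
          - u_fun (\<pi> k j) * gr k / vr k)"
      by (intro sum.cong refl) (simp add: zr_def zc_def \<rho>_def algebra_simps)
    also have "\<dots> = gc j - (\<Sum>k\<in>{1..n}-{j}. \<rho> k j) - vc j * (gc j / vc j)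
        - (\<Sum>k\<in>{1..n}-{j}. u_fun (\<pi> k j) * gr k / vr k)"
      unfolding sum_subtractf sum_distrib_right[symmetric] col_dev_def col_info_def
      using col[OF that] by simp
    finally show ?thesis using vc[OF that] by simp
  qed
  define G where "G = 48 * p ^ 3 * r\<^sup>2 * real n + \<epsilon>"
  have G0: "0 \<le> G" using \<epsilon>0 p by (simp add: G_def)
  have rb: "\<bar>\<Sum>k\<in>{1..n}-{i}. u_fun (\<pi> i k) * (zr i - zc k)\<bar> \<le> G" if "i \<in> {1..n}" for i
  proof -
    have "\<bar>\<Sum>k\<in>{1..n}-{i}. \<rho> i k\<bar> \<le> 48 * p ^ 3 * r\<^sup>2 * real n"
      using \<rho> that by (intro sum_bound) auto
    thus ?thesis unfolding rowz[OF that] G_def using er[OF that] by linarith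
  qed
  have cb: "\<bar>\<Sum>k\<in>{1..n}-{j}. u_fun (\<pi> k j) * (zc j - zr k)\<bar> \<le> G" if "j \<in> {1..n}" for j
  proof -
    have "\<bar>\<Sum>k\<in>{1..n}-{j}. \<rho> k j\<bar> \<le> 48 * p ^ 3 * r\<^sup>2 * real n"
      using \<rho> that by (intro sum_bound) auto
    thus ?thesis unfolding colz[OF that] G_def using ec[OF that] by linarith
  qed
  define W where "W = zr ` {1..n} \<union> zc ` {1..n}"
  have W: "finite W" by (simp add: W_def)
  have big': "2 * (2 * p\<^sup>2) \<le> (real n - 1) * exp (- Q)"
    using big by (simp add: exp_minus field_simps)
  have "Max W - Min W \<le> 6 * (2 * p\<^sup>2) * G / ((exp (- Q))\<^sup>2 * (real n - 1))"
    unfolding W_def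
    by (rule laplacian_osc[OF n _ big' _ G0, where c="\<lambda>i j. u_fun (\<pi> i j)"])
      (use u rb cb in \<open>auto simp: abs_le_iff minus_le_iff\<close>)
  also have "\<dots> = 12 * p\<^sup>2 * exp (2 * Q) * G / (real n - 1)"
    using exp_double[of Q] by (simp add: exp_minus power_inverse field_simps)
  finally have osc: "Max W - Min W \<le> 12 * p\<^sup>2 * exp (2 * Q) * G / (real n - 1)" .
  have "Min W \<le> zr i" "zr i \<le> Max W" "Min W \<le> zc n" "zc n \<le> Max W"
    using W i n by (auto intro!: Min_le Max_ge simp: W_def)
  moreover have "x i + gr i / vr i + gc n / vc n = zr i - zc n"
    by (simp add: zr_def zc_def z)
  ultimately show ?thesis using osc unfolding G_def by (simp only: abs_le_iff) linarith
qed

end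

section \<open>The discrete-weight model\<close>

lemma sum_offdiag:
  "(\<Sum>x\<in>offdiag n. f x) = (\<Sum>i\<in>{1..n}. \<Sum>j\<in>{1..n}-{i}. f (i, j))"
proof -
  have "offdiag n = Sigma {1..n} (\<lambda>i. {1..n} - {i})" by (auto simp: offdiag_def)
  thus ?thesis by (simp add: sum.Sigma)
qed

lemma finite_offdiag [simp]: "finite (offdiag n)"
  by (rule finite_subset[of _ "{1..n} \<times> {1..n}"]) (auto simp: offdiag_def)

abbreviation (input) rate_at :: "nat \<Rightarrow> (nat \<Rightarrow> real) \<Rightarrow> nat \<Rightarrow> nat \<Rightarrow> real" where
  "rate_at n \<theta> i j \<equiv> alpha \<theta> i + beta n \<theta> j"

section \<open>Entries of the Fisher information and of \<open>S\<close>\<close>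

lemma vmat_diag:
  assumes "i \<in> {1..n}"
  shows "vmat n \<theta> i i = row_info n (rate_at n \<theta>) i"
  using assms by (simp add: vmat_def row_info_def)

lemma sum_split_index:
  fixes f :: "nat \<Rightarrow> real"
  assumes "1 \<le> n"
  shows "(\<Sum>j\<in>{1..2*n-1}. f j) = (\<Sum>j\<in>{1..n}. f j) + (\<Sum>j\<in>{1..n-1}. f (n + j))"
proof -
  have "{1..2*n-1} = {1..n} \<union> {n+1..n+(n-1)}" using assms by auto
  moreover have "(\<Sum>j\<in>{n+1..n+(n-1)}. f j) = (\<Sum>j\<in>{1..n-1}. f (n + j))"
    by (rule sum.reindex_bij_witness[of _ "\<lambda>j. n + j" "\<lambda>j. j - n"]) auto
  ultimately show ?thesis by (subst \<open>{1..2*n-1} = _\<close>, subst sum.union_disjoint) auto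
qed

text \<open>The off-diagonal entries in row \<open>i\<close> cover only the columns below
  \<open>n\<close>, while the diagonal entry sums over all columns except \<open>i\<close>. The
  difference is the weight of column \<open>n\<close>, which row \<open>n\<close> does not
  meet.\<close>

lemma v2n_row:
  assumes n: "2 \<le> n" and i: "i \<in> {1..n}"
  shows "v2n n \<theta> i = (if i = n then 0 else u_fun (rate_at n \<theta> i n))"
proof -
  have "(\<Sum>j\<in>{1..2*n-1} - {i}. vmat n \<theta> i j) = (\<Sum>j\<in>{1..2*n-1}. if j = i then 0 else vmat n \<theta> i j)"
    by (rule sum.mono_neutral_cong_left) auto
  also have "\<dots> = (\<Sum>j\<in>{1..n}. if j = i then 0 else vmat n \<theta> i j)
      + (\<Sum>j\<in>{1..n-1}. if n + j = i then 0 else vmat n \<theta> i (n + j))"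
    using n by (subst sum_split_index) auto
  also have "(\<Sum>j\<in>{1..n}. if j = i then 0 else vmat n \<theta> i j) = 0"
    using i by (intro sum.neutral ballI) (simp add: vmat_def)
  also have "(\<Sum>j\<in>{1..n-1}. if n + j = i then 0 else vmat n \<theta> i (n + j)) =
      (\<Sum>j\<in>{1..n-1}. if j = i then 0 else u_fun (rate_at n \<theta> i j))"
    using i by (intro sum.cong refl) (auto simp: vmat_def)
  also have "\<dots> = (\<Sum>j\<in>{1..n} - {i} - {n}. u_fun (rate_at n \<theta> i j))"
    by (rule sum.mono_neutral_cong_right) auto
  finally have "v2n n \<theta> i = (\<Sum>j\<in>{1..n} - {i}. u_fun (rate_at n \<theta> i j))
      - (\<Sum>j\<in>{1..n} - {i} - {n}. u_fun (rate_at n \<theta> i j))"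
    using i by (simp add: v2n_def vmat_diag row_info_def)
  also have "\<dots> = (if i = n then 0 else u_fun (rate_at n \<theta> i n))"
  proof (cases "i = n")
    case False
    hence "(\<Sum>j\<in>{1..n} - {i}. u_fun (rate_at n \<theta> i j)) =
        u_fun (rate_at n \<theta> i n) + (\<Sum>j\<in>{1..n} - {i} - {n}. u_fun (rate_at n \<theta> i j))"
      using n by (intro sum.remove) auto
    thus ?thesis using False by simp
  qed simp
  finally show ?thesis .
qed

text \<open>Column \<open>j\<close> below \<open>n\<close> meets every row other than
  \<open>j\<close>, and each row has its own parameter, so the diagonal entry is balanced
  exactly.\<close>

lemma v2n_col:
  assumes n: "2 \<le> n" and j: "j \<in> {1..n-1}"
  shows "v2n n \<theta> (n + j) = 0"
proof -
  have "(\<Sum>b\<in>{1..2*n-1} - {n + j}. vmat n \<theta> (n + j) b) =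
      (\<Sum>b\<in>{1..2*n-1}. if b = n + j then 0 else vmat n \<theta> (n + j) b)"
    by (rule sum.mono_neutral_cong_left) auto
  also have "\<dots> = (\<Sum>b\<in>{1..n}. if b = n + j then 0 else vmat n \<theta> (n + j) b)
      + (\<Sum>b\<in>{1..n-1}. if n + b = n + j then 0 else vmat n \<theta> (n + j) (n + b))"
    using n by (subst sum_split_index) auto
  also have "(\<Sum>b\<in>{1..n-1}. if n + b = n + j then 0 else vmat n \<theta> (n + j) (n + b)) = 0"
    using j by (intro sum.neutral ballI) (auto simp: vmat_def)
  also have "(\<Sum>b\<in>{1..n}. if b = n + j then 0 else vmat n \<theta> (n + j) b) =
      (\<Sum>b\<in>{1..n}. if b = j then 0 else u_fun (rate_at n \<theta> b j))"
    using j by (intro sum.cong refl) (auto simp: vmat_def)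
  also have "\<dots> = (\<Sum>b\<in>{1..n} - {j}. u_fun (rate_at n \<theta> b j))"
    by (rule sum.mono_neutral_cong_right) auto
  also have "\<dots> = vmat n \<theta> (n + j) (n + j)"
  proof -
    have "n + j \<le> 2 * n - 1" using j n by auto
    thus ?thesis using j by (simp add: vmat_def)
  qed
  finally show ?thesis by (simp add: v2n_def)
qed

lemma v2n2n_eq:
  assumes n: "2 \<le> n"
  shows "v2n2n n \<theta> = col_info n (rate_at n \<theta>) n"
proof -
  have "v2n2n n \<theta> = (\<Sum>i\<in>{1..n}. v2n n \<theta> i) + (\<Sum>j\<in>{1..n-1}. v2n n \<theta> (n + j))"
    unfolding v2n2n_def using n by (intro sum_split_index) auto
  also have "(\<Sum>j\<in>{1..n-1}. v2n n \<theta> (n + j)) = 0"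
    using n by (intro sum.neutral ballI v2n_col)
  also have "(\<Sum>i\<in>{1..n}. v2n n \<theta> i) = (\<Sum>i\<in>{1..n}. if i = n then 0 else u_fun (rate_at n \<theta> i n))"
    using n by (intro sum.cong refl v2n_row)
  also have "\<dots> = col_info n (rate_at n \<theta>) n"
    unfolding col_info_def by (rule sum.mono_neutral_cong_right) auto
  finally show ?thesis by simp
qed

lemma Smat_block:
  assumes "2 \<le> n" "a \<in> {1..n}" "b \<in> {1..n}"
  shows "Smat n \<theta> a b = (if a = b then 1 / row_info n (rate_at n \<theta>) a else 0) + 1 / col_info n (rate_at n \<theta>) n"
  unfolding Smat_def using assms by (simp add: v2n2n_eq vmat_diag)

lemma geom_model_eq:
  "geom_model n \<theta> = Pi_pmf (offdiag n) 0 (\<lambda>x. geometric_pmf (1 - exp (- (case x of (i, j) \<Rightarrow> rate_at n \<theta> i j))))"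
  unfolding geom_model_def by (intro arg_cong[where f="Pi_pmf (offdiag n) 0"]) auto

lemma is_mle_alt:
  "is_mle n A \<theta> \<longleftrightarrow>
     (\<forall>i\<in>{1..n}. \<forall>j\<in>{1..n}. i \<noteq> j \<longrightarrow> 0 < rate_at n \<theta> i j) \<and>
     (\<forall>i\<in>{1..n}. out_deg n A i = (\<Sum>k\<in>{1..n}-{i}. h_fun (rate_at n \<theta> i k))) \<and>
     (\<forall>j\<in>{1..n-1}. in_deg n A j = (\<Sum>k\<in>{1..n}-{j}. h_fun (rate_at n \<theta> k j)))"
  by (simp add: is_mle_def h_fun_def)

text \<open>\<open>p\<close> stands for \<open>max 1 (1 / q)\<close> and \<open>\<zeta>\<close> for
  the ratio that the rate hypothesis sends to 0. As \<open>p\<close> and \<open>exp Q\<close> are at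
  least 1, \<open>\<zeta>\<close> absorbs every monomial in them up to the degrees 15 and 9. The
  threshold for \<open>\<zeta>\<close> comes from \<open>radius_small\<close>, which needs
  \<open>34560 * \<zeta> \<le> 1\<close>.\<close>

locale geom_setting =
  fixes n :: nat and \<theta> :: "nat \<Rightarrow> real" and p Q \<zeta> :: real
  assumes n: "3 \<le> n" and p: "1 \<le> p"
    and bounds: "\<And>i j. i \<in> {1..n} \<Longrightarrow> j \<in> {1..n} \<Longrightarrow> i \<noteq> j \<Longrightarrow>
      1 / p \<le> rate_at n \<theta> i j \<and> rate_at n \<theta> i j \<le> Q"
    and \<zeta>: "p ^ 15 * exp Q ^ 9 * ln (real n) / sqrt (real n) \<le> \<zeta>" "\<zeta> \<le> 1 / 40000"
begin

definition "\<pi> = rate_at n \<theta>"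
abbreviation "L \<equiv> ln (real n)"
abbreviation "E \<equiv> exp Q"
abbreviation "\<gamma> \<equiv> 10 * p * sqrt (real n * L)"
abbreviation "\<epsilon> \<equiv> 10 * p * sqrt (8 * p ^ 4 * E\<^sup>2 * L)"
abbreviation "vr \<equiv> row_info n \<pi>"
abbreviation "vc \<equiv> col_info n \<pi>"
abbreviation "gr A \<equiv> row_dev n \<pi> (out_deg n A)"
abbreviation "gc A \<equiv> col_dev n \<pi> (in_deg n A)"
abbreviation "row_err A i \<equiv> \<Sum>k\<in>{1..n}-{i}. u_fun (\<pi> i k) * gc A k / vc k"
abbreviation "col_err A i \<equiv> \<Sum>k\<in>{1..n}-{i}. u_fun (\<pi> k i) * gr A k / vr k"
abbreviation "stat \<equiv> lin_stat (offdiag n) (case_prod \<pi>)"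
abbreviation "M \<equiv> geom_model n \<theta>"

lemma M_eq: "M = Pi_pmf (offdiag n) 0 (\<lambda>x. geometric_pmf (1 - exp (- case_prod \<pi> x)))"
  unfolding geom_model_eq \<pi>_def by (simp add: case_prod_beta)

lemma \<pi>: "1 / p \<le> \<pi> i j" "\<pi> i j \<le> Q" if "i \<in> {1..n}" "j \<in> {1..n}" "i \<noteq> j"
  using bounds[OF that] by (auto simp: \<pi>_def)

lemma offdiag_rate: "x \<in> offdiag n \<Longrightarrow> 1 / p \<le> case_prod \<pi> x"
  by (auto simp: offdiag_def intro: \<pi>)

lemma E_ge_1: "1 \<le> E"
proof -
  have "0 < 1 / p" using p by simp
  moreover have "1 / p \<le> \<pi> 1 2" "\<pi> 1 2 \<le> Q" using \<pi>[of 1 2] n by auto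
  ultimately have "0 < Q" by linarith
  thus ?thesis by simp
qed

lemma L_ge_1: "1 \<le> L"
proof -
  have "exp 1 \<le> real n" using exp_le n by linarith
  thus ?thesis using n by (subst ln_ge_iff) auto
qed

lemma \<zeta>_ge: "a \<le> 15 \<Longrightarrow> b \<le> 9 \<Longrightarrow> p ^ a * E ^ b * L / sqrt (real n) \<le> \<zeta>"
proof -
  assume ab: "a \<le> 15" "b \<le> 9"
  have "p ^ a * E ^ b * L / sqrt (real n) \<le> p ^ 15 * E ^ 9 * L / sqrt (real n)"
    using p E_ge_1 L_ge_1 ab n
    by (intro divide_right_mono mult_right_mono mult_mono power_increasing) auto
  thus ?thesis using \<zeta> by simp
qed

lemma \<zeta>_pos: "0 \<le> \<zeta>"
  using \<zeta>_ge[of 0 0] L_ge_1 n by (auto intro: order_trans[rotated])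

lemma \<zeta>_sqrt: "a \<le> 15 \<Longrightarrow> b \<le> 9 \<Longrightarrow> p ^ a * E ^ b * L \<le> \<zeta> * sqrt (real n)"
  using \<zeta>_ge[of a b] n by (simp add: pos_divide_le_eq)

lemma \<zeta>_sqrt': "a \<le> 15 \<Longrightarrow> b \<le> 9 \<Longrightarrow> p ^ a * E ^ b \<le> \<zeta> * sqrt (real n)"
proof -
  assume ab: "a \<le> 15" "b \<le> 9"
  have "p ^ a * E ^ b * 1 \<le> p ^ a * E ^ b * L"
    using p E_ge_1 L_ge_1 by (intro mult_left_mono) auto
  thus ?thesis using \<zeta>_sqrt[OF ab] by simp
qed

lemma u_bounds:
  assumes "i \<in> {1..n}" "j \<in> {1..n}" "i \<noteq> j"
  shows "1 / E \<le> u_fun (\<pi> i j)" "u_fun (\<pi> i j) \<le> 2 * p\<^sup>2" "0 < u_fun (\<pi> i j)"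
proof -
  have pos: "0 < \<pi> i j" using \<pi>[OF assms] p by (smt (verit) zero_less_divide_1_iff)
  have "1 / E = exp (- Q)" by (simp add: exp_minus field_simps)
  also have "\<dots> \<le> exp (- \<pi> i j)" using \<pi>[OF assms] by simp
  also have "\<dots> \<le> u_fun (\<pi> i j)" by (rule u_fun_lower[OF pos])
  finally show "1 / E \<le> u_fun (\<pi> i j)" .
  show "u_fun (\<pi> i j) \<le> 2 * p\<^sup>2" using \<pi>[OF assms] p by (intro u_fun_upper) auto
  show "0 < u_fun (\<pi> i j)" by (rule u_fun_pos[OF pos])
qed

lemma card_minus: "i \<in> {1..n} \<Longrightarrow> real (card ({1..n} - {i})) = real n - 1"
  using n by (simp add: card_Diff_subset of_nat_diff)

lemma info_bounds:
  assumes "i \<in> {1..n}"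
  shows "(real n - 1) / E \<le> vr i" "vr i \<le> 2 * p\<^sup>2 * real n" "0 < vr i"
    "(real n - 1) / E \<le> vc i" "vc i \<le> 2 * p\<^sup>2 * real n" "0 < vc i"
proof -
  have "(\<Sum>k\<in>{1..n}-{i}. 1 / E) \<le> vr i"
    unfolding row_info_def by (rule sum_mono) (use u_bounds assms in auto)
  moreover have "(\<Sum>k\<in>{1..n}-{i}. 1 / E) \<le> vc i"
    unfolding col_info_def by (rule sum_mono) (use u_bounds assms in auto)
  ultimately show l: "(real n - 1) / E \<le> vr i" "(real n - 1) / E \<le> vc i"
    unfolding sum_constant card_minus[OF assms] by simp_all
  have "0 < (real n - 1) / E" using n by simp
  thus "0 < vr i" "0 < vc i" using l by linarith+
  have "vr i \<le> (\<Sum>k\<in>{1..n}-{i}. 2 * p\<^sup>2)"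
    unfolding row_info_def by (rule sum_mono) (use u_bounds assms in auto)
  moreover have "vc i \<le> (\<Sum>k\<in>{1..n}-{i}. 2 * p\<^sup>2)"
    unfolding col_info_def by (rule sum_mono) (use u_bounds assms in auto)
  ultimately have "vr i \<le> (real n - 1) * (2 * p\<^sup>2)" "vc i \<le> (real n - 1) * (2 * p\<^sup>2)"
    unfolding sum_constant card_minus[OF assms] by simp_all
  moreover have "(real n - 1) * (2 * p\<^sup>2) \<le> 2 * p\<^sup>2 * real n" using p by (simp add: algebra_simps)
  ultimately show "vr i \<le> 2 * p\<^sup>2 * real n" "vc i \<le> 2 * p\<^sup>2 * real n" by linarith+
qed

section \<open>Concentration of the degree deviations and of the averaged error sums\<close>

lemma gr_sum: "gr A i = (\<Sum>k\<in>{1..n}-{i}. geom_eps (\<pi> i k) (A (i, k)))"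
  by (simp add: row_dev_def out_deg_def geom_eps_def sum_subtractf)

lemma gc_sum: "gc A j = (\<Sum>k\<in>{1..n}-{j}. geom_eps (\<pi> k j) (A (k, j)))"
  by (simp add: col_dev_def in_deg_def geom_eps_def sum_subtractf)

lemma stat_rows: "stat c A = (\<Sum>i\<in>{1..n}. \<Sum>j\<in>{1..n}-{i}. c (i, j) * geom_eps (\<pi> i j) (A (i, j)))"
  by (simp add: lin_stat_def sum_offdiag)

lemma stat_cols: "stat c A = (\<Sum>j\<in>{1..n}. \<Sum>i\<in>{1..n}-{j}. c (i, j) * geom_eps (\<pi> i j) (A (i, j)))"
  unfolding stat_rows by (rule sum_offdiag_swap)

lemma stat_row_weights: "stat (\<lambda>(i, j). w i) A = (\<Sum>i\<in>{1..n}. w i * gr A i)"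
  unfolding stat_rows gr_sum by (simp add: sum_distrib_left)

lemma stat_col_weights: "stat (\<lambda>(i, j). w j) A = (\<Sum>j\<in>{1..n}. w j * gc A j)"
  unfolding stat_cols gc_sum by (simp add: sum_distrib_left)

lemma sum_indicator: "i \<in> {1..n} \<Longrightarrow> (\<Sum>l\<in>{1..n}. (if l = i then c else 0) * f l) = c * (f i :: real)"
  by (simp add: if_distrib[of "\<lambda>x. x * _"] cong: if_cong)

lemma sum_minus: "(\<Sum>k\<in>{1..n}-{i}. f k) = (\<Sum>k\<in>{1..n}. if k = i then 0 else (f k :: real))"
  by (rule sum.mono_neutral_cong_left) auto

lemma L_small: "sqrt (L / real n) \<le> 1 / 2" "sqrt L / (real n - 1) \<le> 1 / 2"
proof -
  have "L \<le> \<zeta> * sqrt (real n)" using \<zeta>_sqrt[of 0 0] by simp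
  also have "\<dots> \<le> (1 / 4) * sqrt (real n)" using \<zeta> by (intro mult_right_mono) auto
  also have "\<dots> \<le> (1 / 4) * real n"   proof -
    have "sqrt (real n) \<le> real n" using n by (intro real_le_lsqrt) (auto simp: self_le_power)
    thus ?thesis by simp
  qed
  finally have *: "L \<le> real n / 4" by simp
  hence "L / real n \<le> (1 / 2)\<^sup>2" using n by (simp add: field_simps power2_eq_square)
  thus "sqrt (L / real n) \<le> 1 / 2" by (intro real_le_lsqrt) auto
  have "L \<le> ((real n - 1) / 2)\<^sup>2"
  proof -
    have "L \<le> (real n - 1) / 2" using * n by simp
    also have "\<dots> \<le> ((real n - 1) / 2)\<^sup>2" using n by (intro self_le_power) auto
    finally show ?thesis .
  qed
  hence "sqrt L \<le> (real n - 1) / 2" using n by (intro real_le_lsqrt) auto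
  thus "sqrt L / (real n - 1) \<le> 1 / 2" using n by (simp add: field_simps)
qed

lemma exp_L: "exp (- 2 * L) = 1 / (real n)\<^sup>2"
proof -
  have "exp (- 2 * L) = inverse (exp (2 * L))" by (simp flip: exp_minus)
  also have "exp (2 * L) = (real n)\<^sup>2" using n by (simp add: exp_double)
  finally show ?thesis by (simp add: inverse_eq_divide)
qed

text \<open>With \<open>L = ln n\<close> the failure probability is of order \<open>1 / n^2\<close>,
  small enough for the union bound over the \<open>4 * n\<close> events in
  \<open>good\<close>.\<close>

lemma stat_tail:
  assumes "0 < V" "(\<Sum>x\<in>offdiag n. (c x)\<^sup>2) \<le> V" "\<And>x. x \<in> offdiag n \<Longrightarrow> \<bar>c x\<bar> * sqrt (L / V) \<le> 1 / 2"
  shows "measure M {A. \<bar>stat c A\<bar> \<ge> 10 * p * sqrt (V * L)} \<le> 2 / (real n)\<^sup>2"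
  using lin_stat_tail[OF finite_offdiag p offdiag_rate assms(1,2) _ assms(3)] L_ge_1
  unfolding M_eq exp_L by simp

lemma degree_tail:
  assumes i: "i \<in> {1..n}"
  shows "measure M {A. \<bar>gr A i\<bar> \<ge> \<gamma>} \<le> 2 / (real n)\<^sup>2" "measure M {A. \<bar>gc A i\<bar> \<ge> \<gamma>} \<le> 2 / (real n)\<^sup>2"
proof -
  have one: "(\<Sum>l\<in>{1..n}. \<Sum>j\<in>{1..n}-{l}. if l = i then 1 else 0 :: real) = real n - 1"
  proof -
    have "(\<Sum>l\<in>{1..n}. \<Sum>j\<in>{1..n}-{l}. if l = i then 1 else 0 :: real) =
        (\<Sum>l\<in>{1..n}. (if l = i then 1 else 0) * real (card ({1..n}-{l})))"
      by (intro sum.cong refl) simp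
    also have "\<dots> = real n - 1" using card_minus[OF i] by (subst sum_indicator[OF i]) simp
    finally show ?thesis .
  qed
  have sq: "(\<Sum>x\<in>offdiag n. (case x of (l, j) \<Rightarrow> if l = i then 1 else 0)\<^sup>2) \<le> real n"
    "(\<Sum>x\<in>offdiag n. (case x of (l, j) \<Rightarrow> if j = i then 1 else 0)\<^sup>2) \<le> real n"
  proof -
    have "(\<Sum>x\<in>offdiag n. (case x of (l, j) \<Rightarrow> if l = i then 1 else 0)\<^sup>2) =
        (\<Sum>l\<in>{1..n}. \<Sum>j\<in>{1..n}-{l}. if l = i then 1 else 0 :: real)"
      by (subst sum_offdiag, intro sum.cong refl) auto
    thus "(\<Sum>x\<in>offdiag n. (case x of (l, j) \<Rightarrow> if l = i then 1 else 0)\<^sup>2) \<le> real n" unfolding one by simp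
    have "(\<Sum>x\<in>offdiag n. (case x of (l, j) \<Rightarrow> if j = i then 1 else 0)\<^sup>2) =
        (\<Sum>j\<in>{1..n}. \<Sum>l\<in>{1..n}-{j}. if j = i then 1 else 0 :: real)"
      by (subst sum_offdiag, subst sum_offdiag_swap, intro sum.cong refl) auto
    thus "(\<Sum>x\<in>offdiag n. (case x of (l, j) \<Rightarrow> if j = i then 1 else 0)\<^sup>2) \<le> real n" unfolding one by simp
  qed
  have "stat (\<lambda>(l, j). if l = i then 1 else 0) A = gr A i" for A
    unfolding stat_row_weights[of "\<lambda>l. if l = i then 1 else 0"] using sum_indicator[OF i, of 1] by simp
  thus "measure M {A. \<bar>gr A i\<bar> \<ge> \<gamma>} \<le> 2 / (real n)\<^sup>2"
    using stat_tail[of "real n" "\<lambda>(l, j). if l = i then 1 else 0"] sq(1) L_small(1) n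
    by (auto split: if_splits)
  have "stat (\<lambda>(l, j). if j = i then 1 else 0) A = gc A i" for A
    unfolding stat_col_weights[of "\<lambda>l. if l = i then 1 else 0"] using sum_indicator[OF i, of 1] by simp
  thus "measure M {A. \<bar>gc A i\<bar> \<ge> \<gamma>} \<le> 2 / (real n)\<^sup>2"
    using stat_tail[of "real n" "\<lambda>(l, j). if j = i then 1 else 0"] sq(2) L_small(1) n
    by (auto split: if_splits)
qed

text \<open>Here lies the gain from averaging: about \<open>n^2\<close> weights of order
  \<open>1 / n\<close> have a bounded sum of squares, so for fixed \<open>p\<close> and
  \<open>Q\<close> the deviation is of order \<open>sqrt (ln n)\<close>, whereas a degree deviates
  by order \<open>sqrt (n * ln n)\<close>.\<close>

lemma weights_tail:
  assumes "\<And>x. x \<in> offdiag n \<Longrightarrow> \<bar>c x\<bar> \<le> 2 * p\<^sup>2 * E / (real n - 1)"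
  shows "measure M {A. \<bar>stat c A\<bar> \<ge> \<epsilon>} \<le> 2 / (real n)\<^sup>2"
proof -
  have p0: "0 < p" "0 < p\<^sup>2" using p by auto
  have "(\<Sum>x\<in>offdiag n. (c x)\<^sup>2) \<le> (\<Sum>x\<in>offdiag n. (2 * p\<^sup>2 * E / (real n - 1))\<^sup>2)"
    using assms by (intro sum_mono) (metis abs_ge_zero power2_abs power_mono)
  also have "\<dots> = (\<Sum>i\<in>{1..n}. real (card ({1..n}-{i})) * (2 * p\<^sup>2 * E / (real n - 1))\<^sup>2)"
    by (subst sum_offdiag) (simp only: sum_constant)
  also have "\<dots> = (\<Sum>i\<in>{1..n}. (real n - 1) * (2 * p\<^sup>2 * E / (real n - 1))\<^sup>2)"
    by (intro sum.cong refl) (simp add: card_minus[unfolded One_nat_def])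
  also have "\<dots> = real n * ((real n - 1) * (2 * p\<^sup>2 * E / (real n - 1))\<^sup>2)" by simp
  also have "\<dots> = (4 * p ^ 4 * E\<^sup>2) * (real n / (real n - 1))"
  proof -
    have "real n - 1 \<noteq> 0" using n by simp
    hence "(real n - 1) * (x / (real n - 1))\<^sup>2 = x\<^sup>2 / (real n - 1)" for x
      by (simp add: power_divide power2_eq_square)
    moreover have "(2 * p\<^sup>2 * E)\<^sup>2 = 4 * p ^ 4 * E\<^sup>2"
      by (simp add: power2_eq_square power4_eq_xxxx)
    ultimately show ?thesis by simp
  qed
  also have "\<dots> \<le> (4 * p ^ 4 * E\<^sup>2) * 2"
    using n by (intro mult_left_mono) (auto simp: field_simps)
  finally have V: "(\<Sum>x\<in>offdiag n. (c x)\<^sup>2) \<le> 8 * p ^ 4 * E\<^sup>2" by simp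
  have "\<bar>c x\<bar> * sqrt (L / (8 * p ^ 4 * E\<^sup>2)) \<le> 1 / 2" if "x \<in> offdiag n" for x
  proof -
    \<comment> \<open>Lowering 8 to 4 makes the denominator the square of
      \<open>2 * p^2 * E\<close>, which then cancels against the bound on
      \<open>c x\<close>.\<close>
    have "sqrt (L / (8 * p ^ 4 * E\<^sup>2)) \<le> sqrt (L / (2 * p\<^sup>2 * E)\<^sup>2)"
      using p0 L_ge_1 by (intro real_sqrt_le_mono divide_left_mono) (auto simp: power2_eq_square power4_eq_xxxx)
    also have "\<dots> = sqrt L / (2 * p\<^sup>2 * E)" using p0 by (simp add: real_sqrt_divide)
    finally have "\<bar>c x\<bar> * sqrt (L / (8 * p ^ 4 * E\<^sup>2)) \<le>
        (2 * p\<^sup>2 * E / (real n - 1)) * (sqrt L / (2 * p\<^sup>2 * E))"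
      using assms[OF that] n L_ge_1 p0 by (intro mult_mono) auto
    also have "\<dots> = sqrt L / (real n - 1)" using p0 by simp
    finally show ?thesis using L_small(2) by linarith
  qed
  thus ?thesis using V p0 by (intro stat_tail) auto
qed

text \<open>Expanding \<open>gc A k\<close> into the entries of column \<open>k\<close> exhibits the
  error sum as a statistic of the whole matrix, with weights that depend on the column only.\<close>

lemma row_error_stat:
  "row_err A i = stat (\<lambda>(l, k). if k = i then 0 else u_fun (\<pi> i k) / vc k) A"
  unfolding stat_col_weights[of "\<lambda>k. if k = i then 0 else u_fun (\<pi> i k) / vc k"] sum_minus
  by (intro sum.cong refl) simp

lemma col_error_stat:
  "col_err A j = stat (\<lambda>(k, l). if k = j then 0 else u_fun (\<pi> k j) / vr k) A"
  unfolding stat_row_weights[of "\<lambda>k. if k = j then 0 else u_fun (\<pi> k j) / vr k"] sum_minus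
  by (intro sum.cong refl) simp

lemma weight_bound:
  assumes "u \<le> 2 * p\<^sup>2" "0 < u" "(real n - 1) / E \<le> v" "0 < v"
  shows "\<bar>u / v\<bar> \<le> 2 * p\<^sup>2 * E / (real n - 1)"
proof -
  have "0 < (real n - 1) / E" using n by simp
  hence "u / v \<le> (2 * p\<^sup>2) / ((real n - 1) / E)" using assms by (intro frac_le) auto
  thus ?thesis using assms by simp
qed

definition good :: "(nat \<times> nat \<Rightarrow> nat) set" where
  "good = {A. \<forall>i\<in>{1..n}. \<bar>gr A i\<bar> < \<gamma> \<and> \<bar>gc A i\<bar> < \<gamma> \<and>
     \<bar>row_err A i\<bar> < \<epsilon> \<and>
     \<bar>col_err A i\<bar> < \<epsilon>}"

lemma good_prob: "measure M (- good) \<le> 8 / real n"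
proof -
  define B1 where "B1 i = {A. \<bar>gr A i\<bar> \<ge> \<gamma>}" for i
  define B2 where "B2 i = {A. \<bar>gc A i\<bar> \<ge> \<gamma>}" for i
  define B3 where "B3 i = {A. \<bar>row_err A i\<bar> \<ge> \<epsilon>}" for i
  define B4 where "B4 i = {A. \<bar>col_err A i\<bar> \<ge> \<epsilon>}" for i
  have B: "measure M (B1 i) \<le> 2 / (real n)\<^sup>2" "measure M (B2 i) \<le> 2 / (real n)\<^sup>2"
    "measure M (B3 i) \<le> 2 / (real n)\<^sup>2" "measure M (B4 i) \<le> 2 / (real n)\<^sup>2" if i: "i \<in> {1..n}" for i
  proof -
    show "measure M (B1 i) \<le> 2 / (real n)\<^sup>2" "measure M (B2 i) \<le> 2 / (real n)\<^sup>2"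
      unfolding B1_def B2_def using degree_tail[OF i] by auto
    have pos: "0 \<le> 2 * p\<^sup>2 * E / (real n - 1)" using n by simp
    show "measure M (B3 i) \<le> 2 / (real n)\<^sup>2" unfolding B3_def row_error_stat
    proof (rule weights_tail)
      fix x assume "x \<in> offdiag n"
      thus "\<bar>case x of (l, k) \<Rightarrow> if k = i then 0 else u_fun (\<pi> i k) / vc k\<bar> \<le> 2 * p\<^sup>2 * E / (real n - 1)"
        using pos i by (cases x) (auto simp: offdiag_def simp del: abs_divide intro!: weight_bound u_bounds info_bounds)
    qed
    show "measure M (B4 i) \<le> 2 / (real n)\<^sup>2" unfolding B4_def col_error_stat
    proof (rule weights_tail)
      fix x assume "x \<in> offdiag n"
      thus "\<bar>case x of (k, l) \<Rightarrow> if k = i then 0 else u_fun (\<pi> k i) / vr k\<bar> \<le> 2 * p\<^sup>2 * E / (real n - 1)"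
        using pos i by (cases x) (auto simp: offdiag_def simp del: abs_divide intro!: weight_bound u_bounds info_bounds)
    qed
  qed
  have "- good = (\<Union>i\<in>{1..n}. B1 i \<union> B2 i \<union> B3 i \<union> B4 i)"
    by (auto simp: good_def B1_def B2_def B3_def B4_def not_less)
  hence "measure M (- good) \<le> (\<Sum>i\<in>{1..n}. measure M (B1 i \<union> B2 i \<union> B3 i \<union> B4 i))"
    by (simp only:) (rule measure_pmf.finite_measure_subadditive_finite, auto)
  also have "\<dots> \<le> (\<Sum>i\<in>{1..n}. 8 / (real n)\<^sup>2)"
  proof (rule sum_mono)
    fix i assume i: "i \<in> {1..n}"
    have "measure M (B1 i \<union> B2 i \<union> B3 i \<union> B4 i) \<le> measure M (B1 i) + measure M (B2 i) + measure M (B3 i) + measure M (B4 i)"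
      by (intro order.trans[OF measure_Un_le] add_mono) auto
    also have "\<dots> \<le> 8 / (real n)\<^sup>2" using B[OF i] by linarith
    finally show "measure M (B1 i \<union> B2 i \<union> B3 i \<union> B4 i) \<le> 8 / (real n)\<^sup>2" .
  qed
  also have "\<dots> = 8 / real n" using n by (simp add: power2_eq_square)
  finally show ?thesis .
qed

end

lemma iexp_lipschitz: "cmod (iexp a - iexp b) \<le> \<bar>a - b\<bar>"
proof -
  have "iexp a - iexp b = iexp b * (iexp (a - b) - 1)"
    by (simp add: right_diff_distrib exp_add[symmetric] algebra_simps)
  hence "cmod (iexp a - iexp b) = cmod (iexp (a - b) - 1)" by (simp add: norm_mult)
  also have "\<dots> \<le> \<bar>a - b\<bar>" using iexp_approx1[of "a - b" 0] by simp
  finally show ?thesis .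
qed

lemma exp_minus_lipschitz:
  fixes a b :: real assumes "0 \<le> a" "0 \<le> b"
  shows "\<bar>exp (- a) - exp (- b)\<bar> \<le> \<bar>a - b\<bar>"
proof -
  have "norm (exp (- a) - exp (- b)) \<le> 1 * norm (a - b)"
    by (rule field_differentiable_bound[of "{0..}" "\<lambda>x. exp (- x)" "\<lambda>x. - exp (- x)"])
      (use assms in \<open>auto intro!: derivative_eq_intros\<close>)
  thus ?thesis by simp
qed

section \<open>Expansion of the estimator on the good event\<close>

context geom_setting
begin

definition "rad = 48 * p\<^sup>2 * exp (2 * (Q + 1)) * \<gamma> / (real n - 1)"

text \<open>The bound of \<open>solution_expansion\<close> with \<open>r = rad\<close>;
  \<open>rad\<close> repeats \<open>radius\<close> for the fixed noise level
  \<open>\<gamma>\<close>, so that it can be estimated before a sample is chosen.\<close>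

definition "\<eta> = 12 * p\<^sup>2 * exp (2 * Q) * (48 * p ^ 3 * rad\<^sup>2 * real n + \<epsilon>) / (real n - 1)"

lemma half_n: "real n / 2 \<le> real n - 1" "0 < real n - 1"
  using n by auto

lemma radius_bound: "rad * sqrt (real n) \<le> 8640 * p ^ 3 * E\<^sup>2 * sqrt L" "0 \<le> rad"
proof -
  have p0: "0 < p" and L0: "0 \<le> L" using p L_ge_1 by auto
  have e: "exp (2 * (Q + 1)) = exp 2 * E\<^sup>2"
  proof -
    have "2 * (Q + 1) = 2 + 2 * Q" by simp
    thus ?thesis by (simp only: exp_add exp_double)
  qed
  show "0 \<le> rad" unfolding rad_def using p0 L0 half_n by simp
  \<comment> \<open>\<open>480 = 48 * 10\<close>; then \<open>exp 2 \<le> 9\<close> and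
    \<open>n / (n - 1) \<le> 2\<close> give \<open>480 * 18 = 8640\<close>.\<close>
  have "rad * sqrt (real n) = 480 * p ^ 3 * E\<^sup>2 * sqrt L * exp 2 * (real n / (real n - 1))"
    unfolding rad_def e real_sqrt_mult by (simp add: power2_eq_square power3_eq_cube)
  also have "\<dots> \<le> 480 * p ^ 3 * E\<^sup>2 * sqrt L * 9 * 2"
    using exp_2_le p0 L0 half_n by (intro mult_mono) (auto simp: pos_divide_le_eq)
  finally show "rad * sqrt (real n) \<le> 8640 * p ^ 3 * E\<^sup>2 * sqrt L" by simp
qed

lemma sqrt_L_le: "sqrt L \<le> L"
  using L_ge_1 by (intro real_le_lsqrt) (auto simp: self_le_power)

lemma radius_small: "rad \<le> 1 / (4 * p)"
proof -
  have p0: "0 < p" using p by simp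
  have "(4 * p * rad) * sqrt (real n) = 4 * p * (rad * sqrt (real n))" by simp
  also have "\<dots> \<le> 4 * p * (8640 * p ^ 3 * E\<^sup>2 * sqrt L)"
    using radius_bound p0 by (intro mult_left_mono) auto
  also have "\<dots> = 34560 * (p ^ 4 * E\<^sup>2 * sqrt L)" by (simp add: power3_eq_cube power4_eq_xxxx)
  also have "\<dots> \<le> 34560 * (p ^ 4 * E\<^sup>2 * L)"
    using p0 sqrt_L_le by (intro mult_left_mono) auto
  also have "\<dots> \<le> 34560 * (\<zeta> * sqrt (real n))"
    using \<zeta>_sqrt[of 4 2] by simp
  also have "\<dots> = (34560 * \<zeta>) * sqrt (real n)" by simp
  also have "\<dots> \<le> 1 * sqrt (real n)" using \<zeta>(2) by (intro mult_right_mono) auto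
  finally have "4 * p * rad \<le> 1" using n by (simp add: mult_le_cancel_right)
  thus ?thesis using p0 by (simp add: field_simps)
qed

lemma size_large: "16 * p\<^sup>2 * exp (Q + 1) \<le> real n - 1" "4 * p\<^sup>2 * E \<le> real n - 1"
proof -
  have "p\<^sup>2 * E \<le> \<zeta> * sqrt (real n)" using \<zeta>_sqrt'[of 2 1] by simp
  also have "\<dots> \<le> (1 / 100) * sqrt (real n)" using \<zeta>(2) by (intro mult_right_mono) auto
  also have "sqrt (real n) \<le> real n" using n by (intro real_le_lsqrt) (auto simp: self_le_power)
  finally have *: "100 * (p\<^sup>2 * E) \<le> real n" by simp
  have "16 * p\<^sup>2 * exp (Q + 1) = 16 * (p\<^sup>2 * E) * exp 1" by (simp add: exp_add)
  also have "\<dots> \<le> 16 * (p\<^sup>2 * E) * 3" using exp_le by (intro mult_left_mono) auto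
  also have "\<dots> \<le> real n - 1" using * half_n by simp
  finally show "16 * p\<^sup>2 * exp (Q + 1) \<le> real n - 1" .
  show "4 * p\<^sup>2 * E \<le> real n - 1" using * half_n by simp
qed

text \<open>The square root bounds the coefficients of the projection up to \<open>norm t\<close>
  (\<open>abs_y_bound\<close>), so the expansion error is negligible after normalisation. As to the
  exponents, \<open>rad^2\<close> brings \<open>p^6 * E^4\<close>, the Taylor constant
  \<open>p^3\<close>, the maximum principle \<open>p^2 * E^2\<close> and the normalisation
  \<open>p\<close>; the total \<open>p^12 * E^6\<close> is within the degrees that
  \<open>\<zeta>\<close> absorbs.\<close>

lemma eta_bound: "sqrt (2 * p\<^sup>2 * real n) * \<eta> \<le> 10 ^ 12 * \<zeta>"
proof -
  have p0: "0 < p" and L0: "0 \<le> L" using p L_ge_1 by auto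
  have r2: "rad\<^sup>2 * real n \<le> 74649600 * (p ^ 6 * E ^ 4 * L)"
  proof -
    have "(rad * sqrt (real n))\<^sup>2 \<le> (8640 * p ^ 3 * E\<^sup>2 * sqrt L)\<^sup>2"
      using radius_bound by (intro power_mono) auto
    thus ?thesis using L0 by (simp add: power_mult_distrib flip: power_mult)
  qed
  have eps: "\<epsilon> \<le> 30 * (p ^ 9 * E ^ 4 * L)"
  proof -
    have "sqrt (8 * p ^ 4 * E\<^sup>2 * L) \<le> sqrt ((3 * p\<^sup>2 * E)\<^sup>2 * L)"
      using L0 p0 by (intro real_sqrt_le_mono mult_right_mono) (auto simp: power2_eq_square power4_eq_xxxx)
    also have "\<dots> = 3 * p\<^sup>2 * E * sqrt L" using p0 by (simp add: real_sqrt_mult)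
    also have "\<dots> \<le> 3 * p\<^sup>2 * E * L" using sqrt_L_le by (intro mult_left_mono) auto
    finally have "\<epsilon> \<le> 10 * p * (3 * p\<^sup>2 * E * L)" using p0 by (intro mult_left_mono) auto
    also have "\<dots> = 30 * (p ^ 3 * E ^ 1 * L)" by (simp add: power2_eq_square power3_eq_cube)
    also have "\<dots> \<le> 30 * (p ^ 9 * E ^ 4 * L)"
      using p E_ge_1 L0 by (intro mult_left_mono mult_right_mono mult_mono power_increasing) auto
    finally show ?thesis .
  qed
  have "48 * p ^ 3 * rad\<^sup>2 * real n = 48 * p ^ 3 * (rad\<^sup>2 * real n)" by simp
  also have "\<dots> \<le> 48 * p ^ 3 * (74649600 * (p ^ 6 * E ^ 4 * L))"
    using r2 p0 by (intro mult_left_mono) auto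
  also have "\<dots> = 3583180800 * (p ^ 9 * E ^ 4 * L)"
    by (simp add: power_add[of p 3 6, simplified])
  finally have G: "48 * p ^ 3 * rad\<^sup>2 * real n + \<epsilon> \<le> 3583180830 * (p ^ 9 * E ^ 4 * L)"
    using eps by linarith
  have e2: "exp (2 * Q) = E\<^sup>2" by (simp add: exp_double)
  have "\<eta> = 12 * p\<^sup>2 * E\<^sup>2 * (48 * p ^ 3 * rad\<^sup>2 * real n + \<epsilon>) / (real n - 1)"
    unfolding \<eta>_def e2 ..
  also have "\<dots> \<le> 12 * p\<^sup>2 * E\<^sup>2 * (3583180830 * (p ^ 9 * E ^ 4 * L)) / (real n / 2)"
    using G half_n p0 L0 n by (intro frac_le mult_left_mono) auto
  also have "\<dots> = 85996339920 * (p ^ 11 * E ^ 6 * L) / real n"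
  proof -
    have *: "p ^ 11 = p\<^sup>2 * p ^ 9" "E ^ 6 = E\<^sup>2 * E ^ 4" by (simp_all flip: power_add)
    have "12 * a * b * (3583180830 * (c * d * L)) / (real n / 2) = 85996339920 * ((a * c) * (b * d) * L) / real n"
      for a b c d :: real by simp
    thus ?thesis unfolding * .
  qed
  finally have \<eta>: "\<eta> \<le> 85996339920 * (p ^ 11 * E ^ 6 * L) / real n" .
  have \<eta>0: "0 \<le> \<eta>"
    unfolding \<eta>_def using p0 L0 half_n
    by (intro divide_nonneg_pos mult_nonneg_nonneg add_nonneg_nonneg) auto
  have "sqrt (2 * p\<^sup>2 * real n) \<le> 2 * p * sqrt (real n)"
    using p0 by (intro real_le_lsqrt) (auto simp: power_mult_distrib)
  hence "sqrt (2 * p\<^sup>2 * real n) * \<eta> \<le> (2 * p * sqrt (real n)) * (85996339920 * (p ^ 11 * E ^ 6 * L) / real n)"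
    using \<eta> p0 \<eta>0 by (intro mult_mono) auto
  also have "\<dots> = 171992679840 * (p ^ 12 * E ^ 6 * L / sqrt (real n)) * (sqrt (real n) * sqrt (real n) / real n)"
  proof -
    have *: "p ^ 12 = p * p ^ 11" by (simp flip: power_Suc)
    have g: "(2 * p * r) * (85996339920 * (a * b * L) / real n) =
        171992679840 * ((p * a) * b * L / r) * (r * r / real n)" if "r \<noteq> 0" for a b r :: real
      using that by simp
    have "sqrt (real n) \<noteq> 0" using n by simp
    thus ?thesis unfolding * by (rule g)
  qed
  also have "\<dots> = 171992679840 * (p ^ 12 * E ^ 6 * L / sqrt (real n))"
    using n by simp
  also have "\<dots> \<le> 171992679840 * \<zeta>" using \<zeta>_ge[of 12 6] by simp
  also have "\<dots> \<le> 10 ^ 12 * \<zeta>" using \<zeta>_pos by (intro mult_right_mono) auto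
  finally show ?thesis .
qed

text \<open>The solution near the truth is itself an MLE, so one exists and the assumption on
  \<open>e\<close> applies; uniqueness then identifies the first \<open>n\<close> coordinates of
  \<open>e\<close> with it.\<close>

lemma mle_expansion:
  assumes A: "A \<in> good" and est: "(\<exists>\<theta>'. is_mle n A \<theta>') \<longrightarrow> is_mle n A e" and i: "i \<in> {1..n}"
  shows "\<bar>e i - \<theta> i + gr A i / vr i + gc A n / vc n\<bar> \<le> \<eta>"
proof -
  have p0: "0 < 1 / p" using p by simp
  interpret D: degree_data n \<pi> p Q "out_deg n A" "in_deg n A" \<gamma>
  proof
    show "(\<Sum>i\<in>{1..n}. out_deg n A i) = (\<Sum>j\<in>{1..n}. in_deg n A j)"
      unfolding out_deg_def in_deg_def of_nat_sum by (rule sum_offdiag_swap)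
    show "\<bar>gr A i\<bar> \<le> \<gamma>" "\<bar>gc A i\<bar> \<le> \<gamma>" if "i \<in> {1..n}" for i
      using A that unfolding good_def by (auto intro: less_imp_le)
    show "0 < \<gamma>" using p n L_ge_1 by simp
  qed (use n p \<pi> in auto)
  have rad: "D.radius = rad" unfolding rad_def D.radius_def ..
  obtain x y where y: "y n = 0"
    and close': "\<forall>i\<in>{1..n}. \<forall>j\<in>{1..n}. i \<noteq> j \<longrightarrow> \<bar>x i - y j\<bar> \<le> rad"
    and row': "\<forall>i\<in>{1..n}. out_deg n A i = (\<Sum>k\<in>{1..n}-{i}. h_fun (\<pi> i k + x i - y k))"
    and col': "\<forall>j\<in>{1..n}. in_deg n A j = (\<Sum>k\<in>{1..n}-{j}. h_fun (\<pi> k j + x k - y j))"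
    using D.likelihood_solution_exists[unfolded rad, OF radius_small size_large(1)] by (elim exE conjE)
  note close = close'[rule_format] and row = row'[rule_format] and col = col'[rule_format]
  \<comment> \<open>Coordinates beyond \<open>n\<close> are the \<open>\<beta>\<close> part,
    perturbed by \<open>- y\<close>; since \<open>y n = 0\<close>, this is consistent with the
    convention that \<open>beta\<close> vanishes at \<open>n\<close>.\<close>
  define \<theta>' where "\<theta>' i = (if i \<le> n then \<theta> i + x i else \<theta> i - y (i - n))" for i
  have rate: "rate_at n \<theta>' i j = \<pi> i j + x i - y j" if "i \<in> {1..n}" "j \<in> {1..n}" for i j
    using that y by (auto simp: alpha_def beta_def \<theta>'_def \<pi>_def)
  have r: "rad \<le> 1 / (2 * p)" "rad < 1 / p"
  proof -
    have "1 / (4 * p) = (1 / p) / 4" "1 / (2 * p) = (1 / p) / 2" by auto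
    thus "rad \<le> 1 / (2 * p)" "rad < 1 / p" using radius_small p0 by linarith+
  qed
  have pos: "0 < rate_at n \<theta>' i j" if "i \<in> {1..n}" "j \<in> {1..n}" "i \<noteq> j" for i j
    unfolding rate[OF that(1,2)] using close[OF that] \<pi>[OF that] r by (simp add: abs_le_iff)
  have row': "out_deg n A i = (\<Sum>k\<in>{1..n}-{i}. h_fun (rate_at n \<theta>' i k))" if "i \<in> {1..n}" for i
    unfolding row[OF that] by (intro sum.cong refl) (use rate that in auto)
  have col': "in_deg n A j = (\<Sum>k\<in>{1..n}-{j}. h_fun (rate_at n \<theta>' k j))" if "j \<in> {1..n}" for j
    unfolding col[OF that] by (intro sum.cong refl) (use rate that in auto)
  have mle': "is_mle n A \<theta>'"
    unfolding is_mle_alt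
  proof (intro conjI ballI impI)
    fix j assume "j \<in> {1..n-1}"
    hence "j \<in> {1..n}" by auto
    thus "in_deg n A j = (\<Sum>k\<in>{1..n}-{j}. h_fun (rate_at n \<theta>' k j))" by (rule col')
  qed (fact pos row')+
  hence mle: "is_mle n A e" using est by blast
  have "alpha e i = alpha \<theta>' i"
  proof (rule likelihood_solution_unique[of n "beta n e" "beta n \<theta>'"])
    have m: "\<forall>i\<in>{1..n}. \<forall>j\<in>{1..n}. i \<noteq> j \<longrightarrow> 0 < rate_at n e i j"
      "\<forall>i\<in>{1..n}. out_deg n A i = (\<Sum>k\<in>{1..n}-{i}. h_fun (rate_at n e i k))"
      "\<forall>j\<in>{1..n-1}. in_deg n A j = (\<Sum>k\<in>{1..n}-{j}. h_fun (rate_at n e k j))"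
      using mle[unfolded is_mle_alt] by (blast dest: conjunct1 conjunct2)+
    show "(\<Sum>k\<in>{1..n} - {i}. h_fun (rate_at n e i k)) = (\<Sum>k\<in>{1..n} - {i}. h_fun (rate_at n \<theta>' i k))"
      if "i \<in> {1..n}" for i
      using m(2)[rule_format, OF that] row'[OF that] by (rule trans[OF sym])
    show "(\<Sum>k\<in>{1..n} - {j}. h_fun (rate_at n e k j)) = (\<Sum>k\<in>{1..n} - {j}. h_fun (rate_at n \<theta>' k j))"
      if "j \<in> {1..n-1}" for j
    proof -
      have "j \<in> {1..n}" using that by auto
      from m(3)[rule_format, OF that] col'[OF this] show ?thesis by (rule trans[OF sym])
    qed
    show "0 < rate_at n e i j \<and> 0 < rate_at n \<theta>' i j" if "i \<in> {1..n}" "j \<in> {1..n}" "i \<noteq> j" for i j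
      using m(1)[rule_format, OF that] pos[OF that] by (rule conjI)
  qed (use n i in \<open>auto simp: beta_def\<close>)
  hence "e i - \<theta> i = x i" using i by (simp add: alpha_def \<theta>'_def)
  moreover have "\<bar>x i + gr A i / vr i + gc A n / vc n\<bar> \<le> \<eta>"
    unfolding \<eta>_def
  proof (rule D.solution_expansion[OF y r(1) close row col _ _ size_large(2) i])
    show "\<bar>row_err A i\<bar> \<le> \<epsilon>"
      "\<bar>col_err A i\<bar> \<le> \<epsilon>" if "i \<in> {1..n}" for i
      using A that unfolding good_def by (auto intro: less_imp_le)
  qed
  ultimately show ?thesis by simp
qed

end

section \<open>Asymptotic normality\<close>

text \<open>A fixed argument \<open>t\<close> of the characteristic function. By symmetry of the
  inverse root, \<open>t\<close> paired with the normalised error is \<open>y\<close> paired with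
  the raw one. The in-degree of \<open>n\<close> enters every coordinate of the raw error, so its
  coefficient involves the sum \<open>s\<close> of all entries of \<open>y\<close>.\<close>

locale projection_setting = geom_setting n \<theta> p Q \<zeta>
  for n :: nat and \<theta> :: "nat \<Rightarrow> real" and p Q \<zeta> :: real +
  fixes idx :: "'k::finite \<Rightarrow> nat" and t :: "real^'k"
  assumes idx: "bij_betw idx UNIV {1..CARD('k)}" and card: "CARD('k) \<le> n"
begin

definition "S = (\<chi> a b. Smat n \<theta> (idx a) (idx b) :: real^'k^'k)"
definition "y = inv_sqrt_mat S *v t"
definition "s = (\<Sum>a\<in>UNIV. y $ a)"
definition "cf i = (\<Sum>a\<in>UNIV. if idx a = i then y $ a else 0)"
text \<open>The coefficient of the centred entry \<open>(i, j)\<close> in the main term: it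
  contributes to out-degree \<open>i\<close> and, if \<open>j = n\<close>, to in-degree
  \<open>n\<close>.\<close>

definition "weight x = - (case x of (i, j) \<Rightarrow> cf i / vr i + (if j = n then s / vc n else 0))"
text \<open>Square root of the upper bound on \<open>1 / vr i\<close> and \<open>1 / vc i\<close>
  from \<open>info_bounds\<close>; it makes all weights of order \<open>1 / sqrt n\<close> for fixed
  \<open>t\<close> and \<open>Q\<close>.\<close>

definition "\<kappa> = sqrt (E / (real n - 1))"

lemma idx_range: "idx a \<in> {1..n}"
  using bij_betwE[OF idx] card by (meson UNIV_I atLeastAtMost_iff order_trans)

lemma idx_eq: "idx a = idx b \<longleftrightarrow> a = b"
  using idx by (auto simp: bij_betw_def inj_on_def)

lemma S_apply: "(S *v x) $ a = x $ a / vr (idx a) + (\<Sum>b\<in>UNIV. x $ b) / vc n"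
proof -
  have "Smat n \<theta> (idx a) (idx b) = (if b = a then 1 / vr (idx a) else 0) + 1 / vc n" for b
    using Smat_block[of n "idx a" "idx b" \<theta>] idx_range n
    by (auto simp: idx_eq \<pi>_def)
  hence "(S *v x) $ a = (\<Sum>b\<in>UNIV. ((if b = a then 1 / vr (idx a) else 0) + 1 / vc n) * x $ b)"
    by (simp add: S_def matrix_vector_mult_def)
  also have "\<dots> = (\<Sum>b\<in>UNIV. if b = a then x $ b / vr (idx a) else 0) + (\<Sum>b\<in>UNIV. x $ b / vc n)"
    unfolding sum.distrib[symmetric] by (intro sum.cong refl) (simp add: algebra_simps)
  finally show ?thesis by (simp add: sum_divide_distrib)
qed

text \<open>The block of \<open>S\<close> is a positive diagonal matrix plus a positive multiple of
  the all-ones matrix; positive definiteness is read off from this form.\<close>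

lemma S_quadratic: "x \<bullet> (S *v x) = (\<Sum>a\<in>UNIV. (x $ a)\<^sup>2 / vr (idx a)) + (\<Sum>a\<in>UNIV. x $ a)\<^sup>2 / vc n"
proof -
  have "x \<bullet> (S *v x) = (\<Sum>a\<in>UNIV. (x $ a)\<^sup>2 / vr (idx a) + x $ a * ((\<Sum>b\<in>UNIV. x $ b) / vc n))"
    unfolding inner_vec_def S_apply
    by (intro sum.cong refl) (simp add: distrib_left power2_eq_square)
  also have "\<dots> = (\<Sum>a\<in>UNIV. (x $ a)\<^sup>2 / vr (idx a)) + (\<Sum>a\<in>UNIV. x $ a) * ((\<Sum>b\<in>UNIV. x $ b) / vc n)"
    by (simp only: sum.distrib sum_distrib_right)
  finally show ?thesis by (simp add: power2_eq_square)
qed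

lemma info_pos: "0 < vr (idx a)" "0 < vc n"
  using info_bounds(3)[OF idx_range] info_bounds(6)[of n] n by auto

lemma S_sym: "transpose S = S"
  by (simp add: S_def transpose_def vec_eq_iff Smat_def idx_eq)

lemma S_pos: "x \<noteq> 0 \<Longrightarrow> 0 < x \<bullet> (S *v x)"
proof -
  assume "x \<noteq> 0"
  then obtain a where "x $ a \<noteq> 0" by (auto simp: vec_eq_iff)
  hence "0 < (\<Sum>a\<in>UNIV. (x $ a)\<^sup>2 / vr (idx a))"
    using info_pos by (intro sum_pos2[of _ a] divide_pos_pos divide_nonneg_pos) auto
  moreover have "0 \<le> (\<Sum>a\<in>UNIV. x $ a)\<^sup>2 / vc n" using info_pos by (intro divide_nonneg_pos) auto
  ultimately show ?thesis unfolding S_quadratic by linarith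
qed

lemma norm_t: "(\<Sum>a\<in>UNIV. (y $ a)\<^sup>2 / vr (idx a)) + s\<^sup>2 / vc n = (norm t)\<^sup>2"
proof -
  let ?R = "inv_sqrt_mat S"
  have "t = (?R ** S ** ?R) *v t" using inv_sqrt_mat(2)[OF S_sym S_pos] by simp
  also have "\<dots> = ?R *v (S *v y)" by (simp add: y_def matrix_vector_mul_assoc matrix_mul_assoc)
  finally have "t \<bullet> t = y \<bullet> (S *v y)"
    using sym_matrix_inner[OF inv_sqrt_mat(1)[OF S_sym S_pos], of t "S *v y"] by (simp add: y_def)
  thus ?thesis unfolding S_quadratic s_def power2_norm_eq_inner by simp
qed

lemma y_bound: "(y $ a)\<^sup>2 / vr (idx a) \<le> (norm t)\<^sup>2" "s\<^sup>2 / vc n \<le> (norm t)\<^sup>2"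
proof -
  have nn: "0 \<le> (y $ a)\<^sup>2 / vr (idx a)" for a
    using info_pos by (intro divide_nonneg_pos) auto
  have "0 \<le> s\<^sup>2 / vc n" using info_pos by (intro divide_nonneg_pos) auto
  moreover have "(y $ a)\<^sup>2 / vr (idx a) \<le> (\<Sum>a\<in>UNIV. (y $ a)\<^sup>2 / vr (idx a))"
    using nn by (intro member_le_sum) auto
  ultimately show "(y $ a)\<^sup>2 / vr (idx a) \<le> (norm t)\<^sup>2" using norm_t by linarith
  show "s\<^sup>2 / vc n \<le> (norm t)\<^sup>2" using norm_t sum_nonneg[of UNIV "\<lambda>a. (y $ a)\<^sup>2 / vr (idx a)"] nn by simp
qed

lemma abs_y_bound: "\<bar>y $ a\<bar> \<le> norm t * sqrt (2 * p\<^sup>2 * real n)"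
proof -
  have "(y $ a)\<^sup>2 \<le> (norm t)\<^sup>2 * vr (idx a)"
    using y_bound(1)[of a] info_pos by (simp add: pos_divide_le_eq)
  also have "\<dots> \<le> (norm t)\<^sup>2 * (2 * p\<^sup>2 * real n)"
    using info_bounds(2)[OF idx_range] by (intro mult_left_mono) auto
  also have "\<dots> = (norm t * sqrt (2 * p\<^sup>2 * real n))\<^sup>2" by (simp add: power_mult_distrib)
  finally show ?thesis by (simp add: abs_le_square_iff[symmetric] abs_mult)
qed

lemma ratio_bound:
  assumes "x\<^sup>2 / v \<le> (norm t)\<^sup>2" "(real n - 1) / E \<le> v" "0 < v"
  shows "\<bar>x / v\<bar> \<le> norm t * \<kappa>"
proof -
  have "(x / v)\<^sup>2 = (x\<^sup>2 / v) / v" by (simp add: power_divide power2_eq_square)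
  also have "\<dots> \<le> (norm t)\<^sup>2 / ((real n - 1) / E)"
    using assms half_n by (intro frac_le) auto
  also have "\<dots> = (norm t * \<kappa>)\<^sup>2" using half_n by (simp add: \<kappa>_def power_mult_distrib)
  finally show ?thesis using half_n by (simp add: abs_le_square_iff[symmetric] abs_mult \<kappa>_def)
qed

lemma cf_sum: "(\<Sum>i\<in>{1..n}. cf i * f i) = (\<Sum>a\<in>UNIV. y $ a * f (idx a))"
proof -
  have "(\<Sum>i\<in>{1..n}. cf i * f i) = (\<Sum>i\<in>{1..n}. \<Sum>a\<in>UNIV. if idx a = i then y $ a * f i else 0)"
    unfolding cf_def sum_distrib_right by (intro sum.cong refl) simp
  also have "\<dots> = (\<Sum>a\<in>UNIV. \<Sum>i\<in>{1..n}. if idx a = i then y $ a * f i else 0)"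
    by (rule sum.swap)
  also have "\<dots> = (\<Sum>a\<in>UNIV. y $ a * f (idx a))"
    using idx_range by (intro sum.cong refl) (simp only: sum.delta' finite_atLeastAtMost if_True)
  finally show ?thesis .
qed

lemma cf_idx: "cf (idx a) = y $ a"
  unfolding cf_def by (simp add: idx_eq)

lemma cf_ratio: "\<bar>cf i / vr i\<bar> \<le> norm t * \<kappa>" if i: "i \<in> {1..n}"
proof (cases "i \<in> range idx")
  case True
  then obtain a where "i = idx a" by auto
  thus ?thesis using ratio_bound[OF y_bound(1)] info_bounds(1,3)[OF i] by (simp add: cf_idx)
next
  case False
  hence "cf i = 0" unfolding cf_def by (intro sum.neutral) auto
  thus ?thesis using half_n by (simp add: \<kappa>_def)
qed

lemma s_ratio: "\<bar>s / vc n\<bar> \<le> norm t * \<kappa>"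
  using ratio_bound[OF y_bound(2)] info_bounds(4,6)[of n] n by simp

lemma weight_abs: "x \<in> offdiag n \<Longrightarrow> \<bar>weight x\<bar> \<le> 2 * (norm t * \<kappa>)"
proof -
  assume "x \<in> offdiag n"
  then obtain i j where x: "x = (i, j)" "i \<in> {1..n}" by (auto simp: offdiag_def)
  have "\<bar>weight x\<bar> \<le> \<bar>cf i / vr i\<bar> + \<bar>if j = n then s / vc n else 0\<bar>"
    unfolding weight_def x prod.case abs_minus_cancel by (rule abs_triangle_ineq)
  also have "\<bar>if j = n then s / vc n else 0\<bar> \<le> norm t * \<kappa>" using order_trans[OF abs_ge_zero s_ratio] s_ratio by (cases "j = n") simp_all
  finally show ?thesis using cf_ratio[OF x(2)] by simp
qed

lemma weight_stat: "stat weight A = - (\<Sum>a\<in>UNIV. y $ a * (gr A (idx a) / vr (idx a) + gc A n / vc n))"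
proof -
  have "stat weight A = - (stat (\<lambda>(i, j). cf i / vr i) A + stat (\<lambda>(i, j). if j = n then s / vc n else 0) A)"
    unfolding lin_stat_def sum.distrib[symmetric] sum_negf[symmetric]
    by (intro sum.cong refl) (auto simp: weight_def algebra_simps)
  also have "stat (\<lambda>(i, j). cf i / vr i) A = (\<Sum>i\<in>{1..n}. cf i * (gr A i / vr i))"
    using stat_row_weights[of "\<lambda>i. cf i / vr i" A] by simp
  also have "\<dots> = (\<Sum>a\<in>UNIV. y $ a * (gr A (idx a) / vr (idx a)))" by (rule cf_sum)
  also have "stat (\<lambda>(i, j). if j = n then s / vc n else 0) A = s / vc n * gc A n"
    using stat_col_weights[of "\<lambda>j. if j = n then s / vc n else 0" A] sum_indicator[of n "s / vc n"] n by simp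
  also have "\<dots> = (\<Sum>a\<in>UNIV. y $ a * (gc A n / vc n))"
    by (simp add: s_def sum_distrib_right sum_divide_distrib)
  finally show ?thesis by (simp add: sum.distrib[symmetric] distrib_left)
qed

section \<open>The variance of the main term\<close>

definition "W = (\<Sum>x\<in>offdiag n. (weight x)\<^sup>2 * u_fun (case_prod \<pi> x))"

text \<open>The block of \<open>S\<close> is the covariance that the main term would have if
  out-degrees were uncorrelated with the in-degree of \<open>n\<close>. The entries
  \<open>(i, n)\<close> belong to both and produce the additional sum, which \<open>W_bound\<close>
  shows to be of order \<open>\<zeta>\<close>.\<close>

lemma W_eq: "W = (norm t)\<^sup>2 + 2 * (\<Sum>a\<in>UNIV. if idx a = n then 0 else (y $ a / vr (idx a)) * (s / vc n) * u_fun (\<pi> (idx a) n))"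
proof -
  define e where "e j = (if j = n then s / vc n else 0)" for j
  have "(weight (i, j))\<^sup>2 = (cf i / vr i)\<^sup>2 + (e j)\<^sup>2 + 2 * (cf i / vr i) * e j" for i j
    by (simp only: weight_def e_def prod.case power2_minus power2_sum)
  hence "W = (\<Sum>i\<in>{1..n}. \<Sum>j\<in>{1..n}-{i}. ((cf i / vr i)\<^sup>2 + (e j)\<^sup>2 + 2 * (cf i / vr i) * e j) * u_fun (\<pi> i j))"
    by (simp only: W_def sum_offdiag prod.case)
  also have "\<dots> = (\<Sum>i\<in>{1..n}. \<Sum>j\<in>{1..n}-{i}. (cf i / vr i)\<^sup>2 * u_fun (\<pi> i j))
      + (\<Sum>i\<in>{1..n}. \<Sum>j\<in>{1..n}-{i}. (e j)\<^sup>2 * u_fun (\<pi> i j))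
      + (\<Sum>i\<in>{1..n}. \<Sum>j\<in>{1..n}-{i}. 2 * (cf i / vr i) * e j * u_fun (\<pi> i j))"
    by (simp only: sum.distrib distrib_right)
  also have "(\<Sum>i\<in>{1..n}. \<Sum>j\<in>{1..n}-{i}. (cf i / vr i)\<^sup>2 * u_fun (\<pi> i j)) = (\<Sum>i\<in>{1..n}. cf i * (cf i / vr i))"
  proof (rule sum.cong[OF refl])
    fix i assume i: "i \<in> {1..n}"
    have "(\<Sum>j\<in>{1..n}-{i}. (cf i / vr i)\<^sup>2 * u_fun (\<pi> i j)) = (cf i / vr i)\<^sup>2 * vr i"
      by (simp only: row_info_def sum_distrib_left)
    thus "(\<Sum>j\<in>{1..n}-{i}. (cf i / vr i)\<^sup>2 * u_fun (\<pi> i j)) = cf i * (cf i / vr i)"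
      using info_bounds(3)[OF i] by (simp add: power2_eq_square)
  qed
  also have "\<dots> = (\<Sum>a\<in>UNIV. (y $ a)\<^sup>2 / vr (idx a))"
    unfolding cf_sum by (simp add: cf_idx power2_eq_square)
  also have "(\<Sum>i\<in>{1..n}. \<Sum>j\<in>{1..n}-{i}. (e j)\<^sup>2 * u_fun (\<pi> i j)) = (\<Sum>j\<in>{1..n}. (if j = n then (s / vc n)\<^sup>2 else 0) * vc j)"
    unfolding sum_offdiag_swap[of "\<lambda>i j. (e j)\<^sup>2 * u_fun (\<pi> i j)"]
    by (intro sum.cong refl) (simp add: col_info_def e_def flip: sum_distrib_left)
  also have "\<dots> = s\<^sup>2 / vc n"
    using sum_indicator[of n "(s / vc n)\<^sup>2" vc] n info_pos by (simp add: power2_eq_square)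
  also have "(\<Sum>i\<in>{1..n}. \<Sum>j\<in>{1..n}-{i}. 2 * (cf i / vr i) * e j * u_fun (\<pi> i j)) =
      (\<Sum>i\<in>{1..n}. cf i * (if i = n then 0 else 2 * (s / vc n) * u_fun (\<pi> i n) / vr i))"
  proof (rule sum.cong[OF refl])
    fix i assume i: "i \<in> {1..n}"
    have "(\<Sum>j\<in>{1..n}-{i}. 2 * (cf i / vr i) * e j * u_fun (\<pi> i j)) =
        (\<Sum>j\<in>{1..n}-{i}. if j = n then 2 * (cf i / vr i) * (s / vc n) * u_fun (\<pi> i j) else 0)"
      by (intro sum.cong refl) (simp add: e_def)
    also have "\<dots> = (if n \<in> {1..n}-{i} then 2 * (cf i / vr i) * (s / vc n) * u_fun (\<pi> i n) else 0)"
      by (subst sum.delta) auto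
    finally show "(\<Sum>j\<in>{1..n}-{i}. 2 * (cf i / vr i) * e j * u_fun (\<pi> i j)) =
        cf i * (if i = n then 0 else 2 * (s / vc n) * u_fun (\<pi> i n) / vr i)"
      using n by (auto simp: ac_simps)
  qed
  also have "\<dots> = 2 * (\<Sum>a\<in>UNIV. if idx a = n then 0 else (y $ a / vr (idx a)) * (s / vc n) * u_fun (\<pi> (idx a) n))"
    unfolding cf_sum sum_distrib_left by (intro sum.cong refl) (auto simp: ac_simps)
  finally show ?thesis using norm_t by simp
qed

lemma kappa_bounds: "p\<^sup>2 * \<kappa>\<^sup>2 \<le> 2 * \<zeta>" "p ^ 3 * E * \<kappa> \<le> 2 * \<zeta>" "0 \<le> \<kappa>"
proof -
  have p0: "0 < p" and n0: "0 < real n" using p n by auto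
  have sq: "sqrt (real n) \<le> real n" "0 < sqrt (real n)"
    using n by (auto intro!: real_le_lsqrt simp: self_le_power)
  have k2: "\<kappa>\<^sup>2 \<le> 2 * E / real n"
  proof -
    have "\<kappa>\<^sup>2 = E / (real n - 1)" using half_n by (simp add: \<kappa>_def)
    also have "\<dots> \<le> E / (real n / 2)" using half_n n0 by (intro divide_left_mono) auto
    finally show ?thesis by (simp add: mult.commute)
  qed
  have "p\<^sup>2 * \<kappa>\<^sup>2 \<le> 2 * (p\<^sup>2 * E ^ 1) / real n"
    using mult_left_mono[OF k2, of "p\<^sup>2"] by (simp add: ac_simps)
  also have "\<dots> \<le> 2 * (\<zeta> * sqrt (real n)) / sqrt (real n)"
    using \<zeta>_sqrt'[of 2 1] sq \<zeta>_pos by (intro frac_le mult_left_mono) auto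
  also have "\<dots> = 2 * \<zeta>" using sq by simp
  finally show "p\<^sup>2 * \<kappa>\<^sup>2 \<le> 2 * \<zeta>" .
  show k0: "0 \<le> \<kappa>" using half_n by (simp add: \<kappa>_def)
  have "\<kappa>\<^sup>2 \<le> (2 * E / sqrt (real n))\<^sup>2"
  proof -
    have "2 * E / real n \<le> (4 * (E * E)) / real n"
      using E_ge_1 mult_left_mono[of 1 E E] by (intro divide_right_mono) linarith+
    thus ?thesis using k2 n0 by (simp add: power_divide power_mult_distrib power2_eq_square)
  qed
  hence "\<kappa> \<le> 2 * E / sqrt (real n)" by (rule power2_le_imp_le) (use sq in simp)
  hence "p ^ 3 * E * \<kappa> \<le> p ^ 3 * E * (2 * E / sqrt (real n))" using p0 by (intro mult_left_mono) auto
  also have "\<dots> = 2 * (p ^ 3 * E\<^sup>2) / sqrt (real n)" by (simp add: power2_eq_square)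
  also have "\<dots> \<le> 2 * (\<zeta> * sqrt (real n)) / sqrt (real n)"
    using \<zeta>_sqrt'[of 3 2] sq by (intro divide_right_mono mult_left_mono) auto
  also have "\<dots> = 2 * \<zeta>" using sq by simp
  finally show "p ^ 3 * E * \<kappa> \<le> 2 * \<zeta>" .
qed

lemma W_bound: "\<bar>W - (norm t)\<^sup>2\<bar> \<le> 8 * CARD('k) * (norm t)\<^sup>2 * \<zeta>" "0 \<le> W" "W \<le> (1 + real CARD('k)) * (norm t)\<^sup>2"
proof -
  define f where "f a = (if idx a = n then 0 else (y $ a / vr (idx a)) * (s / vc n) * u_fun (\<pi> (idx a) n))" for a
  have "\<bar>f a\<bar> \<le> 4 * (norm t)\<^sup>2 * \<zeta>" for a
  proof (cases "idx a = n")
    case False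
    have ia: "idx a \<in> {1..n}" by (rule idx_range)
    have "\<bar>f a\<bar> = \<bar>y $ a / vr (idx a)\<bar> * \<bar>s / vc n\<bar> * u_fun (\<pi> (idx a) n)"
      using False u_bounds(3)[of "idx a" n] ia n by (simp add: f_def abs_mult)
    also have "\<dots> \<le> (norm t * \<kappa>) * (norm t * \<kappa>) * (2 * p\<^sup>2)"
    proof (rule mult_mono[OF mult_mono])
      show "\<bar>y $ a / vr (idx a)\<bar> \<le> norm t * \<kappa>" using cf_ratio[OF ia] by (simp only: cf_idx)
      show "\<bar>s / vc n\<bar> \<le> norm t * \<kappa>" by (rule s_ratio)
      have "idx a \<in> {1..n}" "n \<in> {1..n}" using ia n by auto
      note u = u_bounds[OF this False]
      show "u_fun (\<pi> (idx a) n) \<le> 2 * p\<^sup>2" "0 \<le> u_fun (\<pi> (idx a) n)" using u by simp_all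
    qed (use kappa_bounds(3) in simp_all)
    also have "\<dots> = 2 * (norm t)\<^sup>2 * (p\<^sup>2 * \<kappa>\<^sup>2)" by (simp add: power2_eq_square)
    also have "\<dots> \<le> 2 * (norm t)\<^sup>2 * (2 * \<zeta>)" using kappa_bounds(1) by (intro mult_left_mono) auto
    finally show ?thesis by simp
  qed (use \<zeta>_pos in \<open>simp add: f_def\<close>)
  hence "\<bar>\<Sum>a\<in>UNIV. f a\<bar> \<le> (\<Sum>a\<in>(UNIV :: 'k set). 4 * (norm t)\<^sup>2 * \<zeta>)"
    by (intro order.trans[OF sum_abs] sum_mono)
  hence "2 * \<bar>\<Sum>a\<in>UNIV. f a\<bar> \<le> 8 * CARD('k) * (norm t)\<^sup>2 * \<zeta>" by (simp add: ac_simps)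
  thus *: "\<bar>W - (norm t)\<^sup>2\<bar> \<le> 8 * CARD('k) * (norm t)\<^sup>2 * \<zeta>"
    unfolding W_eq f_def[symmetric] by (simp add: abs_mult)
  have "8 * CARD('k) * (norm t)\<^sup>2 * \<zeta> = CARD('k) * (norm t)\<^sup>2 * (8 * \<zeta>)" by simp
  also have "\<dots> \<le> CARD('k) * (norm t)\<^sup>2 * 1" using \<zeta> by (intro mult_left_mono) auto
  finally have "W \<le> 1 * (norm t)\<^sup>2 + CARD('k) * (norm t)\<^sup>2" using * by linarith
  thus "W \<le> (1 + real CARD('k)) * (norm t)\<^sup>2" by (simp only: distrib_right[symmetric] of_nat_1)
  show "0 \<le> W"
    unfolding W_def
  proof (rule sum_nonneg)
    fix x assume "x \<in> offdiag n"
    hence "0 < u_fun (case_prod \<pi> x)" using u_bounds(3) by (auto simp: offdiag_def)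
    thus "0 \<le> (weight x)\<^sup>2 * u_fun (case_prod \<pi> x)" by simp
  qed
qed

text \<open>Each error term of \<open>lin_stat_char\<close> is at most a multiple of
  \<open>\<zeta>\<close> times the corresponding summand of \<open>W\<close>. Summation yields
  \<open>\<zeta> * W\<close> with bounded \<open>W\<close>, so the number of entries, of order
  \<open>n^2\<close>, does not enter.\<close>

lemma stat_char:
  "cmod ((\<integral>A. iexp (stat weight A) \<partial>measure_pmf M) - exp (- (norm t)\<^sup>2 / 2))
    \<le> ((576 * norm t + 2 * (norm t)\<^sup>2) * (1 + real CARD('k)) * (norm t)\<^sup>2 + 4 * CARD('k) * (norm t)\<^sup>2) * \<zeta>"
proof -
  have p0: "0 < p" using p by simp
  have "cmod ((\<integral>A. iexp (stat weight A) \<partial>measure_pmf M) - complex_of_real (exp (- W / 2)))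
      \<le> (\<Sum>x\<in>offdiag n. 144 * p ^ 3 * \<bar>weight x\<bar> ^ 3 + ((weight x)\<^sup>2 * u_fun (case_prod \<pi> x))\<^sup>2 / 8)"
    unfolding M_eq W_def by (rule lin_stat_char[OF finite_offdiag p offdiag_rate])
  also have "\<dots> \<le> (\<Sum>x\<in>offdiag n. (576 * norm t + 2 * (norm t)\<^sup>2) * \<zeta> * ((weight x)\<^sup>2 * u_fun (case_prod \<pi> x)))"
  proof (rule sum_mono)
    fix x assume x: "x \<in> offdiag n"
    define u where "u = u_fun (case_prod \<pi> x)"
    have u: "1 / E \<le> u" "u \<le> 2 * p\<^sup>2" "0 < u"
      using x u_bounds by (auto simp: u_def offdiag_def)
    \<comment> \<open>The factor \<open>E * u\<close> is inserted into the cubic term, which carries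
      no \<open>u\<close> of its own.\<close>
    have Eu: "1 \<le> E * u" using u by (simp add: field_simps)
    note w = weight_abs[OF x]
    have "144 * p ^ 3 * \<bar>weight x\<bar> ^ 3 = 144 * p ^ 3 * (\<bar>weight x\<bar> * ((weight x)\<^sup>2 * 1))"
      by (simp add: power3_eq_cube power2_eq_square)
    also have "\<dots> \<le> 144 * p ^ 3 * ((2 * (norm t * \<kappa>)) * ((weight x)\<^sup>2 * (E * u)))"
      using w Eu p0 kappa_bounds(3) by (intro mult_left_mono mult_mono) auto
    also have "\<dots> = 288 * norm t * (p ^ 3 * E * \<kappa>) * ((weight x)\<^sup>2 * u)" by (simp add: ac_simps)
    also have "\<dots> \<le> 288 * norm t * (2 * \<zeta>) * ((weight x)\<^sup>2 * u)"
      using kappa_bounds(2) u by (intro mult_right_mono mult_left_mono) auto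
    finally have a: "144 * p ^ 3 * \<bar>weight x\<bar> ^ 3 \<le> 576 * norm t * \<zeta> * ((weight x)\<^sup>2 * u)" by simp
    have "((weight x)\<^sup>2 * u)\<^sup>2 / 8 = ((weight x)\<^sup>2 * u) / 8 * ((weight x)\<^sup>2 * u)"
      by (simp add: power2_eq_square)
    also have "\<dots> \<le> ((2 * (norm t * \<kappa>))\<^sup>2 * (2 * p\<^sup>2)) / 8 * ((weight x)\<^sup>2 * u)"
    proof (intro mult_right_mono divide_right_mono mult_mono)
      show "(weight x)\<^sup>2 \<le> (2 * (norm t * \<kappa>))\<^sup>2" using w by (metis abs_ge_zero power2_abs power_mono)
    qed (use u in auto)
    also have "\<dots> = (norm t)\<^sup>2 * (p\<^sup>2 * \<kappa>\<^sup>2) * ((weight x)\<^sup>2 * u)" by (simp add: power_mult_distrib ac_simps)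
    also have "\<dots> \<le> (norm t)\<^sup>2 * (2 * \<zeta>) * ((weight x)\<^sup>2 * u)"
      using kappa_bounds(1) u by (intro mult_right_mono mult_left_mono) auto
    finally have b: "((weight x)\<^sup>2 * u)\<^sup>2 / 8 \<le> (norm t)\<^sup>2 * (2 * \<zeta>) * ((weight x)\<^sup>2 * u)" .
    have "576 * norm t * \<zeta> * ((weight x)\<^sup>2 * u) + (norm t)\<^sup>2 * (2 * \<zeta>) * ((weight x)\<^sup>2 * u) =
        (576 * norm t + 2 * (norm t)\<^sup>2) * \<zeta> * ((weight x)\<^sup>2 * u)"
      by (simp add: algebra_simps)
    thus "144 * p ^ 3 * \<bar>weight x\<bar> ^ 3 + ((weight x)\<^sup>2 * u_fun (case_prod \<pi> x))\<^sup>2 / 8 \<le>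
        (576 * norm t + 2 * (norm t)\<^sup>2) * \<zeta> * ((weight x)\<^sup>2 * u_fun (case_prod \<pi> x))"
      using add_mono[OF a b] unfolding u_def by simp
  qed
  also have "\<dots> = (576 * norm t + 2 * (norm t)\<^sup>2) * \<zeta> * W"
    by (simp add: W_def sum_distrib_left)
  also have "\<dots> \<le> (576 * norm t + 2 * (norm t)\<^sup>2) * \<zeta> * ((1 + real CARD('k)) * (norm t)\<^sup>2)"
    using W_bound(3) \<zeta>_pos by (intro mult_left_mono) auto
  finally have 1: "cmod ((\<integral>A. iexp (stat weight A) \<partial>measure_pmf M) - complex_of_real (exp (- W / 2)))
    \<le> (576 * norm t + 2 * (norm t)\<^sup>2) * (1 + real CARD('k)) * (norm t)\<^sup>2 * \<zeta>" by (simp add: ac_simps)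
  have "\<bar>exp (- (W / 2)) - exp (- ((norm t)\<^sup>2 / 2))\<bar> \<le> \<bar>W / 2 - (norm t)\<^sup>2 / 2\<bar>"
    using W_bound(2) by (intro exp_minus_lipschitz) auto
  also have "\<dots> \<le> 4 * CARD('k) * (norm t)\<^sup>2 * \<zeta>" using W_bound(1) by (simp flip: diff_divide_distrib)
  finally have 2: "cmod (complex_of_real (exp (- W / 2)) - exp (- (norm t)\<^sup>2 / 2))
      \<le> 4 * CARD('k) * (norm t)\<^sup>2 * \<zeta>"
    by (simp flip: of_real_diff)
  show ?thesis
    using norm_triangle_mono[OF 1 2] by (simp add: distrib_right)
qed

text \<open>On \<open>good\<close> the two phases differ by at most \<open>D\<close>, and characters
  are 1-Lipschitz in the phase. Outside it nothing is known about the estimate, but the integrands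
  differ by at most 2, which costs \<open>2 * (8 / n)\<close>.\<close>

lemma mle_char:
  assumes est: "\<And>A. (\<exists>\<theta>'. is_mle n A \<theta>') \<longrightarrow> is_mle n A (e A)"
  defines "X \<equiv> \<lambda>A. inv_sqrt_mat S *v (\<chi> a. e A (idx a) - \<theta> (idx a))"
  shows "cmod ((\<integral>A. iexp (t \<bullet> X A) \<partial>measure_pmf M) - exp (- (norm t)\<^sup>2 / 2))
    \<le> ((576 * norm t + 2 * (norm t)\<^sup>2) * (1 + real CARD('k)) * (norm t)\<^sup>2 + 4 * CARD('k) * (norm t)\<^sup>2
        + CARD('k) * norm t * 10 ^ 12) * \<zeta> + 16 / real n"
proof -
  define D where "D = CARD('k) * norm t * 10 ^ 12 * \<zeta>"
  have D0: "0 \<le> D" using \<zeta>_pos by (simp add: D_def)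
  have close: "\<bar>t \<bullet> X A - stat weight A\<bar> \<le> D" if "A \<in> good" for A
  proof -
    have "t \<bullet> X A = y \<bullet> (\<chi> a. e A (idx a) - \<theta> (idx a))"
      unfolding X_def y_def using sym_matrix_inner[OF inv_sqrt_mat(1)[OF S_sym S_pos]] by simp
    hence eq: "t \<bullet> X A - stat weight A =
        (\<Sum>a\<in>UNIV. y $ a * (e A (idx a) - \<theta> (idx a) + gr A (idx a) / vr (idx a) + gc A n / vc n))"
      unfolding weight_stat inner_vec_def by (simp add: sum.distrib[symmetric] algebra_simps)
    have "\<bar>t \<bullet> X A - stat weight A\<bar> \<le> (\<Sum>a\<in>(UNIV :: 'k set). norm t * sqrt (2 * p\<^sup>2 * real n) * \<eta>)"
      unfolding eq
    proof (rule order.trans[OF sum_abs], rule sum_mono)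
      fix a
      show "\<bar>y $ a * (e A (idx a) - \<theta> (idx a) + gr A (idx a) / vr (idx a) + gc A n / vc n)\<bar>
          \<le> norm t * sqrt (2 * p\<^sup>2 * real n) * \<eta>"
        unfolding abs_mult
        by (rule mult_mono[OF abs_y_bound mle_expansion[OF that est idx_range]]) simp_all
    qed
    also have "\<dots> = CARD('k) * norm t * (sqrt (2 * p\<^sup>2 * real n) * \<eta>)"
      by (simp only: sum_constant mult.assoc)
    also have "\<dots> \<le> CARD('k) * norm t * (10 ^ 12 * \<zeta>)"
      using eta_bound by (intro mult_left_mono) auto
    finally show ?thesis by (simp only: D_def mult.assoc)
  qed
  have int: "integrable (measure_pmf M) (\<lambda>A. iexp (f A))" for f :: "_ \<Rightarrow> real"
    by (rule measure_pmf.integrable_const_bound[of _ 1]) auto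
  have ind: "integrable (measure_pmf M) (indicator (- good) :: _ \<Rightarrow> real)"
    by (rule measure_pmf.integrable_const_bound[of _ 1]) (auto simp: indicator_def)
  have "cmod ((\<integral>A. iexp (t \<bullet> X A) \<partial>measure_pmf M) - (\<integral>A. iexp (stat weight A) \<partial>measure_pmf M)) =
      cmod (\<integral>A. iexp (t \<bullet> X A) - iexp (stat weight A) \<partial>measure_pmf M)"
    by (subst Bochner_Integration.integral_diff[OF int int]) simp
  also have "\<dots> \<le> (\<integral>A. cmod (iexp (t \<bullet> X A) - iexp (stat weight A)) \<partial>measure_pmf M)"
    by (rule integral_norm_bound)
  also have "\<dots> \<le> (\<integral>A. D + 2 * indicator (- good) A \<partial>measure_pmf M)"
  proof (rule integral_mono)
    show "integrable (measure_pmf M) (\<lambda>A. cmod (iexp (t \<bullet> X A) - iexp (stat weight A)))"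
      by (intro integrable_norm Bochner_Integration.integrable_diff int)
    show "integrable (measure_pmf M) (\<lambda>A. D + 2 * indicator (- good) A)" using ind by simp
    fix A
    show "cmod (iexp (t \<bullet> X A) - iexp (stat weight A)) \<le> D + 2 * indicator (- good) A"
    proof (cases "A \<in> good")
      case True
      thus ?thesis using iexp_lipschitz[of "t \<bullet> X A" "stat weight A"] close[OF True] by simp
    next
      case False
      have "cmod (iexp (t \<bullet> X A) - iexp (stat weight A)) \<le> cmod (iexp (t \<bullet> X A)) + cmod (iexp (stat weight A))"
        by (rule norm_triangle_ineq4)
      thus ?thesis using False D0 by simp
    qed
  qed
  also have "\<dots> = D + 2 * measure M (- good)"
    using ind by simp
  also have "\<dots> \<le> D + 16 / real n" using good_prob by simp
  finally have "cmod ((\<integral>A. iexp (t \<bullet> X A) \<partial>measure_pmf M) - (\<integral>A. iexp (stat weight A) \<partial>measure_pmf M))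
      \<le> D + 16 / real n" .
  from norm_triangle_mono[OF this stat_char] show ?thesis
    by (simp add: D_def distrib_right)
qed

end

section \<open>Passage to the limit along the sequence of models\<close>

theorem theorem6:
  fixes \<theta>s :: "nat \<Rightarrow> nat \<Rightarrow> real" and q Q :: "nat \<Rightarrow> real"
    and est :: "nat \<Rightarrow> (nat \<times> nat \<Rightarrow> nat) \<Rightarrow> nat \<Rightarrow> real"
    and idx :: "'k::finite \<Rightarrow> nat"
  assumes qQ: "\<forall>n. 0 < q n \<and> q n \<le> Q n"
    and bounds: "\<forall>n i j. i \<in> {1..n} \<and> j \<in> {1..n} \<and> i \<noteq> j \<longrightarrow>
                   q n \<le> alpha (\<theta>s n) i + beta n (\<theta>s n) j \<and>
                   alpha (\<theta>s n) i + beta n (\<theta>s n) j \<le> Q n"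
    and rate: "(\<lambda>n. exp (9 * Q n) * (1 + q n powr (-15))) \<in> o(\<lambda>n. sqrt (real n) / ln (real n))"
    and mle: "\<forall>n A. (\<exists>\<theta>. is_mle n A \<theta>) \<longrightarrow> is_mle n A (est n A)"
    and idx: "bij_betw idx UNIV {1..CARD('k)}"
  shows "conv_in_distr (\<lambda>n. measure_pmf (geom_model n (\<theta>s n)))
           (\<lambda>n A. inv_sqrt_mat (\<chi> a b. Smat n (\<theta>s n) (idx a) (idx b))
                    *v (\<chi> a. est n A (idx a) - \<theta>s n (idx a)))
           std_normal_vec"
proof (rule conv_in_distr_std_normal_vecI)
  let ?X = "\<lambda>n A. inv_sqrt_mat (\<chi> a b. Smat n (\<theta>s n) (idx a) (idx b))
      *v (\<chi> a. est n A (idx a) - \<theta>s n (idx a))"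
  fix t :: "real^'k"
  define \<zeta> where "\<zeta> n = exp (9 * Q n) * (1 + q n powr (-15)) / (sqrt (real n) / ln (real n))" for n
  define C where "C = (576 * norm t + 2 * (norm t)\<^sup>2) * (1 + real CARD('k)) * (norm t)\<^sup>2 + 4 * CARD('k) * (norm t)\<^sup>2
        + CARD('k) * norm t * 10 ^ 12"
  have \<zeta>: "\<zeta> \<longlonglongrightarrow> 0"
    unfolding \<zeta>_def by (rule smalloD_tendsto[OF rate])
  have "eventually (\<lambda>n. \<zeta> n < 1 / 40000) sequentially"
    using \<zeta> by (rule order_tendstoD) simp
  \<comment> \<open>From 3 on the maximum principle and uniqueness apply; from
    \<open>CARD('k)\<close> on the first coordinates all belong to the \<open>\<alpha>\<close>
    part.\<close>
  hence "eventually (\<lambda>n. cmod ((\<integral>A. iexp (t \<bullet> ?X n A) \<partial>measure_pmf (geom_model n (\<theta>s n)))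
      - exp (- (norm t)\<^sup>2 / 2)) \<le> C * \<zeta> n + 16 / real n) sequentially"
    using eventually_ge_at_top[of "max 3 CARD('k)"]
  proof eventually_elim
    case (elim n)
    \<comment> \<open>\<open>p^15\<close> is either 1 or \<open>q^(-15)\<close>, hence at most their
      sum, the factor in the rate hypothesis; the maximum with 1 makes powers of \<open>p\<close>
      increasing in the exponent.\<close>
    define p where "p = max 1 (1 / q n)"
    have q: "0 < q n" using qQ by auto
    have p: "1 \<le> p" "1 / p \<le> q n"
      using q by (auto simp: p_def max_def field_simps)
    interpret projection_setting n "\<theta>s n" p "Q n" "\<zeta> n" idx t
    proof
      show "1 / p \<le> rate_at n (\<theta>s n) i j \<and> rate_at n (\<theta>s n) i j \<le> Q n"
        if "i \<in> {1..n}" "j \<in> {1..n}" "i \<noteq> j" for i j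
        using bounds that p(2) by (meson order_trans)
      have "p ^ 15 \<le> 1 + q n powr (-15)"
      proof (cases "1 \<le> q n")
        case True
        thus ?thesis by (simp add: p_def max_def)
      next
        case False
        hence "p = 1 / q n" using q by (simp add: p_def max_def)
        moreover have "q n powr (-15) = (1 / q n) ^ 15"
          using q powr_realpow[OF q, of 15] by (simp add: powr_minus power_divide inverse_eq_divide)
        ultimately show ?thesis by simp
      qed
      moreover have "exp (Q n) ^ 9 = exp (9 * Q n)" by (simp add: exp_of_nat_mult[symmetric])
      ultimately have "p ^ 15 * exp (Q n) ^ 9 \<le> exp (9 * Q n) * (1 + q n powr (-15))"
        by (simp add: mult.commute)
      hence "p ^ 15 * exp (Q n) ^ 9 * ln (real n) / sqrt (real n) \<le>
          exp (9 * Q n) * (1 + q n powr (-15)) * ln (real n) / sqrt (real n)"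
        using elim by (intro divide_right_mono mult_right_mono) auto
      thus "p ^ 15 * exp (Q n) ^ 9 * ln (real n) / sqrt (real n) \<le> \<zeta> n" by (simp add: \<zeta>_def)
    qed (use elim p idx in auto)
    have "(\<exists>\<theta>'. is_mle n A \<theta>') \<longrightarrow> is_mle n A (est n A)" for A using mle by blast
    from mle_char[of "est n", OF this] show ?case unfolding C_def S_def .
  qed
  moreover have "(\<lambda>n. C * \<zeta> n + 16 / real n) \<longlonglongrightarrow> 0"
  proof -
    have "(\<lambda>n. C * \<zeta> n + 16 / real n) \<longlonglongrightarrow> C * 0 + 0"
      by (intro tendsto_intros \<zeta> real_tendsto_divide_at_top[OF tendsto_const] filterlim_real_sequentially)
    thus ?thesis by simp
  qed
  ultimately have "(\<lambda>n. (\<integral>A. iexp (t \<bullet> ?X n A) \<partial>measure_pmf (geom_model n (\<theta>s n)))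
      - exp (- (norm t)\<^sup>2 / 2)) \<longlonglongrightarrow> 0"
    by (rule Lim_null_comparison)
  thus "(\<lambda>n. \<integral>A. iexp (t \<bullet> ?X n A) \<partial>measure_pmf (geom_model n (\<theta>s n)))
      \<longlonglongrightarrow> exp (- (norm t)\<^sup>2 / 2)"
    by (rule LIM_zero_cancel)
qed (auto intro: measure_pmf.prob_space_axioms)

end
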